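(* Consider the real scalar fading channel $Y_i=H_iX_i+Z_i$ described in the context, where the fading process $H_1,H_2,\dots$ is narrow-sense stationary and satisfies: (1) $E\{H_i^2\}=1$; (2) the marginal distribution of $H_i$ is a regular fading distribution; (3) either the process is strong mixing with $\alpha_H(n)\le Ke^{-\beta n}$, or it is complete regular with $\rho_H(n)\le Ke^{-\beta n}$, for some positive constants $K,\beta$; (4) $E\left\{\left|\tfrac12\ln(H_1^2)-E\{\tfrac12\ln(H_1^2)\}\right|^3\right\}<\infty$. Let $\epsilon>0$ be fixed and let $\delta^*(n,\epsilon)$ be the supremum of NLDs of $n$-dimensional infinite constellations with average error probability at most $\epsilon$. Then, as $n\to\infty$, $$\delta^*(n,\epsilon)=\delta^*-\sqrt{\frac{V}{n}}Q^{-1}(\epsilon)+O\!\left(\frac{\ln^2 n}{n}\right),$$ where $\delta^*=E\left\{\tfrac12\ln\!\left(\tfrac{H^2}{2\pi e\sigma^2}\right)\right\}$ and $$V=\tfrac12+\lim_{n\to\infty}\tfrac1n\mathrm{Var}\!\left(\sum_{i=1}^n\tfrac12\ln(H_i^2)\right)=\tfrac12+S_{\frac12\ln(H^2)}(e^{j\omega})\big|_{\omega=0}=\tfrac12+\mathrm{Var}\!\left(\tfrac12\ln(H_1^2)\right)+2\sum_{k=1}^\infty R_{\frac12\ln(H^2)}(k).$$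
   Context: Channel: $Y_i=H_iX_i+Z_i$ with $\{Z_i\}$ i.i.d. $N(0,\sigma^2)$, inputs, fading process and noise mutually independent, nonnegative fading, receiver knows $\mathbf H=\mathrm{diag}(H_1,\dots,H_n)$. A fading PDF $f$ is a regular fading distribution if there is $\alpha>0$ with $f(h)\propto h^{\alpha-1}$ for all sufficiently small $h>0$. Strong mixing coefficient: $\alpha_H(n)=\sup|P(A\cap B)-P(A)P(B)|$ over $A$ in the $\sigma$-algebra generated by $\{H_i:i\le k\}$ and $B$ in that generated by $\{H_i:i\ge k+n\}$; complete regularity coefficient $\rho_H(n)=\sup|\mathrm{Corr}(f,g)|$ over square-integrable random variables $f,g$ measurable with respect to these two $\sigma$-algebras respectively. With $X_i=\frac12\ln(H_i^2)$: $R_{\frac12\ln(H^2)}(k)=E\{(X_{k+1}-EX_{k+1})(X_1-EX_1)\}$ and $S_{\frac12\ln(H^2)}(e^{j\omega})=\sum_{k=-\infty}^\infty R_{\frac12\ln(H^2)}(k)e^{-j\omega k}$. ICs: countable $S\subset\mathbb R^n$; $\mathrm{Cb}(a)=\{\mathbf x:|x_i|<a/2\}$; density $\gamma=\limsup_a|S\cap\mathrm{Cb}(a)|/a^n$; NLD $\delta=\frac1n\ln\gamma$. Average error probability $P_e(S)=E\{\limsup_{a\to\infty}\frac{1}{M(S_{\mathbf H},a)}\sum_{s_{rc}\in S_{\mathbf H}\cap\mathbf H\mathrm{Cb}(a)}\Pr\{s_{rc}+\mathbf z\notin W(s_{rc})\mid\mathbf H\}\}$ where $S_{\mathbf H}=\{\mathbf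 Hs:s\in S\}$, $M(S_{\mathbf H},a)=|S_{\mathbf H}\cap\mathbf H\mathrm{Cb}(a)|$, and $W(s_{rc})$ is the Voronoi cell of $s_{rc}$ in $S_{\mathbf H}$. $Q$ is the standard Gaussian complementary CDF. *)

theory Defs
  imports "HOL-Probability.Probability" "HOL-Library.Landau_Symbols"
begin

definition Rn :: "nat \<Rightarrow> (nat \<Rightarrow> real) set" where
  "Rn n = {x. \<forall>i\<ge>n. x i = 0}"

definition Cb :: "nat \<Rightarrow> real \<Rightarrow> (nat \<Rightarrow> real) set" where
  "Cb n a = {x \<in> Rn n. \<forall>i<n. \<bar>x i\<bar> < a / 2}"

definition sqdist :: "nat \<Rightarrow> (nat \<Rightarrow> real) \<Rightarrow> (nat \<Rightarrow> real) \<Rightarrow> real" where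
  "sqdist n x y = (\<Sum>i<n. (x i - y i)^2)"

definition is_IC :: "nat \<Rightarrow> (nat \<Rightarrow> real) set \<Rightarrow> bool" where
  "is_IC n S \<longleftrightarrow> countable S \<and> S \<subseteq> Rn n"

definition ecount :: "'a set \<Rightarrow> ereal" where
  "ecount A = (if finite A then ereal (real (card A)) else \<infinity>)"

definition IC_density :: "nat \<Rightarrow> (nat \<Rightarrow> real) set \<Rightarrow> ereal" where
  "IC_density n S = Limsup at_top (\<lambda>a::real. ecount (S \<inter> Cb n a) / ereal (a ^ n))"

definition NLD :: "nat \<Rightarrow> (nat \<Rightarrow> real) set \<Rightarrow> ereal" where
  "NLD n S = (let \<gamma> = IC_density n S in
     if \<gamma> = 0 then -\<infinity> else if \<gamma> = \<infinity> then \<infinity>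
     else ereal (ln (real_of_ereal \<gamma>) / real n))"

definition chmap :: "(nat \<Rightarrow> real) \<Rightarrow> (nat \<Rightarrow> real) \<Rightarrow> (nat \<Rightarrow> real)" where
  "chmap h x = (\<lambda>i. h i * x i)"

definition noise :: "nat \<Rightarrow> real \<Rightarrow> (nat \<Rightarrow> real) measure" where
  "noise n \<sigma> = PiM {..<n} (\<lambda>_. density lborel (normal_density 0 \<sigma>))"

definition voronoi :: "nat \<Rightarrow> (nat \<Rightarrow> real) set \<Rightarrow> (nat \<Rightarrow> real) \<Rightarrow> (nat \<Rightarrow> real) set" where
  "voronoi n SH y = {r. \<forall>y'\<in>SH. sqdist n r y \<le> sqdist n r y'}"

definition err_cond :: "nat \<Rightarrow> real \<Rightarrow> (nat \<Rightarrow> real) set \<Rightarrow> (nat \<Rightarrow> real) \<Rightarrow> real" where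
  "err_cond n \<sigma> SH y =
     measure (noise n \<sigma>) {z \<in> space (noise n \<sigma>). (\<lambda>i. y i + z i) \<notin> voronoi n SH y}"

definition avg_err_given :: "nat \<Rightarrow> real \<Rightarrow> (nat \<Rightarrow> real) set \<Rightarrow> (nat \<Rightarrow> real) \<Rightarrow> real" where
  "avg_err_given n \<sigma> S h = real_of_ereal (Limsup at_top (\<lambda>a::real.
     let SH = chmap h ` S; C = SH \<inter> chmap h ` Cb n a
     in ereal ((\<Sum>y\<in>C. err_cond n \<sigma> SH y) / real (card C))))"

definition avg_err :: "'a measure \<Rightarrow> (nat \<Rightarrow> 'a \<Rightarrow> real) \<Rightarrow> nat \<Rightarrow> real \<Rightarrow> (nat \<Rightarrow> real) set \<Rightarrow> ennreal" where
  "avg_err M H n \<sigma> S = (\<integral>\<^sup>+ \<omega>. ennreal (avg_err_given n \<sigma> S (\<lambda>i. H i \<omega>)) \<partial>M)"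

text \<open>delta*(n, eps): supremum of NLDs of n-dimensional ICs with P_e <= eps.
  Only ICs with finitely many points in every cube are considered (otherwise the
  average in the definition of P_e is meaningless).\<close>
definition opt_NLD :: "'a measure \<Rightarrow> (nat \<Rightarrow> 'a \<Rightarrow> real) \<Rightarrow> real \<Rightarrow> nat \<Rightarrow> real \<Rightarrow> ereal" where
  "opt_NLD M H \<sigma> n \<epsilon> = Sup {NLD n S | S. is_IC n S \<and> (\<forall>a. finite (S \<inter> Cb n a))
                                     \<and> avg_err M H n \<sigma> S \<le> ennreal \<epsilon>}"

definition stationary_proc :: "'a measure \<Rightarrow> (nat \<Rightarrow> 'a \<Rightarrow> real) \<Rightarrow> bool" where
  "stationary_proc M H \<longleftrightarrow> (\<forall>k. distr M (PiM UNIV (\<lambda>_::nat. borel)) (\<lambda>\<omega> i. H (i + k) \<omega>)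
                               = distr M (PiM UNIV (\<lambda>_::nat. borel)) (\<lambda>\<omega> i. H i \<omega>))"

definition regular_fading_pdf :: "(real \<Rightarrow> real) \<Rightarrow> bool" where
  "regular_fading_pdf f \<longleftrightarrow> (\<exists>\<alpha>>0. \<exists>c>0. \<exists>h0>0. \<forall>h. 0 < h \<and> h < h0 \<longrightarrow> f h = c * h powr (\<alpha> - 1))"

definition past_gen :: "'a measure \<Rightarrow> (nat \<Rightarrow> 'a \<Rightarrow> real) \<Rightarrow> nat \<Rightarrow> 'a set set" where
  "past_gen M H k = {H i -` A \<inter> space M | i A. i \<le> k \<and> A \<in> sets borel}"

definition future_gen :: "'a measure \<Rightarrow> (nat \<Rightarrow> 'a \<Rightarrow> real) \<Rightarrow> nat \<Rightarrow> 'a set set" where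
  "future_gen M H m = {H i -` A \<inter> space M | i A. m \<le> i \<and> A \<in> sets borel}"

definition strong_mixing_coeff :: "'a measure \<Rightarrow> (nat \<Rightarrow> 'a \<Rightarrow> real) \<Rightarrow> nat \<Rightarrow> real" where
  "strong_mixing_coeff M H n = Sup {\<bar>measure M (A \<inter> B) - measure M A * measure M B\<bar> | k A B.
      A \<in> sigma_sets (space M) (past_gen M H k) \<and> B \<in> sigma_sets (space M) (future_gen M H (k + n))}"

definition var :: "'a measure \<Rightarrow> ('a \<Rightarrow> real) \<Rightarrow> real" where
  "var M f = (\<integral>x. (f x - (\<integral>y. f y \<partial>M))^2 \<partial>M)"

definition correlation :: "'a measure \<Rightarrow> ('a \<Rightarrow> real) \<Rightarrow> ('a \<Rightarrow> real) \<Rightarrow> real" where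
  "correlation M f g = ((\<integral>x. f x * g x \<partial>M) - (\<integral>x. f x \<partial>M) * (\<integral>x. g x \<partial>M))
                        / sqrt (var M f * var M g)"

definition complete_regularity_coeff :: "'a measure \<Rightarrow> (nat \<Rightarrow> 'a \<Rightarrow> real) \<Rightarrow> nat \<Rightarrow> real" where
  "complete_regularity_coeff M H n = Sup {\<bar>correlation M f g\<bar> | k f g.
      f \<in> borel_measurable (sigma (space M) (past_gen M H k)) \<and>
      g \<in> borel_measurable (sigma (space M) (future_gen M H (k + n))) \<and>
      integrable M (\<lambda>x. (f x)^2) \<and> integrable M (\<lambda>x. (g x)^2) \<and> var M f > 0 \<and> var M g > 0}"

text \<open>X_i = 1/2 ln(H_i^2) (index i here corresponds to i+1 in the paper).\<close>
definition lnH :: "(nat \<Rightarrow> 'a \<Rightarrow> real) \<Rightarrow> nat \<Rightarrow> 'a \<Rightarrow> real" where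
  "lnH H i \<omega> = ln ((H i \<omega>)^2) / 2"

definition autocov :: "'a measure \<Rightarrow> (nat \<Rightarrow> 'a \<Rightarrow> real) \<Rightarrow> nat \<Rightarrow> real" where
  "autocov M H k = (\<integral>\<omega>. (lnH H k \<omega> - (\<integral>\<omega>'. lnH H k \<omega>' \<partial>M))
                         * (lnH H 0 \<omega> - (\<integral>\<omega>'. lnH H 0 \<omega>' \<partial>M)) \<partial>M)"

definition cap_star :: "'a measure \<Rightarrow> (nat \<Rightarrow> 'a \<Rightarrow> real) \<Rightarrow> real \<Rightarrow> real" where
  "cap_star M H \<sigma> = (\<integral>\<omega>. ln ((H 0 \<omega>)^2 / (2 * pi * exp 1 * \<sigma>^2)) / 2 \<partial>M)"

definition dispersion :: "'a measure \<Rightarrow> (nat \<Rightarrow> 'a \<Rightarrow> real) \<Rightarrow> real" where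
  "dispersion M H = 1/2 + var M (lnH H 0) + 2 * (\<Sum>k. autocov M H (Suc k))"

definition Qfun :: "real \<Rightarrow> real" where
  "Qfun x = measure (density lborel std_normal_density) {x<..}"

definition Qinv :: "real \<Rightarrow> real" where
  "Qinv \<epsilon> = (THE x. Qfun x = \<epsilon>)"

end

(*
  Given the fading H, a Gaussian noise vector Z is decoded wrongly, roughly, when the ball of radius
  |Z| has larger volume than a cell of the received constellation, i.e. when
  ln vol B(|Z|) > ln h_1 + ... + ln h_n - n delta.  The probability of this event bounds the error
  probability of every constellation of NLD delta from below (sphere packing), and is attained up to
  a factor O(n) in the density (hence O(ln n / n) in delta) by averaging over random lattices
  {x in Z^n : x_i = g_i x_0 mod q}, with no appeal to the Minkowski-Hlawka theorem.

  The logarithmic volume has an explicit density, which is O(1/sqrt n)-close in L1 to a normal one of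
  variance n/2.  Conditioning on the fading therefore leaves the expectation of the smooth function
  Q of the sum of the ln h_i, and a Berry-Esseen bound for mixing sequences is not needed: Lindeberg's
  telescoping along the heat equation suffices.  Expanding the first derivative back over a window of
  p ~ ln n preceding variables makes the dependent increments contribute exactly the covariances, at
  the cost of O(p^2 / n^(3/2)) per step, which sums to the error ln^2 n / sqrt n.
*)
theory Submission
  imports Defs "HOL-Computational_Algebra.Primes" "HOL-Real_Asymp.Real_Asymp"
begin

section \<open>Covariance inequalities under mixing\<close>

text \<open>An error of order ln^2 n / sqrt n in a probability is harmless: a shift of the same
  order in the argument of Q outweighs it, since Q has non-zero slope, and one unit of that argument
  is worth sqrt (V / n) in delta. So tail probabilities are needed only to that precision, but
  uniformly in the threshold. The noise makes this possible: with a normal part of variance n/2, the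
  test function applied to the fading has k-th derivative of order n^(-k/2), so n third-order Taylor
  remainders cost n^(-1/2), although the fading has just a third moment. That moment also shapes the
  use of mixing: mixing speaks of events, so unbounded variables are clipped at an exponential level
  that balances the discarded tail against the mixing rate. For existence the obstacle is that the
  transmitter does not know the fading: one constellation must serve almost all channels. The
  lattice is therefore averaged inside both expectations, with spacing and modulus fixed in advance
  for a bounded set of fading and noise values of probability near one.\<close>

lemma cov_le_indicator:
  fixes f g :: "'a \<Rightarrow> real"
  assumes P: "prob_space M" and F: "subalgebra M F"
    and f: "f \<in> borel_measurable F" "\<And>x. \<bar>f x\<bar> \<le> a"
    and g: "integrable M g"
  shows "\<exists>A\<in>sets F. \<bar>(\<integral>x. f x * g x \<partial>M) - (\<integral>x. f x \<partial>M) * (\<integral>x. g x \<partial>M)\<bar>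
    \<le> 2 * a * \<bar>(\<integral>x. indicator A x * g x \<partial>M) - measure M A * (\<integral>x. g x \<partial>M)\<bar>"
proof -
  interpret prob_space M by fact
  interpret S: finite_measure_subalgebra M F
    by (simp add: F finite_measure_axioms finite_measure_subalgebra.intro finite_measure_subalgebra_axioms.intro)
  \<comment> \<open>Conditioning on \<open>F\<close> turns the covariance of \<open>g\<close> with
    any bounded \<open>F\<close>-measurable h into the integral of h * c (this is
    \<open>key\<close>). It is largest when h follows the sign of \<open>c\<close>; as
    \<open>c\<close> has mean zero, the integral of its modulus is twice its integral over
    \<open>A\<close>, which is the factor 2.\<close>
  define c where "c x = real_cond_exp M F g x - (\<integral>x. g x \<partial>M)" for x
  define A where "A = {x \<in> space M. c x > 0}"
  have sp: "space F = space M" using F by (simp add: subalgebra_def)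
  have cF[measurable]: "c \<in> borel_measurable F" unfolding c_def by measurable
  have fF[measurable]: "f \<in> borel_measurable F" by fact
  have fM[measurable]: "f \<in> borel_measurable M" by (rule measurable_from_subalg[OF F fF])
  have gM[measurable]: "g \<in> borel_measurable M" using g by auto
  have AF: "A \<in> sets F" unfolding A_def sp[symmetric] by measurable
  then have AM[measurable]: "A \<in> sets M" using F by (auto simp: subalgebra_def)
  have a0: "0 \<le> a" using f(2)[of undefined] by linarith
  have ci: "integrable M c" unfolding c_def using S.real_cond_exp_int[OF g] by auto
  have c0: "(\<integral>x. c x \<partial>M) = 0"
    unfolding c_def using S.real_cond_exp_int[OF g] by (simp add: prob_space)
  have key: "(\<integral>x. h x * g x \<partial>M) - (\<integral>x. h x \<partial>M) * (\<integral>x. g x \<partial>M) = (\<integral>x. h x * c x \<partial>M)"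
    if h: "h \<in> borel_measurable F" "\<And>x. \<bar>h x\<bar> \<le> b" for h :: "'a \<Rightarrow> real" and b
  proof -
    have hM: "h \<in> borel_measurable M" by (rule measurable_from_subalg[OF F h(1)])
    have hi: "integrable M h" by (rule integrable_const_bound[of _ b]) (use h hM in auto)
    have i: "integrable M (\<lambda>x. h x * g x)"
      by (rule Bochner_Integration.integrable_bound[of _ "\<lambda>x. b * \<bar>g x\<bar>"])
        (use g hM in \<open>auto\<close>, auto simp: abs_mult intro!: AE_I2 mult_mono order_trans[OF h(2) abs_ge_self])
    note r = S.real_cond_exp_intg[OF i h(1) gM]
    have "(\<integral>x. h x * c x \<partial>M) = (\<integral>x. h x * real_cond_exp M F g x - h x * (\<integral>x. g x \<partial>M) \<partial>M)"
      by (simp add: c_def algebra_simps)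
    also have "\<dots> = (\<integral>x. h x * g x \<partial>M) - (\<integral>x. h x \<partial>M) * (\<integral>x. g x \<partial>M)"
      using r hi by (subst Bochner_Integration.integral_diff) auto
    finally show ?thesis by simp
  qed
  have k1: "\<bar>(\<integral>x. f x * g x \<partial>M) - (\<integral>x. f x \<partial>M) * (\<integral>x. g x \<partial>M)\<bar> \<le> (\<integral>x. a * \<bar>c x\<bar> \<partial>M)"
  proof -
    have "\<bar>\<integral>x. f x * c x \<partial>M\<bar> \<le> (\<integral>x. \<bar>f x * c x\<bar> \<partial>M)"
      by (rule integral_abs_bound)
    also have "\<dots> \<le> (\<integral>x. a * \<bar>c x\<bar> \<partial>M)"
    proof (rule integral_mono)
      show "integrable M (\<lambda>x. \<bar>f x * c x\<bar>)"
        by (rule Bochner_Integration.integrable_bound[of _ "\<lambda>x. a * \<bar>c x\<bar>"])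
          (use ci in \<open>auto\<close>, auto simp: abs_mult intro!: AE_I2 mult_mono order_trans[OF f(2) abs_ge_self])
    qed (use ci f(2) in \<open>auto simp: abs_mult intro!: mult_right_mono\<close>)
    finally show ?thesis using key[OF f] by simp
  qed
  have k2: "(\<integral>x. indicator A x * g x \<partial>M) - measure M A * (\<integral>x. g x \<partial>M) = (\<integral>x. indicator A x * c x \<partial>M)"
    using key[of "indicator A" 1] AF AM by (auto simp: indicator_le_1)
  have ici: "integrable M (\<lambda>x. indicator A x * c x)"
    using integrable_mult_indicator[OF AM ci] by simp
  have "(\<integral>x. \<bar>c x\<bar> \<partial>M) = (\<integral>x. 2 * (indicator A x * c x) - c x \<partial>M)"
    by (rule Bochner_Integration.integral_cong) (auto simp: A_def indicator_def)
  also have "\<dots> = 2 * (\<integral>x. indicator A x * c x \<partial>M)"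
    using ici ci c0 by (subst Bochner_Integration.integral_diff) auto
  finally have k3: "(\<integral>x. \<bar>c x\<bar> \<partial>M) = 2 * (\<integral>x. indicator A x * c x \<partial>M)" .
  have "(\<integral>x. a * \<bar>c x\<bar> \<partial>M) \<le> 2 * a * \<bar>(\<integral>x. indicator A x * g x \<partial>M) - measure M A * (\<integral>x. g x \<partial>M)\<bar>"
    using k3 k2 a0 by (auto intro!: mult_left_mono)
  then show ?thesis using AF k1 by (intro bexI[of _ A]) linarith
qed

text \<open>\<open>cov_le_indicator\<close> is used twice: it first trades \<open>f\<close> for the
  indicator of an event of \<open>F\<close>, then \<open>g\<close> for the indicator of an event of
  \<open>G\<close>. Each exchange costs a factor 2, hence the constant 4.\<close>

lemma cov_bounded:
  fixes f g :: "'a \<Rightarrow> real"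
  assumes P: "prob_space M" and F: "subalgebra M F" and G: "subalgebra M G"
    and f: "f \<in> borel_measurable F" "\<And>x. \<bar>f x\<bar> \<le> a"
    and g: "g \<in> borel_measurable G" "\<And>x. \<bar>g x\<bar> \<le> b"
    and mix: "\<And>A B. A \<in> sets F \<Longrightarrow> B \<in> sets G \<Longrightarrow>
      \<bar>measure M (A \<inter> B) - measure M A * measure M B\<bar> \<le> \<alpha>"
  shows "\<bar>(\<integral>x. f x * g x \<partial>M) - (\<integral>x. f x \<partial>M) * (\<integral>x. g x \<partial>M)\<bar> \<le> 4 * a * b * \<alpha>"
proof -
  interpret prob_space M by fact
  have a0: "0 \<le> a" using f(2)[of undefined] by linarith
  have b0: "0 \<le> b" using g(2)[of undefined] by linarith
  have gM: "g \<in> borel_measurable M" by (rule measurable_from_subalg[OF G g(1)])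
  have gi: "integrable M g" by (rule integrable_const_bound[of _ b]) (use g gM in auto)
  obtain A where A: "A \<in> sets F" and 1: "\<bar>(\<integral>x. f x * g x \<partial>M) - (\<integral>x. f x \<partial>M) * (\<integral>x. g x \<partial>M)\<bar>
    \<le> 2 * a * \<bar>(\<integral>x. indicator A x * g x \<partial>M) - measure M A * (\<integral>x. g x \<partial>M)\<bar>"
    using cov_le_indicator[OF P F f gi] by auto
  have AM: "A \<in> sets M" using A F by (auto simp: subalgebra_def)
  have ii: "integrable M (indicator A :: 'a \<Rightarrow> real)" using AM by (intro integrable_real_indicator) (auto simp: emeasure_eq_measure)
  obtain B where B: "B \<in> sets G" and 2: "\<bar>(\<integral>x. g x * indicator A x \<partial>M) - (\<integral>x. g x \<partial>M) * (\<integral>x. indicator A x \<partial>M)\<bar>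
    \<le> 2 * b * \<bar>(\<integral>x. indicator B x * indicator A x \<partial>M) - measure M B * (\<integral>x. indicator A x \<partial>M)\<bar>"
    using cov_le_indicator[OF P G g ii] by auto
  have BM: "B \<in> sets M" using B G by (auto simp: subalgebra_def)
  have e: "(\<integral>x. indicator B x * indicator A x \<partial>M) = measure M (A \<inter> B)"
    using AM BM by (simp add: indicator_inter_arith[symmetric] Int_commute)
  have "2 * b * \<bar>(\<integral>x. indicator B x * indicator A x \<partial>M) - measure M B * (\<integral>x. indicator A x \<partial>M)\<bar> \<le> 2 * b * \<alpha>"
    using mix[OF A B] AM b0 unfolding e by (intro mult_left_mono) (auto simp: mult.commute)
  with 2 have "\<bar>(\<integral>x. indicator A x * g x \<partial>M) - measure M A * (\<integral>x. g x \<partial>M)\<bar> \<le> 2 * b * \<alpha>"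
    using AM by (simp add: mult.commute)
  then have "2 * a * \<bar>(\<integral>x. indicator A x * g x \<partial>M) - measure M A * (\<integral>x. g x \<partial>M)\<bar> \<le> 2 * a * (2 * b * \<alpha>)"
    using a0 by (intro mult_left_mono) auto
  with 1 show ?thesis by (simp add: mult_ac)
qed

section \<open>Truncation, and what it costs in third moments\<close>

definition clip :: "real \<Rightarrow> real \<Rightarrow> real" where
  "clip T x = max (- T) (min T x)"

lemma clip_measurable[measurable]: "clip T \<in> borel_measurable borel"
  unfolding clip_def[abs_def] by measurable

lemma abs_clip_le: "T \<ge> 0 \<Longrightarrow> \<bar>clip T x\<bar> \<le> T" "T \<ge> 0 \<Longrightarrow> \<bar>clip T x\<bar> \<le> \<bar>x\<bar>"
  by (auto simp: clip_def)

text \<open>Clipping only acts where |x| > T, and there |x| is at most |x|^3 / T^2.\<close>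

lemma clip_diff_le:
  assumes "T > 0" shows "\<bar>x - clip T x\<bar> \<le> \<bar>x\<bar>^3 / T^2"
proof (cases "\<bar>x\<bar> \<le> T")
  case True then have "x - clip T x = 0" by (auto simp: clip_def)
  then show ?thesis using assms by simp
next
  case False
  have "\<bar>x - clip T x\<bar> \<le> \<bar>x\<bar>" using False assms by (auto simp: clip_def)
  also have "\<bar>x\<bar> * T^2 \<le> \<bar>x\<bar> * \<bar>x\<bar>^2" using False assms by (intro mult_left_mono power_mono) auto
  then have "\<bar>x\<bar> \<le> \<bar>x\<bar>^3 / T^2" using assms by (simp add: field_simps power3_eq_cube power2_eq_square)
  finally show ?thesis .
qed

text \<open>Clipping multiplies the factors by some s, t in [0, 1], so the difference is at most m^2
  with m the larger modulus, and m > T when clipping acts. The product uses up two of the three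
  moments, which leaves a single power of \<open>T\<close>.\<close>

lemma clip_prod_diff_le:
  assumes "T > 0" shows "\<bar>x * y - clip T x * clip T y\<bar> \<le> (\<bar>x\<bar>^3 + \<bar>y\<bar>^3) / T"
proof (cases "\<bar>x\<bar> \<le> T \<and> \<bar>y\<bar> \<le> T")
  case True then have "clip T x = x" "clip T y = y" by (auto simp: clip_def)
  then show ?thesis using assms by simp
next
  case False
  define m where "m = max \<bar>x\<bar> \<bar>y\<bar>"
  have m: "m > T" "\<bar>x\<bar> \<le> m" "\<bar>y\<bar> \<le> m" using False by (auto simp: m_def)
  obtain s t where s: "clip T x = s * x" "0 \<le> s" "s \<le> 1" and t: "clip T y = t * y" "0 \<le> t" "t \<le> 1"
  proof -
    have *: "\<exists>s. clip T x = s * x \<and> 0 \<le> s \<and> s \<le> 1" for x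
    proof (cases "\<bar>x\<bar> \<le> T")
      case True then show ?thesis by (intro exI[of _ 1]) (auto simp: clip_def)
    next
      case False
      then show ?thesis using assms
        by (intro exI[of _ "T / \<bar>x\<bar>"]) (cases "x < 0"; simp add: clip_def min_def max_def field_simps)
    qed
    show ?thesis using *[of x] *[of y] that by blast
  qed
  have st: "0 \<le> s * t" "s * t \<le> 1" using s t by (auto intro: mult_le_one)
  have "\<bar>x * y - clip T x * clip T y\<bar> = \<bar>1 - s * t\<bar> * (\<bar>x\<bar> * \<bar>y\<bar>)"
    unfolding s t abs_mult[symmetric] by (simp add: algebra_simps)
  also have "\<dots> \<le> 1 * (m * m)" using st m by (intro mult_mono) auto
  also have "m * m \<le> m^3 / T"
  proof -
    have "m * m * T \<le> m * m * m" using m assms by (intro mult_left_mono) auto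
    then show ?thesis using assms by (simp add: field_simps power3_eq_cube)
  qed
  also have "m^3 \<le> \<bar>x\<bar>^3 + \<bar>y\<bar>^3" by (auto simp: m_def max_def)
  then have "m^3 / T \<le> (\<bar>x\<bar>^3 + \<bar>y\<bar>^3) / T" using assms by (intro divide_right_mono) auto
  finally show ?thesis by simp
qed

lemma abs_le_one_plus_cube: "\<bar>x::real\<bar> \<le> 1 + \<bar>x\<bar>^3" "x^2 \<le> 1 + \<bar>x\<bar>^3"
proof -
  have "\<bar>x\<bar> \<le> 1 + \<bar>x\<bar>^3 \<and> \<bar>x\<bar>^2 \<le> 1 + \<bar>x\<bar>^3"
  proof (cases "\<bar>x\<bar> \<le> 1")
    case True then have "\<bar>x\<bar>^2 \<le> 1" "0 \<le> \<bar>x\<bar>^3" by (auto simp: abs_square_le_1)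
    then show ?thesis using True by linarith
  next
    case False
    then have "\<bar>x\<bar>^1 \<le> \<bar>x\<bar>^3" "\<bar>x\<bar>^2 \<le> \<bar>x\<bar>^3" by (intro power_increasing; simp)+
    then show ?thesis by simp
  qed
  then show "\<bar>x::real\<bar> \<le> 1 + \<bar>x\<bar>^3" "x^2 \<le> 1 + \<bar>x\<bar>^3" by auto
qed

lemma mult2_le_cubes:
  fixes x y :: real shows "\<bar>x * y\<bar> \<le> 2 + \<bar>x\<bar>^3 + \<bar>y\<bar>^3"
proof -
  have "\<bar>x * y\<bar> \<le> x^2 + y^2"
    using sum_squares_bound[of "\<bar>x\<bar>" "\<bar>y\<bar>"] mult_nonneg_nonneg[OF abs_ge_zero abs_ge_zero, of x y]
    unfolding abs_mult power2_abs by linarith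
  then show ?thesis using abs_le_one_plus_cube(2)[of x] abs_le_one_plus_cube(2)[of y] by linarith
qed

lemma mult3_le_cubes:
  fixes a b c :: real assumes "0 \<le> a" "0 \<le> b" "0 \<le> c"
  shows "a * b * c \<le> a^3 + b^3 + c^3"
proof -
  define m where "m = max a (max b c)"
  have "a * b * c \<le> m * m * m" using assms by (intro mult_mono) (auto simp: m_def)
  also have "\<dots> = m^3" by (simp add: power3_eq_cube)
  also have "\<dots> \<le> a^3 + b^3 + c^3" using assms by (auto simp: m_def max_def)
  finally show ?thesis .
qed

section \<open>Partial sums of a mixing sequence\<close>

text \<open>The factors 1/2 and 1/6 of the remainders are dropped, so that one constant
  \<open>L\<close> serves all three expansions of the Lindeberg step.\<close>

lemma taylor_bounds:
  fixes g0 g1 g2 g3 :: "real \<Rightarrow> real"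
  assumes d0: "\<And>x. (g0 has_real_derivative g1 x) (at x)"
    and d1: "\<And>x. (g1 has_real_derivative g2 x) (at x)"
    and d2: "\<And>x. (g2 has_real_derivative g3 x) (at x)"
    and b3: "\<And>x. \<bar>g3 x\<bar> \<le> L"
  shows "\<bar>g2 (x + y) - g2 x\<bar> \<le> L * \<bar>y\<bar>"
    and "\<bar>g1 (x + y) - g1 x - g2 x * y\<bar> \<le> L * y^2"
    and "\<bar>g0 (x + y) - g0 x - g1 x * y - g2 x * y^2 / 2\<bar> \<le> L * \<bar>y\<bar>^3"
proof -
  have L0: "0 \<le> L" using b3[of 0] by linarith
  have "\<exists>t. g2 (x + y) = g2 x + g3 t * y" if "y \<noteq> 0"
    using Taylor[of 1 "\<lambda>m. [g2, g3] ! m" g2 "x - \<bar>y\<bar>" "x + \<bar>y\<bar>" x "x + y"] that d2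
      abs_ge_self[of y] abs_ge_minus_self[of y] by fastforce
  then show "\<bar>g2 (x + y) - g2 x\<bar> \<le> L * \<bar>y\<bar>"
    using b3 by (cases "y = 0") (auto simp: abs_mult intro!: mult_right_mono)
  have dd: "([g1, g2, g3] ! m has_real_derivative ([g1, g2, g3] ! Suc m) t) (at t)" if "m < 2" for m t
    using that d1 d2 by (cases m) (auto simp: less_Suc_eq numeral_2_eq_2)
  have "\<exists>t. g1 (x + y) = g1 x + g2 x * y + g3 t / 2 * y^2" if "y \<noteq> 0"
    using Taylor[of 2 "\<lambda>m. [g1, g2, g3] ! m" g1 "x - \<bar>y\<bar>" "x + \<bar>y\<bar>" x "x + y"] that dd
      abs_ge_self[of y] abs_ge_minus_self[of y]
    by (simp add: lessThan_Suc numeral_2_eq_2 add_ac) metis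
  then obtain t where "\<bar>g1 (x + y) - g1 x - g2 x * y\<bar> = \<bar>g3 t / 2\<bar> * y^2"
    by (cases "y = 0") (auto simp: abs_mult)
  also have "\<dots> \<le> L * y^2" using b3[of t] L0 by (intro mult_right_mono) auto
  finally show "\<bar>g1 (x + y) - g1 x - g2 x * y\<bar> \<le> L * y^2" .
  have dd: "([g0, g1, g2, g3] ! m has_real_derivative ([g0, g1, g2, g3] ! Suc m) t) (at t)" if "m < 3" for m t
    using that d0 d1 d2 by (cases m) (auto simp: less_Suc_eq numeral_3_eq_3)
  have "\<exists>t. g0 (x + y) = g0 x + g1 x * y + g2 x * y^2 / 2 + g3 t / 6 * y^3" if "y \<noteq> 0"
    using Taylor[of 3 "\<lambda>m. [g0, g1, g2, g3] ! m" g0 "x - \<bar>y\<bar>" "x + \<bar>y\<bar>" x "x + y"] that dd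
      abs_ge_self[of y] abs_ge_minus_self[of y]
    by (simp add: lessThan_Suc numeral_2_eq_2 numeral_3_eq_3 add_ac fact_numeral) metis
  then obtain t where "\<bar>g0 (x + y) - g0 x - g1 x * y - g2 x * y^2 / 2\<bar> = \<bar>g3 t / 6\<bar> * \<bar>y\<bar>^3"
    by (cases "y = 0") (auto simp: abs_mult power_abs)
  also have "\<dots> \<le> L * \<bar>y\<bar>^3" using b3[of t] L0 by (intro mult_right_mono) auto
  finally show "\<bar>g0 (x + y) - g0 x - g1 x * y - g2 x * y^2 / 2\<bar> \<le> L * \<bar>y\<bar>^3" .
qed

lemma integral_dominated:
  fixes u v :: "'a \<Rightarrow> real"
  assumes "integrable M v" "u \<in> borel_measurable M" "\<And>x. \<bar>u x\<bar> \<le> v x"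
  shows "integrable M u" "\<bar>\<integral>x. u x \<partial>M\<bar> \<le> (\<integral>x. v x \<partial>M)"
proof -
  show i: "integrable M u"
    using assms by (intro Bochner_Integration.integrable_bound[OF assms(1)])
      (auto intro!: AE_I2 order_trans[OF assms(3) abs_ge_self])
  have "\<bar>\<integral>x. u x \<partial>M\<bar> \<le> (\<integral>x. \<bar>u x\<bar> \<partial>M)" by (rule integral_abs_bound)
  also have "\<dots> \<le> (\<integral>x. v x \<partial>M)" using i assms by (intro integral_mono) auto
  finally show "\<bar>\<integral>x. u x \<partial>M\<bar> \<le> (\<integral>x. v x \<partial>M)" .
qed

text \<open>What the limit theorem takes from stationarity is \<open>cov_eq\<close>, the zero means
  and the uniform third moment; both variants of the mixing hypothesis will be reduced to the bound
  \<open>mix\<close> on events.\<close>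

locale mixing_seq = prob_space M for M :: "'a measure" +
  fixes X :: "nat \<Rightarrow> 'a \<Rightarrow> real" and K \<beta> m3 :: real and R :: "nat \<Rightarrow> real"
  assumes X_meas[measurable]: "\<And>i. X i \<in> borel_measurable M"
    and cube_int: "\<And>i. integrable M (\<lambda>\<omega>. \<bar>X i \<omega>\<bar>^3)"
    and cube_le: "\<And>i. (\<integral>\<omega>. \<bar>X i \<omega>\<bar>^3 \<partial>M) \<le> m3"
    and mean_zero: "\<And>i. (\<integral>\<omega>. X i \<omega> \<partial>M) = 0"
    and cov_eq: "\<And>i d. (\<integral>\<omega>. X i \<omega> * X (i + d) \<omega> \<partial>M) = R d"
    and K_nonneg: "0 \<le> K" and \<beta>_pos: "0 < \<beta>"
    and mix: "\<And>n k A B. 1 \<le> n \<Longrightarrow> A \<in> sigma_sets (space M) (past_gen M X k) \<Longrightarrow>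
      B \<in> sigma_sets (space M) (future_gen M X (k + n)) \<Longrightarrow>
      \<bar>measure M (A \<inter> B) - measure M A * measure M B\<bar> \<le> K * exp (- \<beta> * real n)"
begin

text \<open>With clipping level T = exp (\<theta> n) the mixing bound becomes K / T^3, so that even
  the factor T^2 of a clipped product leaves a decay of 1 / T.\<close>

definition "\<theta> = \<beta> / 3"
text \<open>Large enough for the three truncation arguments at once: 4 K + 2 m3 in
  \<open>cov_X\<close>, 4 K + 4 m3 in \<open>cov_XX\<close>, and 4 K + 2 m3 + m3^2 in
  \<open>R_le\<close>.\<close>

definition "cov_bound = 4 * K + 4 * m3 + m3^2"
text \<open>Dominates the mixed absolute moments of order one, two and three together, and is at
  least 1.\<close>

definition "moment_bound = 2 + 3 * m3"
definition "S k \<omega> = (\<Sum>i<k. X i \<omega>)"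
definition "past k = sigma (space M) (past_gen M X k)"
definition "future k = sigma (space M) (future_gen M X k)"

lemma \<theta>_pos: "0 < \<theta>" using \<beta>_pos by (simp add: \<theta>_def)

lemma m3_nonneg: "0 \<le> m3"
  using cube_le[of 0] by (rule order_trans[rotated]) (auto intro!: integral_nonneg_AE)

lemma moment_bound_ge: "1 \<le> moment_bound" "m3 \<le> moment_bound" "3 * m3 \<le> moment_bound" using m3_nonneg by (auto simp: moment_bound_def)
lemma cov_bound_nonneg: "0 \<le> cov_bound" using m3_nonneg K_nonneg by (auto simp: cov_bound_def)

lemma gen_subset: "past_gen M X k \<subseteq> Pow (space M)" "future_gen M X k \<subseteq> Pow (space M)"
  by (auto simp: past_gen_def future_gen_def)

lemma sets_past: "sets (past k) = sigma_sets (space M) (past_gen M X k)"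
  and sets_future: "sets (future k) = sigma_sets (space M) (future_gen M X k)"
  and space_past: "space (past k) = space M" and space_future: "space (future k) = space M"
  using gen_subset by (auto simp: past_def future_def)

lemma subalg_past: "subalgebra M (past k)"
  unfolding subalgebra_def sets_past space_past
  by (intro conjI sets.sigma_sets_subset) (auto simp: past_gen_def intro!: measurable_sets)

lemma subalg_future: "subalgebra M (future k)"
  unfolding subalgebra_def sets_future space_future
  by (intro conjI sets.sigma_sets_subset) (auto simp: future_gen_def intro!: measurable_sets)

lemma X_past: "i \<le> k \<Longrightarrow> X i \<in> borel_measurable (past k)"
  by (rule measurableI) (auto simp: space_past sets_past past_gen_def intro!: sigma_sets.Basic)

lemma X_future: "k \<le> i \<Longrightarrow> X i \<in> borel_measurable (future k)"
  by (rule measurableI) (auto simp: space_future sets_future future_gen_def intro!: sigma_sets.Basic)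

lemma S_meas[measurable]: "S k \<in> borel_measurable M"
  unfolding S_def[abs_def] by measurable

text \<open>\<open>S k\<close> stops at \<open>X (k - 1)\<close> while \<open>past m\<close>
  contains \<open>X m\<close>, hence the successor.\<close>

lemma S_past: "k \<le> Suc m \<Longrightarrow> S k \<in> borel_measurable (past m)"
  unfolding S_def[abs_def] by (intro borel_measurable_sum X_past) auto

lemma S_Suc: "S (Suc k) \<omega> = S k \<omega> + X k \<omega>" by (simp add: S_def)

lemma S_diff: "j \<le> k \<Longrightarrow> S k \<omega> = S j \<omega> + (\<Sum>i\<in>{j..<k}. X i \<omega>)"
  unfolding S_def by (simp add: lessThan_atLeast0 sum.atLeastLessThan_concat)

lemma cov_mixing:
  assumes "1 \<le> n" "k + n \<le> j" "f \<in> borel_measurable (past k)" "\<And>x. \<bar>f x\<bar> \<le> a"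
    "g \<in> borel_measurable (future j)" "\<And>x. \<bar>g x\<bar> \<le> b"
  shows "\<bar>(\<integral>x. f x * g x \<partial>M) - (\<integral>x. f x \<partial>M) * (\<integral>x. g x \<partial>M)\<bar> \<le> 4 * a * b * (K * exp (- \<beta> * real n))"
proof (rule cov_bounded[OF prob_space_axioms subalg_past subalg_future assms(3-6)])
  fix A B' assume A: "A \<in> sets (past k)" and B: "B' \<in> sets (future j)"
  have "future_gen M X j \<subseteq> future_gen M X (k + n)"
    unfolding future_gen_def using assms(2) order_trans[OF assms(2)] by blast
  then have "B' \<in> sigma_sets (space M) (future_gen M X (k + n))"
    using B unfolding sets_future using sigma_sets_mono' by blast
  then show "\<bar>prob (A \<inter> B') - prob A * prob B'\<bar> \<le> K * exp (- \<beta> * real n)"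
    using mix[OF assms(1)] A by (auto simp: sets_past)
qed

lemma X_int: "integrable M (X i)" and X_abs: "(\<integral>x. \<bar>X i x\<bar> \<partial>M) \<le> moment_bound"
proof -
  note d = integral_dominated[of M "\<lambda>x. 1 + \<bar>X i x\<bar>^3", OF _ _ abs_le_one_plus_cube(1)]
  have i: "integrable M (\<lambda>x. 1 + \<bar>X i x\<bar>^3)" using cube_int by auto
  show "integrable M (X i)" using d(1)[OF i] by auto
  then have "(\<integral>x. \<bar>X i x\<bar> \<partial>M) \<le> (\<integral>x. 1 + \<bar>X i x\<bar>^3 \<partial>M)"
    using i abs_le_one_plus_cube(1) by (intro integral_mono) auto
  also have "\<dots> \<le> moment_bound" using cube_int[of i] cube_le[of i] m3_nonneg by (simp add: prob_space moment_bound_def)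
  finally show "(\<integral>x. \<bar>X i x\<bar> \<partial>M) \<le> moment_bound" .
qed

lemma XX_int: "integrable M (\<lambda>x. X i x * X j x)" and XX_abs: "(\<integral>x. \<bar>X i x * X j x\<bar> \<partial>M) \<le> moment_bound"
proof -
  have i: "integrable M (\<lambda>x. 2 + \<bar>X i x\<bar>^3 + \<bar>X j x\<bar>^3)" using cube_int by auto
  show "integrable M (\<lambda>x. X i x * X j x)" by (rule integral_dominated(1)[OF i _ mult2_le_cubes]) auto
  then have "(\<integral>x. \<bar>X i x * X j x\<bar> \<partial>M) \<le> (\<integral>x. 2 + \<bar>X i x\<bar>^3 + \<bar>X j x\<bar>^3 \<partial>M)"
    using i mult2_le_cubes by (intro integral_mono) auto
  also have "\<dots> \<le> moment_bound" using cube_int[of i] cube_le[of i] cube_int[of j] cube_le[of j] m3_nonneg by (simp add: prob_space moment_bound_def)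
  finally show "(\<integral>x. \<bar>X i x * X j x\<bar> \<partial>M) \<le> moment_bound" .
qed

lemma XXX_int: "integrable M (\<lambda>x. \<bar>X i x\<bar> * \<bar>X j x\<bar> * \<bar>X l x\<bar>)"
  and XXX_abs: "(\<integral>x. \<bar>X i x\<bar> * \<bar>X j x\<bar> * \<bar>X l x\<bar> \<partial>M) \<le> moment_bound"
proof -
  have i: "integrable M (\<lambda>x. \<bar>X i x\<bar>^3 + \<bar>X j x\<bar>^3 + \<bar>X l x\<bar>^3)" using cube_int by auto
  have le: "\<bar>\<bar>X i x\<bar> * \<bar>X j x\<bar> * \<bar>X l x\<bar>\<bar> \<le> \<bar>X i x\<bar>^3 + \<bar>X j x\<bar>^3 + \<bar>X l x\<bar>^3" for x
    using mult3_le_cubes[of "\<bar>X i x\<bar>" "\<bar>X j x\<bar>" "\<bar>X l x\<bar>"] by (simp add: abs_mult)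
  show "integrable M (\<lambda>x. \<bar>X i x\<bar> * \<bar>X j x\<bar> * \<bar>X l x\<bar>)" by (rule integral_dominated(1)[OF i _ le]) auto
  have "(\<integral>x. \<bar>X i x\<bar> * \<bar>X j x\<bar> * \<bar>X l x\<bar> \<partial>M) \<le> (\<integral>x. \<bar>X i x\<bar>^3 + \<bar>X j x\<bar>^3 + \<bar>X l x\<bar>^3 \<partial>M)"
    using integral_dominated(2)[OF i _ le] by auto
  also have "\<dots> \<le> moment_bound" using cube_int cube_le[of i] cube_le[of j] cube_le[of l] by (simp add: moment_bound_def)
  finally show "(\<integral>x. \<bar>X i x\<bar> * \<bar>X j x\<bar> * \<bar>X l x\<bar> \<partial>M) \<le> moment_bound" .
qed

lemma exp_T: "exp (- \<beta> * real n) = 1 / exp (\<theta> * real n)^3" "exp (- \<theta> * real n) = 1 / exp (\<theta> * real n)"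
  by (auto simp: exp_of_nat_mult[symmetric] \<theta>_def exp_minus field_simps)

text \<open>Since \<open>X j\<close> is centred, the clipped mean is minus the mean of the part cut
  off.\<close>

lemma clip_mean: assumes "T > 0" shows "\<bar>\<integral>x. clip T (X j x) \<partial>M\<bar> \<le> m3 / T^2"
proof -
  have ic: "integrable M (\<lambda>x. clip T (X j x))"
    by (rule integral_dominated(1)[of _ "\<lambda>x. \<bar>X j x\<bar>"]) (use X_int abs_clip_le assms in auto)
  have "(\<integral>x. clip T (X j x) \<partial>M) = - (\<integral>x. X j x - clip T (X j x) \<partial>M)"
    using ic X_int[of j] mean_zero[of j] by simp
  also have "\<bar>- (\<integral>x. X j x - clip T (X j x) \<partial>M)\<bar> \<le> (\<integral>x. \<bar>X j x\<bar>^3 / T^2 \<partial>M)"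
    unfolding abs_minus_cancel
    by (rule integral_dominated(2)) (use cube_int clip_diff_le assms in auto)
  also have "\<dots> \<le> m3 / T^2" using cube_le[of j] assms by (simp add: divide_right_mono)
  finally show ?thesis .
qed

text \<open>Clip \<open>X j\<close> at T = exp (\<theta> n). The clipped covariance is at most 4 a T
  times K / T^3; the discarded part and the product of the means cost a m3 / T^2 each.\<close>

lemma cov_X:
  assumes n: "1 \<le> n" "k + n \<le> j" and f: "f \<in> borel_measurable (past k)" "\<And>x. \<bar>f x\<bar> \<le> a"
  shows "\<bar>\<integral>x. f x * X j x \<partial>M\<bar> \<le> a * cov_bound * exp (- \<theta> * real n)"
proof -
  define T where "T = exp (\<theta> * real n)"
  have T1: "1 \<le> T" using \<theta>_pos by (simp add: T_def)
  have a0: "0 \<le> a" using f(2)[of undefined] by linarith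
  have fM[measurable]: "f \<in> borel_measurable M" by (rule measurable_from_subalg[OF subalg_past f(1)])
  have fi: "integrable M f" and fa: "\<bar>\<integral>x. f x \<partial>M\<bar> \<le> a"
    using integral_dominated[of M "\<lambda>_. a" f] f(2) by (auto simp: prob_space)
  have m: "(\<lambda>x. clip T (X j x)) \<in> borel_measurable (future j)"
    using X_future[of j j] by measurable
  have cc: "\<bar>(\<integral>x. f x * clip T (X j x) \<partial>M) - (\<integral>x. f x \<partial>M) * (\<integral>x. clip T (X j x) \<partial>M)\<bar> \<le> 4 * a * T * (K * exp (- \<beta> * real n))"
    by (rule cov_mixing[OF n f m]) (use T1 abs_clip_le in auto)
  have fc: "integrable M (\<lambda>x. f x * clip T (X j x))"
    by (rule integral_dominated(1)[of _ "\<lambda>x. a * T"]) (use T1 f(2) a0 abs_clip_le in \<open>auto simp: abs_mult intro!: mult_mono\<close>)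
  have db: "\<bar>f x * (X j x - clip T (X j x))\<bar> \<le> a * (\<bar>X j x\<bar>^3 / T^2)" for x
    unfolding abs_mult using f(2) clip_diff_le[of T "X j x"] T1 a0 by (intro mult_mono) auto
  have i3: "integrable M (\<lambda>x. a * (\<bar>X j x\<bar>^3 / T^2))" using cube_int by auto
  have fd: "integrable M (\<lambda>x. f x * (X j x - clip T (X j x)))"
    and fdb: "\<bar>\<integral>x. f x * (X j x - clip T (X j x)) \<partial>M\<bar> \<le> (\<integral>x. a * (\<bar>X j x\<bar>^3 / T^2) \<partial>M)"
    using integral_dominated[OF i3 _ db] by auto
  have "(\<integral>x. a * (\<bar>X j x\<bar>^3 / T^2) \<partial>M) \<le> a * (m3 / T^2)"
    using cube_le[of j] a0 by (auto intro!: mult_left_mono divide_right_mono)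
  with fdb have 1: "\<bar>\<integral>x. f x * (X j x - clip T (X j x)) \<partial>M\<bar> \<le> a * (m3 / T^2)" by linarith
  have 2: "\<bar>(\<integral>x. f x \<partial>M) * (\<integral>x. clip T (X j x) \<partial>M)\<bar> \<le> a * (m3 / T^2)"
    unfolding abs_mult using fa clip_mean[of T j] T1 a0 by (intro mult_mono) auto
  have "(\<integral>x. f x * X j x \<partial>M) = (\<integral>x. f x * clip T (X j x) + f x * (X j x - clip T (X j x)) \<partial>M)"
    by (simp add: algebra_simps)
  also have "\<dots> = (\<integral>x. f x * clip T (X j x) \<partial>M) + (\<integral>x. f x * (X j x - clip T (X j x)) \<partial>M)"
    using fc fd by simp
  finally have "\<bar>\<integral>x. f x * X j x \<partial>M\<bar> \<le> 4 * a * T * (K * exp (- \<beta> * real n)) + 2 * (a * (m3 / T^2))"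
    using cc 1 2 by linarith
  also have "\<dots> = a * (4 * K + 2 * m3) / T^2"
    using T1 unfolding exp_T T_def[symmetric] by (simp add: field_simps power2_eq_square power3_eq_cube)
  also have "\<dots> \<le> a * cov_bound / T^1"
    using T1 a0 m3_nonneg K_nonneg
    by (intro frac_le mult_left_mono power_increasing mult_nonneg_nonneg cov_bound_nonneg) (auto simp: cov_bound_def)
  finally show ?thesis unfolding exp_T T_def[symmetric] by simp
qed

text \<open>The truncation of \<open>cov_X\<close>, now for a product whose mean does not vanish and
  must be subtracted. The clipped product is bounded by T^2, so mixing yields 4 a K / T, and
  exchanging the products costs 2 m3 / T twice.\<close>

lemma cov_XX:
  assumes n: "1 \<le> n" "k + n \<le> i" "k + n \<le> j" and f: "f \<in> borel_measurable (past k)" "\<And>x. \<bar>f x\<bar> \<le> a"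
  shows "\<bar>(\<integral>x. f x * (X i x * X j x) \<partial>M) - (\<integral>x. f x \<partial>M) * (\<integral>x. X i x * X j x \<partial>M)\<bar> \<le> a * cov_bound * exp (- \<theta> * real n)"
proof -
  define T where "T = exp (\<theta> * real n)"
  have T1: "1 \<le> T" using \<theta>_pos by (simp add: T_def)
  have a0: "0 \<le> a" using f(2)[of undefined] by linarith
  have fM[measurable]: "f \<in> borel_measurable M" by (rule measurable_from_subalg[OF subalg_past f(1)])
  have fi: "integrable M f" and fa: "\<bar>\<integral>x. f x \<partial>M\<bar> \<le> a"
    using integral_dominated[of M "\<lambda>_. a" f] f(2) by (auto simp: prob_space)
  define c where "c x = clip T (X i x) * clip T (X j x)" for x
  have [measurable]: "c \<in> borel_measurable M" unfolding c_def by measurable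
  have m: "c \<in> borel_measurable (future (k + n))"
    unfolding c_def using X_future[of "k + n" i] X_future[of "k + n" j] n by measurable
  have cT: "\<bar>c x\<bar> \<le> T^2" for x
    unfolding c_def abs_mult power2_eq_square using T1 abs_clip_le[of T] by (intro mult_mono) auto
  have cc: "\<bar>(\<integral>x. f x * c x \<partial>M) - (\<integral>x. f x \<partial>M) * (\<integral>x. c x \<partial>M)\<bar> \<le> 4 * a * T^2 * (K * exp (- \<beta> * real n))"
    by (rule cov_mixing[OF n(1) _ f m]) (use cT in auto)
  have ci: "integrable M c" by (rule integral_dominated(1)[of _ "\<lambda>x. T^2"]) (use cT in auto)
  have fc: "integrable M (\<lambda>x. f x * c x)"
    by (rule integral_dominated(1)[of _ "\<lambda>x. a * T^2"]) (use T1 f(2) a0 cT in \<open>auto simp: abs_mult intro!: mult_mono\<close>)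
  have dc: "\<bar>X i x * X j x - c x\<bar> \<le> (\<bar>X i x\<bar>^3 + \<bar>X j x\<bar>^3) / T" for x
    unfolding c_def using clip_prod_diff_le T1 by auto
  have i2: "integrable M (\<lambda>x. (\<bar>X i x\<bar>^3 + \<bar>X j x\<bar>^3) / T)" using cube_int by auto
  have db: "\<bar>f x * (X i x * X j x - c x)\<bar> \<le> a * ((\<bar>X i x\<bar>^3 + \<bar>X j x\<bar>^3) / T)" for x
    unfolding abs_mult[of "f x"] using f(2) dc T1 a0 by (intro mult_mono) auto
  have i3: "integrable M (\<lambda>x. a * ((\<bar>X i x\<bar>^3 + \<bar>X j x\<bar>^3) / T))" using cube_int by auto
  have e: "(\<integral>x. (\<bar>X i x\<bar>^3 + \<bar>X j x\<bar>^3) / T \<partial>M) \<le> 2 * m3 / T"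
    using cube_le[of i] cube_le[of j] cube_int[of i] cube_int[of j] T1 by (simp add: divide_right_mono)
  have fd: "integrable M (\<lambda>x. f x * (X i x * X j x - c x))"
    and fdb: "\<bar>\<integral>x. f x * (X i x * X j x - c x) \<partial>M\<bar> \<le> (\<integral>x. a * ((\<bar>X i x\<bar>^3 + \<bar>X j x\<bar>^3) / T) \<partial>M)"
    using integral_dominated[OF i3 _ db] by auto
  have "(\<integral>x. a * ((\<bar>X i x\<bar>^3 + \<bar>X j x\<bar>^3) / T) \<partial>M) \<le> a * (2 * m3 / T)"
    unfolding integral_mult_right_zero using e a0 by (intro mult_left_mono)
  with fdb have 1: "\<bar>\<integral>x. f x * (X i x * X j x - c x) \<partial>M\<bar> \<le> a * (2 * m3 / T)" by linarith
  have dci: "integrable M (\<lambda>x. X i x * X j x - c x)"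
    and "\<bar>\<integral>x. X i x * X j x - c x \<partial>M\<bar> \<le> (\<integral>x. (\<bar>X i x\<bar>^3 + \<bar>X j x\<bar>^3) / T \<partial>M)"
    using integral_dominated[OF i2 _ dc] by auto
  with e have "\<bar>(\<integral>x. X i x * X j x \<partial>M) - (\<integral>x. c x \<partial>M)\<bar> \<le> 2 * m3 / T"
    using XX_int ci by simp
  then have 2: "\<bar>(\<integral>x. f x \<partial>M) * ((\<integral>x. X i x * X j x \<partial>M) - (\<integral>x. c x \<partial>M))\<bar> \<le> a * (2 * m3 / T)"
    unfolding abs_mult[of "\<integral>x. f x \<partial>M"] using fa a0 by (intro mult_mono) auto
  have "(\<integral>x. f x * (X i x * X j x) \<partial>M) = (\<integral>x. f x * c x + f x * (X i x * X j x - c x) \<partial>M)"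
    by (simp add: algebra_simps)
  also have "\<dots> = (\<integral>x. f x * c x \<partial>M) + (\<integral>x. f x * (X i x * X j x - c x) \<partial>M)"
    using fc fd by simp
  finally have "\<bar>(\<integral>x. f x * (X i x * X j x) \<partial>M) - (\<integral>x. f x \<partial>M) * (\<integral>x. X i x * X j x \<partial>M)\<bar>
      \<le> 4 * a * T^2 * (K * exp (- \<beta> * real n)) + 2 * (a * (2 * m3 / T))"
    using cc 1 2 unfolding right_diff_distrib by linarith
  also have "\<dots> = a * (4 * K + 4 * m3) / T"
    using T1 unfolding exp_T T_def[symmetric] by (simp add: field_simps power2_eq_square power3_eq_cube)
  also have "\<dots> \<le> a * cov_bound / T"
    using T1 a0 m3_nonneg K_nonneg
    by (intro divide_right_mono mult_left_mono) (auto simp: cov_bound_def)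
  finally show ?thesis unfolding exp_T T_def[symmetric] by simp
qed

text \<open>Neither factor is bounded, so both are clipped. The product of the clipped means is of
  order T^-4; the clipping and the mixing contribute the terms of order 1 / T.\<close>

lemma R_le: assumes d: "1 \<le> d" shows "\<bar>R d\<bar> \<le> cov_bound * exp (- \<theta> * real d)"
proof -
  define T where "T = exp (\<theta> * real d)"
  have T1: "1 \<le> T" using \<theta>_pos by (simp add: T_def)
  define a where "a x = clip T (X 0 x)" for x
  define c where "c x = clip T (X d x)" for x
  have [measurable]: "c \<in> borel_measurable M" "a \<in> borel_measurable M" unfolding c_def a_def by measurable
  have m: "c \<in> borel_measurable (future d)" "a \<in> borel_measurable (past 0)"
    unfolding c_def a_def using X_future[of d d] X_past[of 0 0] by measurable
  have cT: "\<bar>c x\<bar> \<le> T" "\<bar>a x\<bar> \<le> T" for x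
    unfolding c_def a_def using T1 abs_clip_le[of T] by auto
  have cc: "\<bar>(\<integral>x. a x * c x \<partial>M) - (\<integral>x. a x \<partial>M) * (\<integral>x. c x \<partial>M)\<bar> \<le> 4 * T * T * (K * exp (- \<beta> * real d))"
    by (rule cov_mixing[OF d _ m(2) cT(2) m(1) cT(1)]) auto
  have aci: "integrable M (\<lambda>x. a x * c x)"
    by (rule integral_dominated(1)[of _ "\<lambda>x. T * T"]) (use cT T1 in \<open>auto simp: abs_mult intro!: mult_mono\<close>)
  have dc: "\<bar>X 0 x * X d x - a x * c x\<bar> \<le> (\<bar>X 0 x\<bar>^3 + \<bar>X d x\<bar>^3) / T" for x
    unfolding c_def a_def using clip_prod_diff_le T1 by auto
  have i2: "integrable M (\<lambda>x. (\<bar>X 0 x\<bar>^3 + \<bar>X d x\<bar>^3) / T)" using cube_int by auto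
  have e: "(\<integral>x. (\<bar>X 0 x\<bar>^3 + \<bar>X d x\<bar>^3) / T \<partial>M) \<le> 2 * m3 / T"
    using cube_le[of 0] cube_le[of d] cube_int[of 0] cube_int[of d] T1 by (simp add: divide_right_mono)
  have dci: "integrable M (\<lambda>x. X 0 x * X d x - a x * c x)"
    and "\<bar>\<integral>x. X 0 x * X d x - a x * c x \<partial>M\<bar> \<le> (\<integral>x. (\<bar>X 0 x\<bar>^3 + \<bar>X d x\<bar>^3) / T \<partial>M)"
    using integral_dominated[OF i2 _ dc] by auto
  with e have 1: "\<bar>R d - (\<integral>x. a x * c x \<partial>M)\<bar> \<le> 2 * m3 / T"
    using XX_int aci cov_eq[of 0 d] by simp
  have 2: "\<bar>(\<integral>x. a x \<partial>M) * (\<integral>x. c x \<partial>M)\<bar> \<le> (m3 / T^2) * (m3 / T^2)"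
    unfolding abs_mult a_def c_def using clip_mean[of T] T1 m3_nonneg by (intro mult_mono) auto
  have "\<bar>R d\<bar> \<le> 2 * m3 / T + 4 * T * T * (K * exp (- \<beta> * real d)) + m3^2 / T^4"
    using 1 2 cc by (simp add: power2_eq_square power4_eq_xxxx mult.assoc)
  also have "\<dots> \<le> 2 * m3 / T + 4 * K / T + m3^2 / T^1"
    using T1 unfolding exp_T T_def[symmetric] 
    by (intro add_mono divide_left_mono power_increasing) (auto simp: field_simps power3_eq_cube m3_nonneg)
  also have "\<dots> \<le> cov_bound / T" 
    using T1 m3_nonneg unfolding add_divide_distrib[symmetric] cov_bound_def power_one_right by (intro divide_right_mono) auto
  finally show ?thesis unfolding exp_T T_def[symmetric] by simp
qed

lemma R0_le: "\<bar>R d\<bar> \<le> moment_bound"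
  using cov_eq[of 0 d] XX_abs[of 0 "0+d"] integral_abs_bound[of M "\<lambda>x. X 0 x * X (0+d) x"] by linarith

text \<open>For \<open>m = 0\<close> the partial sum is the constant 0 and the difference is exactly
  0. This covers windows that reach back beyond the start of the sequence.\<close>

lemma cov_S_XX:
  assumes "m = 0 \<or> (m + p \<le> i \<and> m + p \<le> j)" and \<phi>: "\<phi> \<in> borel_measurable borel" "\<And>x. \<bar>\<phi> x\<bar> \<le> a"
  shows "\<bar>(\<integral>x. \<phi> (S m x) * (X i x * X j x) \<partial>M) - (\<integral>x. \<phi> (S m x) \<partial>M) * (\<integral>x. X i x * X j x \<partial>M)\<bar>
    \<le> a * cov_bound * exp (- \<theta> * real p)"
proof (cases m)
  case 0
  have "0 \<le> a" using \<phi>(2)[of 0] by linarith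
  then show ?thesis using 0 cov_bound_nonneg by (simp add: S_def prob_space)
next
  case (Suc m')
  have "(\<lambda>x. \<phi> (S m x)) \<in> borel_measurable (past m')"
    using S_past[of m m'] \<phi>(1) Suc by (intro measurable_compose[OF _ \<phi>(1)]) auto
  \<comment> \<open>The sum \<open>S (Suc m')\<close> only reaches \<open>X m'\<close>, so the
    available gap is \<open>Suc p\<close>, which also meets the requirement of a gap of at least 1
    when p = 0.\<close>
  then have "\<bar>(\<integral>x. \<phi> (S m x) * (X i x * X j x) \<partial>M) - (\<integral>x. \<phi> (S m x) \<partial>M) * (\<integral>x. X i x * X j x \<partial>M)\<bar>
    \<le> a * cov_bound * exp (- \<theta> * real (Suc p))"
    using Suc assms(1) \<phi>(2) by (intro cov_XX[of _ m']) auto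
  also have "\<dots> \<le> a * cov_bound * exp (- \<theta> * real p)"
    using \<theta>_pos cov_bound_nonneg order_trans[OF abs_ge_zero \<phi>(2)[of 0]] by (intro mult_left_mono) auto
  finally show ?thesis .
qed

lemma cov_S_X:
  assumes "m = 0 \<or> m + p \<le> j" and \<phi>: "\<phi> \<in> borel_measurable borel" "\<And>x. \<bar>\<phi> x\<bar> \<le> a"
  shows "\<bar>\<integral>x. \<phi> (S m x) * X j x \<partial>M\<bar> \<le> a * cov_bound * exp (- \<theta> * real p)"
proof (cases m)
  case 0
  have "0 \<le> a" using \<phi>(2)[of 0] by linarith
  then show ?thesis using 0 cov_bound_nonneg by (simp add: S_def mean_zero)
next
  case (Suc m')
  have "(\<lambda>x. \<phi> (S m x)) \<in> borel_measurable (past m')"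
    using S_past[of m m'] \<phi>(1) Suc by (intro measurable_compose[OF _ \<phi>(1)]) auto
  then have "\<bar>\<integral>x. \<phi> (S m x) * X j x \<partial>M\<bar> \<le> a * cov_bound * exp (- \<theta> * real (Suc p))"
    using Suc assms(1) \<phi>(2) by (intro cov_X[of _ m']) auto
  also have "\<dots> \<le> a * cov_bound * exp (- \<theta> * real p)"
    using \<theta>_pos cov_bound_nonneg order_trans[OF abs_ge_zero \<phi>(2)[of 0]] by (intro mult_left_mono) auto
  finally show ?thesis .
qed

text \<open>Without independence the first-order term g1 (S k) X k survives. Rolled back over the
  window it yields one covariance for each lag, and with R 0 / 2 from the second-order term these
  form half of the variance that step k adds. Truncated subtraction in \<open>k - p\<close> shortens
  the window for early k.\<close>

lemma lindeberg_step:
  fixes g0 g1 g2 g3 :: "real \<Rightarrow> real"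
  assumes d0: "\<And>x. (g0 has_real_derivative g1 x) (at x)"
    and d1: "\<And>x. (g1 has_real_derivative g2 x) (at x)"
    and d2: "\<And>x. (g2 has_real_derivative g3 x) (at x)"
    and b0: "\<And>x. \<bar>g0 x\<bar> \<le> L0" and b1: "\<And>x. \<bar>g1 x\<bar> \<le> L1" and b2: "\<And>x. \<bar>g2 x\<bar> \<le> L2" and b3: "\<And>x. \<bar>g3 x\<bar> \<le> L3"
  shows "\<bar>(\<integral>x. g0 (S (Suc k) x) \<partial>M) - (\<integral>x. g0 (S k x) \<partial>M)
      - (R 0 / 2 + (\<Sum>j\<in>{k - p..<k}. R (k - j))) * (\<integral>x. g2 (S k x) \<partial>M)\<bar>
    \<le> L1 * cov_bound * exp (- \<theta> * real p) + (p + 1) * (3 * moment_bound^2 * L3 * (p + 1) + L2 * cov_bound * exp (- \<theta> * real p))"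
proof -
  define e where "e = exp (- \<theta> * real p)"
  note T = taylor_bounds[OF d0 d1 d2 b3]
  have meas: "g0 \<in> borel_measurable borel" "g1 \<in> borel_measurable borel" "g2 \<in> borel_measurable borel"
    using DERIV_isCont[OF d0] DERIV_isCont[OF d1] DERIV_isCont[OF d2]
    by (auto intro!: borel_measurable_continuous_onI continuous_at_imp_continuous_on)
  note [measurable] = meas
  have L: "0 \<le> L1" "0 \<le> L2" "0 \<le> L3" using b1[of 0] b2[of 0] b3[of 0] by auto
  have bi: "integrable M (\<lambda>x. h (S m x))" if "h \<in> borel_measurable borel" "\<And>x. \<bar>h x\<bar> \<le> c" for h :: "real \<Rightarrow> real" and m c
    by (rule integrable_const_bound[of _ c]) (use that in auto)
  note i0 = bi[OF meas(1) b0] and i2 = bi[OF meas(3) b2]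
  have biX: "integrable M (\<lambda>x. h (S m x) * X i x)" if "h \<in> borel_measurable borel" "\<And>x. \<bar>h x\<bar> \<le> c" for h :: "real \<Rightarrow> real" and m i c
    by (rule integral_dominated(1)[of _ "\<lambda>x. c * \<bar>X i x\<bar>"]) (use that X_int in \<open>auto simp: abs_mult intro!: mult_right_mono\<close>)
  have biXX: "integrable M (\<lambda>x. h (S m x) * (X i x * X j x))" if "h \<in> borel_measurable borel" "\<And>x. \<bar>h x\<bar> \<le> c" for h :: "real \<Rightarrow> real" and m i j c
  proof (rule integral_dominated(1)[of _ "\<lambda>x. c * \<bar>X i x * X j x\<bar>"])
    show "integrable M (\<lambda>x. c * \<bar>X i x * X j x\<bar>)" using XX_int[of i j] by (intro integrable_mult_right integrable_abs)
    show "(\<lambda>x. h (S m x) * (X i x * X j x)) \<in> borel_measurable M" using that by measurable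
    show "\<bar>h (S m x) * (X i x * X j x)\<bar> \<le> c * \<bar>X i x * X j x\<bar>" for x
      unfolding abs_mult[of "h _"] using that by (intro mult_right_mono) auto
  qed
  have Sd: "(\<integral>x. \<bar>S n x - S m x\<bar> * \<bar>X i x\<bar> * \<bar>X j x\<bar> \<partial>M) \<le> real (n - m) * moment_bound \<and> integrable M (\<lambda>x. \<bar>S n x - S m x\<bar> * \<bar>X i x\<bar> * \<bar>X j x\<bar>)
      \<and> (\<integral>x. \<bar>S n x - S m x\<bar> \<partial>M) \<le> real (n - m) * moment_bound \<and> integrable M (\<lambda>x. \<bar>S n x - S m x\<bar>)" if "m \<le> n" for m n i j
  proof -
    have le: "\<bar>S n x - S m x\<bar> \<le> (\<Sum>l\<in>{m..<n}. \<bar>X l x\<bar>)" for x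
      using S_diff[OF that] by simp
    have le3: "\<bar>\<bar>S n x - S m x\<bar> * \<bar>X i x\<bar> * \<bar>X j x\<bar>\<bar> \<le> (\<Sum>l\<in>{m..<n}. \<bar>X l x\<bar> * \<bar>X i x\<bar> * \<bar>X j x\<bar>)" for x
      unfolding sum_distrib_right[symmetric] abs_mult using le by (auto intro!: mult_right_mono)
    have isum: "integrable M (\<lambda>x. \<Sum>l\<in>{m..<n}. \<bar>X l x\<bar> * \<bar>X i x\<bar> * \<bar>X j x\<bar>)"
      using XXX_int by (intro Bochner_Integration.integrable_sum)
    have i1: "integrable M (\<lambda>x. \<Sum>l\<in>{m..<n}. \<bar>X l x\<bar>)"
      using X_int by (intro Bochner_Integration.integrable_sum) auto
    have "(\<integral>x. (\<Sum>l\<in>{m..<n}. \<bar>X l x\<bar> * \<bar>X i x\<bar> * \<bar>X j x\<bar>) \<partial>M) \<le> (\<Sum>l\<in>{m..<n}. moment_bound)"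
      unfolding Bochner_Integration.integral_sum[OF XXX_int] by (intro sum_mono XXX_abs)
    moreover have "(\<integral>x. (\<Sum>l\<in>{m..<n}. \<bar>X l x\<bar>) \<partial>M) \<le> (\<Sum>l\<in>{m..<n}. moment_bound)"
      unfolding Bochner_Integration.integral_sum[OF integrable_abs[OF X_int]] by (intro sum_mono X_abs)
    moreover have "integrable M (\<lambda>x. \<bar>S n x - S m x\<bar> * \<bar>X i x\<bar> * \<bar>X j x\<bar>)"
      "\<bar>\<integral>x. \<bar>S n x - S m x\<bar> * \<bar>X i x\<bar> * \<bar>X j x\<bar> \<partial>M\<bar> \<le> (\<integral>x. (\<Sum>l\<in>{m..<n}. \<bar>X l x\<bar> * \<bar>X i x\<bar> * \<bar>X j x\<bar>) \<partial>M)"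
      by (rule integral_dominated[OF isum _ le3], measurable)+
    moreover have "integrable M (\<lambda>x. \<bar>S n x - S m x\<bar>)"
      "\<bar>\<integral>x. \<bar>S n x - S m x\<bar> \<partial>M\<bar> \<le> (\<integral>x. (\<Sum>l\<in>{m..<n}. \<bar>X l x\<bar>) \<partial>M)"
      by (rule integral_dominated[OF i1]; use le in simp)+
    ultimately show ?thesis unfolding sum_constant card_atLeastLessThan by linarith
  qed
  \<comment> \<open>To factor the mean of g2 (S j) X j X k, step back once more by p, from
    \<open>S j\<close> to \<open>S m\<close>: the exchange costs L3 p, mixing then splits off R (k -
    j), and advancing from \<open>S m\<close> to \<open>S k\<close> costs 2 L3 p. This second
    look-back, repeated for each of up to p lags, is why the error is quadratic in p.\<close>
  have cterm: "\<bar>(\<integral>x. g2 (S j x) * (X j x * X k x) \<partial>M) - R (k - j) * (\<integral>x. g2 (S k x) \<partial>M)\<bar>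
      \<le> L3 * (p * moment_bound) + L2 * cov_bound * e + moment_bound * (L3 * (2 * p * moment_bound))" if j: "k - p \<le> j" "j \<le> k" for j
  proof -
    define m where "m = j - p"
    have mj: "m \<le> j" "j - m \<le> p" "m \<le> k" "k - m \<le> 2 * p" "m = 0 \<or> (m + p \<le> j \<and> m + p \<le> k)" using j by (auto simp: m_def)
    have a: "\<bar>g2 (S n x) - g2 (S m x)\<bar> \<le> L3 * \<bar>S n x - S m x\<bar>" for n x
      using T(1)[of "S m x" "S n x - S m x"] by simp
    have a3: "\<bar>(g2 (S j x) - g2 (S m x)) * (X j x * X k x)\<bar> \<le> L3 * (\<bar>S j x - S m x\<bar> * \<bar>X j x\<bar> * \<bar>X k x\<bar>)" for x
      unfolding abs_mult mult.assoc[symmetric] using a by (intro mult_right_mono) auto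
    have "\<bar>\<integral>x. (g2 (S j x) - g2 (S m x)) * (X j x * X k x) \<partial>M\<bar> \<le> (\<integral>x. L3 * (\<bar>S j x - S m x\<bar> * \<bar>X j x\<bar> * \<bar>X k x\<bar>) \<partial>M)"
      by (rule integral_dominated(2)[OF _ _ a3]) (use Sd[OF mj(1)] in auto)
    also have "\<dots> \<le> L3 * (real (j - m) * moment_bound)"
      using Sd[OF mj(1)] L by (auto intro!: mult_left_mono)
    also have "\<dots> \<le> L3 * (p * moment_bound)" using L mj moment_bound_ge by (intro mult_left_mono mult_right_mono) auto
    finally have 1: "\<bar>(\<integral>x. g2 (S j x) * (X j x * X k x) \<partial>M) - (\<integral>x. g2 (S m x) * (X j x * X k x) \<partial>M)\<bar> \<le> L3 * (p * moment_bound)"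
      using biXX[OF meas(3) b2] by (simp add: left_diff_distrib)
    have Rk: "(\<integral>x. X j x * X k x \<partial>M) = R (k - j)" using cov_eq[of j "k - j"] j by simp
    have 2: "\<bar>(\<integral>x. g2 (S m x) * (X j x * X k x) \<partial>M) - (\<integral>x. g2 (S m x) \<partial>M) * R (k - j)\<bar> \<le> L2 * cov_bound * e"
      unfolding e_def using cov_S_XX[OF mj(5) meas(3) b2] Rk by simp
    have "\<bar>\<integral>x. g2 (S k x) - g2 (S m x) \<partial>M\<bar> \<le> (\<integral>x. L3 * \<bar>S k x - S m x\<bar> \<partial>M)"
      by (rule integral_dominated(2)[OF _ _ a]) (use Sd[OF mj(3)] in auto)
    also have "\<dots> \<le> L3 * (real (k - m) * moment_bound)"
      using Sd[OF mj(3)] L by (auto intro!: mult_left_mono)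
    also have "\<dots> \<le> L3 * (real (2 * p) * moment_bound)" using L mj moment_bound_ge by (intro mult_left_mono mult_right_mono) (auto simp del: of_nat_mult)
    finally have "\<bar>(\<integral>x. g2 (S k x) \<partial>M) - (\<integral>x. g2 (S m x) \<partial>M)\<bar> \<le> L3 * (2 * p * moment_bound)"
      using i2 by simp
    then have "\<bar>R (k - j)\<bar> * \<bar>(\<integral>x. g2 (S k x) \<partial>M) - (\<integral>x. g2 (S m x) \<partial>M)\<bar> \<le> moment_bound * (L3 * (2 * p * moment_bound))"
      using R0_le moment_bound_ge by (intro mult_mono) auto
    then have 3: "\<bar>R (k - j) * (\<integral>x. g2 (S k x) \<partial>M) - (\<integral>x. g2 (S m x) \<partial>M) * R (k - j)\<bar> \<le> moment_bound * (L3 * (2 * p * moment_bound))"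
      unfolding abs_mult[symmetric] by (simp add: algebra_simps)
    show ?thesis using 1 2 3 by linarith
  qed
  define E where "E = L3 * (p * moment_bound) + L2 * cov_bound * e + moment_bound * (L3 * (2 * p * moment_bound))"
  have st: "\<bar>(\<integral>x. (g1 (S (Suc j) x) - g1 (S j x)) * X k x \<partial>M) - (\<integral>x. g2 (S j x) * (X j x * X k x) \<partial>M)\<bar> \<le> L3 * moment_bound" for j
  proof -
    have le: "\<bar>(g1 (S (Suc j) x) - g1 (S j x) - g2 (S j x) * X j x) * X k x\<bar> \<le> L3 * (\<bar>X j x\<bar> * \<bar>X j x\<bar> * \<bar>X k x\<bar>)" for x
      using mult_right_mono[OF T(2)[of "S j x" "X j x"] abs_ge_zero[of "X k x"]]
      by (simp add: S_Suc abs_mult power2_eq_square mult.assoc)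
    have "\<bar>\<integral>x. (g1 (S (Suc j) x) - g1 (S j x) - g2 (S j x) * X j x) * X k x \<partial>M\<bar> \<le> (\<integral>x. L3 * (\<bar>X j x\<bar> * \<bar>X j x\<bar> * \<bar>X k x\<bar>) \<partial>M)"
      by (rule integral_dominated(2)[OF integrable_mult_right[OF XXX_int] _ le]) measurable
    also have "\<dots> \<le> L3 * moment_bound" unfolding integral_mult_right_zero using XXX_abs L by (intro mult_left_mono)
    also have "(\<integral>x. (g1 (S (Suc j) x) - g1 (S j x) - g2 (S j x) * X j x) * X k x \<partial>M) =
      (\<integral>x. (g1 (S (Suc j) x) - g1 (S j x)) * X k x - g2 (S j x) * (X j x * X k x) \<partial>M)"
      by (simp add: algebra_simps)
    also have "\<dots> = (\<integral>x. (g1 (S (Suc j) x) - g1 (S j x)) * X k x \<partial>M) - (\<integral>x. g2 (S j x) * (X j x * X k x) \<partial>M)"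
      using biX[OF meas(2) b1] biXX[OF meas(3) b2] by (subst Bochner_Integration.integral_diff) (auto simp: left_diff_distrib)
    finally show ?thesis .
  qed
  let ?I = "{k - p..<k}"
  have tel: "g1 (S k x) = g1 (S (k - p) x) + (\<Sum>j\<in>?I. g1 (S (Suc j) x) - g1 (S j x))" for x
    using sum_Suc_diff'[of "k - p" k "\<lambda>j. g1 (S j x)"] by simp
  have "(\<integral>x. g1 (S k x) * X k x \<partial>M) = (\<integral>x. g1 (S (k - p) x) * X k x + (\<Sum>j\<in>?I. (g1 (S (Suc j) x) - g1 (S j x)) * X k x) \<partial>M)"
    by (subst tel) (simp add: sum_distrib_right ring_distribs)
  also have "\<dots> = (\<integral>x. g1 (S (k - p) x) * X k x \<partial>M) + (\<Sum>j\<in>?I. (\<integral>x. (g1 (S (Suc j) x) - g1 (S j x)) * X k x \<partial>M))"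
    using biX[OF meas(2) b1] by (subst Bochner_Integration.integral_add) (auto simp: left_diff_distrib intro!: Bochner_Integration.integral_sum)
  finally have g1e: "(\<integral>x. g1 (S k x) * X k x \<partial>M) = (\<integral>x. g1 (S (k - p) x) * X k x \<partial>M) + (\<Sum>j\<in>?I. (\<integral>x. (g1 (S (Suc j) x) - g1 (S j x)) * X k x \<partial>M))" .
  \<comment> \<open>If k <= p the base point is \<open>S 0\<close>, a constant, and the zero mean of
    \<open>X k\<close> kills the term; otherwise the gap is exactly p.\<close>
  have c1: "\<bar>\<integral>x. g1 (S (k - p) x) * X k x \<partial>M\<bar> \<le> L1 * cov_bound * e"
    unfolding e_def by (rule cov_S_X[OF _ meas(2) b1]) auto
  have "\<bar>(\<Sum>j\<in>?I. (\<integral>x. (g1 (S (Suc j) x) - g1 (S j x)) * X k x \<partial>M)) - (\<Sum>j\<in>?I. R (k - j) * (\<integral>x. g2 (S k x) \<partial>M))\<bar>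
    \<le> (\<Sum>j\<in>?I. \<bar>(\<integral>x. (g1 (S (Suc j) x) - g1 (S j x)) * X k x \<partial>M) - R (k - j) * (\<integral>x. g2 (S k x) \<partial>M)\<bar>)"
    unfolding sum_subtractf[symmetric] by (rule sum_abs)
  also have "\<dots> \<le> (\<Sum>j\<in>?I. L3 * moment_bound + E)"
  proof (rule sum_mono)
    fix j assume "j \<in> ?I"
    then show "\<bar>(\<integral>x. (g1 (S (Suc j) x) - g1 (S j x)) * X k x \<partial>M) - R (k - j) * (\<integral>x. g2 (S k x) \<partial>M)\<bar> \<le> L3 * moment_bound + E"
      using st[of j] cterm[of j] by (auto simp: E_def)
  qed
  also have "\<dots> = real (k - (k - p)) * (L3 * moment_bound + E)" by simp
  also have "\<dots> \<le> real p * (L3 * moment_bound + E)"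
    using L moment_bound_ge cov_bound_nonneg by (intro mult_right_mono) (auto simp: E_def e_def)
  finally have c2: "\<bar>(\<Sum>j\<in>?I. (\<integral>x. (g1 (S (Suc j) x) - g1 (S j x)) * X k x \<partial>M)) - (\<Sum>j\<in>?I. R (k - j) * (\<integral>x. g2 (S k x) \<partial>M))\<bar>
    \<le> real p * (L3 * moment_bound + E)" .
  have c3: "\<bar>(\<integral>x. g2 (S k x) * (X k x * X k x) \<partial>M) - R 0 * (\<integral>x. g2 (S k x) \<partial>M)\<bar> \<le> E"
    using cterm[of k] by (simp add: E_def)
  have c4: "\<bar>(\<integral>x. g0 (S (Suc k) x) \<partial>M) - (\<integral>x. g0 (S k x) \<partial>M) - (\<integral>x. g1 (S k x) * X k x \<partial>M)
    - (\<integral>x. g2 (S k x) * (X k x * X k x) \<partial>M) / 2\<bar> \<le> L3 * moment_bound"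
  proof -
    have le: "\<bar>g0 (S (Suc k) x) - g0 (S k x) - g1 (S k x) * X k x - g2 (S k x) * (X k x * X k x) / 2\<bar> \<le> L3 * \<bar>X k x\<bar>^3" for x
      using T(3)[of "S k x" "X k x"] by (simp add: S_Suc power2_eq_square)
    have "\<bar>\<integral>x. g0 (S (Suc k) x) - g0 (S k x) - g1 (S k x) * X k x - g2 (S k x) * (X k x * X k x) / 2 \<partial>M\<bar> \<le> (\<integral>x. L3 * \<bar>X k x\<bar>^3 \<partial>M)"
      by (rule integral_dominated(2)[OF _ _ le]) (use cube_int in auto)
    also have "\<dots> \<le> L3 * moment_bound" using cube_le[of k] moment_bound_ge L by (auto intro!: mult_left_mono)
    also have "(\<integral>x. g0 (S (Suc k) x) - g0 (S k x) - g1 (S k x) * X k x - g2 (S k x) * (X k x * X k x) / 2 \<partial>M)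
      = (\<integral>x. g0 (S (Suc k) x) \<partial>M) - (\<integral>x. g0 (S k x) \<partial>M) - (\<integral>x. g1 (S k x) * X k x \<partial>M)
    - (\<integral>x. g2 (S k x) * (X k x * X k x) / 2 \<partial>M)"
      using i0 biX[OF meas(2) b1] biXX[OF meas(3) b2]
      by (subst Bochner_Integration.integral_diff | intro Bochner_Integration.integrable_diff integrable_divide | simp)+
    finally show ?thesis by simp
  qed
  have s: "(\<Sum>j\<in>?I. R (k - j) * (\<integral>x. g2 (S k x) \<partial>M)) = (\<Sum>j\<in>?I. R (k - j)) * (\<integral>x. g2 (S k x) \<partial>M)"
    by (simp add: sum_distrib_right)
  have "\<bar>(\<integral>x. g0 (S (Suc k) x) \<partial>M) - (\<integral>x. g0 (S k x) \<partial>M)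
      - (R 0 / 2 + (\<Sum>j\<in>{k - p..<k}. R (k - j))) * (\<integral>x. g2 (S k x) \<partial>M)\<bar> \<le> L1 * cov_bound * e + real p * (L3 * moment_bound + E) + L3 * moment_bound + E / 2"
    using c1 c2 c3 c4 g1e unfolding s ring_distribs by (simp add: abs_le_iff)
  also have "\<dots> \<le> L1 * cov_bound * e + real p * (L3 * moment_bound + E) + L3 * moment_bound + E"
    using L moment_bound_ge cov_bound_nonneg by (simp add: E_def e_def)
  also have "\<dots> = L1 * cov_bound * e + (p + 1) * (L3 * moment_bound + E)" by (simp add: algebra_simps)
  also have "L3 * moment_bound + E \<le> 3 * moment_bound^2 * L3 * (p + 1) + L2 * cov_bound * e"
  proof -
    have BB: "moment_bound \<le> moment_bound^2" using moment_bound_ge by (simp add: power2_eq_square)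
    have "L3 * (p * moment_bound) \<le> L3 * (p * moment_bound^2)" "L3 * moment_bound \<le> L3 * moment_bound^2"
      using BB L by (auto intro!: mult_left_mono)
    moreover have "0 \<le> L3 * moment_bound^2" "moment_bound * (L3 * (2 * p * moment_bound)) = 2 * (L3 * (p * moment_bound^2))" using L by (auto simp: power2_eq_square)
    moreover have "3 * moment_bound^2 * L3 * (p + 1) = 3 * (L3 * (p * moment_bound^2)) + 3 * (L3 * moment_bound^2)" by (simp add: algebra_simps)
    ultimately show ?thesis unfolding E_def by linarith
  qed
  finally show ?thesis unfolding e_def by (simp add: mult_left_mono add.commute)
qed

lemma R_summable: "summable (\<lambda>d. R (Suc d))" and R_tail: "\<exists>D\<ge>0. \<forall>q. \<bar>(\<Sum>d. R (Suc d)) - (\<Sum>d<q. R (Suc d))\<bar> \<le> D * exp (- \<theta> * real q)"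
proof -
  define r where "r = exp (- \<theta>)"
  have r: "0 \<le> r" "r < 1" using \<theta>_pos by (auto simp: r_def)
  have le: "\<bar>R (Suc d)\<bar> \<le> cov_bound * r ^ d" for d
  proof -
    have "\<bar>R (Suc d)\<bar> \<le> cov_bound * exp (- \<theta> * real (Suc d))" by (rule R_le) simp
    also have "\<dots> \<le> cov_bound * exp (real d * (- \<theta>))" using cov_bound_nonneg \<theta>_pos by (intro mult_left_mono) (auto simp: algebra_simps)
    finally show ?thesis by (simp only: exp_of_nat_mult r_def)
  qed
  have sg: "summable (\<lambda>d. cov_bound * r ^ d)" using r by (intro summable_mult summable_geometric) auto
  have sa: "summable (\<lambda>d. \<bar>R (Suc d)\<bar>)" by (rule summable_comparison_test'[OF sg]) (use le in auto)
  show su: "summable (\<lambda>d. R (Suc d))" using sa by (rule summable_rabs_cancel)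
  show "\<exists>D\<ge>0. \<forall>q. \<bar>(\<Sum>d. R (Suc d)) - (\<Sum>d<q. R (Suc d))\<bar> \<le> D * exp (- \<theta> * real q)"
  proof (intro exI[of _ "cov_bound / (1 - r)"] conjI allI)
    show "0 \<le> cov_bound / (1 - r)" using cov_bound_nonneg r by simp
    fix q
    have "(\<Sum>d. R (Suc d)) - (\<Sum>d<q. R (Suc d)) = (\<Sum>d. R (Suc (d + q)))"
      using suminf_minus_initial_segment[OF su, of q] by simp
    also have "\<bar>\<dots>\<bar> \<le> (\<Sum>d. \<bar>R (Suc (d + q))\<bar>)"
      using summable_ignore_initial_segment[OF sa, of q] by (intro summable_rabs) simp
    also have "\<dots> \<le> (\<Sum>d. cov_bound * r ^ (d + q))"
      using summable_ignore_initial_segment[OF sa, of q] summable_ignore_initial_segment[OF sg, of q] le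
      by (intro suminf_le) auto
    also have "\<dots> = (\<Sum>d. (cov_bound * r ^ q) * r ^ d)" by (simp add: power_add mult_ac)
    also have "\<dots> = cov_bound * r ^ q * (1 / (1 - r))"
      using r by (subst suminf_mult) (auto intro: summable_geometric simp: suminf_geometric)
    also have "r ^ q = exp (- \<theta> * real q)" unfolding r_def by (simp only: exp_of_nat_mult[symmetric] mult.commute)
    finally show "\<bar>(\<Sum>d. R (Suc d)) - (\<Sum>d<q. R (Suc d))\<bar> \<le> cov_bound / (1 - r) * exp (- \<theta> * real q)" by simp
  qed
qed

end

section \<open>Smooth central limit theorem\<close>

abbreviation "phi \<equiv> std_normal_density"

lemma phi_deriv: "(phi has_real_derivative - x * phi x) (at x)"
proof -
  have "((\<lambda>x::real. exp (- x\<^sup>2 / 2)) has_real_derivative - x * exp (- x\<^sup>2 / 2)) (at x)"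
    by (auto intro!: derivative_eq_intros)
  from DERIV_cmult[OF this] show ?thesis
    unfolding std_normal_density_def[abs_def] by (rule DERIV_cong) simp
qed

lemma phi_isCont: "continuous_on A phi"
  using DERIV_isCont[OF phi_deriv] by (auto intro!: continuous_at_imp_continuous_on)

lemma measure_density_normal:
  assumes "A \<in> sets borel"
  shows "measure (density lborel (normal_density \<mu> s)) A = (\<integral>x. indicator A x * normal_density \<mu> s x \<partial>lborel)"
proof -
  have "emeasure (density lborel (normal_density \<mu> s)) A = (\<integral>\<^sup>+x. ennreal (indicator A x * normal_density \<mu> s x) \<partial>lborel)"
    using assms by (subst emeasure_density) (auto intro!: nn_integral_cong simp: indicator_def)
  moreover have "(\<integral>x. indicator A x * normal_density \<mu> s x \<partial>lborel) = enn2real (\<integral>\<^sup>+x. ennreal (indicator A x * normal_density \<mu> s x) \<partial>lborel)"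
    by (rule integral_eq_nn_integral) (use assms in auto)
  ultimately show ?thesis unfolding measure_def by simp
qed

lemma Qfun_diff: assumes "c \<le> x" shows "Qfun c - Qfun x = integral {c..x} phi"
proof -
  have i: "integrable lborel (\<lambda>y. indicator A y * phi y)" if "A \<in> sets borel" for A
    using integrable_mult_indicator[of A lborel phi] that by auto
  have si: "set_integrable lborel {c..x} phi" unfolding set_integrable_def using i[of "{c..x}"] by simp
  have "Qfun c - Qfun x = (\<integral>y. indicator {c<..} y * phi y - indicator {x<..} y * phi y \<partial>lborel)"
    unfolding Qfun_def using i by (simp add: measure_density_normal)
  also have "\<dots> = (\<integral>y. indicator {c..x} y * phi y \<partial>lborel)"
  proof (rule integral_cong_AE)
    show "AE y in lborel. indicator {c<..} y * phi y - indicator {x<..} y * phi y = indicator {c..x} y * phi y"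
      using AE_lborel_singleton[of c] by eventually_elim (use assms in \<open>auto simp: indicator_def\<close>)
  qed auto
  also have "\<dots> = integral {c..x} phi"
    using set_borel_integral_eq_integral(2)[OF si] by (simp add: set_lebesgue_integral_def)
  finally show ?thesis .
qed

lemma Qfun_deriv: "(Qfun has_real_derivative - phi x) (at x)"
proof -
  have "((\<lambda>y. integral {x - 1..y} phi) has_real_derivative phi x) (at x within {x - 1..x + 1})"
    by (rule integral_has_real_derivative) (auto intro: phi_isCont)
  then have "((\<lambda>y. Qfun (x - 1) - integral {x - 1..y} phi) has_real_derivative - phi x) (at x within {x - 1..x + 1})"
    by (auto intro!: derivative_eq_intros)
  then have "(Qfun has_real_derivative - phi x) (at x within {x - 1..x + 1})"
    by (rule has_field_derivative_transform_within[of _ _ _ _ 1]) (use Qfun_diff[of "x - 1"] in \<open>auto simp: algebra_simps\<close>)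
  moreover have "at x within {x - 1..x + 1} = at x" by (rule at_within_interior) auto
  ultimately show ?thesis by simp
qed

text \<open>The density is at most exp (- y^2 / 2), and the Taylor lower bound 1 + y^2/2 + y^4/8 for
  the reciprocal dominates each polynomial. The constants are not meant to be sharp.\<close>

lemma phi_bounds:
  "0 \<le> phi y" "phi y \<le> 1" "\<bar>y\<bar> * phi y \<le> 1" "y^2 * phi y \<le> 2" "\<bar>y\<bar>^3 * phi y \<le> 4"
proof -
  define E where "E = exp (y^2 / 2)"
  define a where "a = \<bar>y\<bar>"
  have a: "0 \<le> a" "y^2 = a^2" by (auto simp: a_def)
  have "phi y = exp (- (y^2) / 2) / sqrt (2 * pi)" by (simp add: std_normal_density_def)
  also have "\<dots> \<le> exp (- (y^2) / 2) / 1"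
    using pi_gt3 by (intro divide_left_mono) auto
  also have "\<dots> = 1 / E" by (simp add: E_def exp_minus field_simps)
  finally have le: "phi y \<le> 1 / E" .
  have E0: "0 < E" by (simp add: E_def)
  have E: "1 + a^2/2 + a^4/8 \<le> E"
    using exp_lower_Taylor_quadratic[of "y^2/2"] unfolding E_def a(2)
    by (simp add: power2_eq_square power4_eq_xxxx)
  have *: "f * phi y \<le> c" if "0 \<le> f" "f \<le> c * E" for f c
  proof -
    have "f * phi y \<le> f * (1 / E)" using that le by (intro mult_left_mono) auto
    also have "\<dots> \<le> c" using that E0 by (simp add: field_simps)
    finally show ?thesis .
  qed
  show "0 \<le> phi y" by simp
  have q: "0 \<le> (a - 1)^2" "0 \<le> (a^2 - a)^2" "0 \<le> a^2" "0 \<le> a^4" by auto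
  show "phi y \<le> 1" using *[of 1 1] E q by simp
  have "2 * a \<le> 1 + a^2" using q(1) by (simp add: power2_eq_square algebra_simps)
  then have "a \<le> 1 * E" using E q(3,4) by linarith
  then show "\<bar>y\<bar> * phi y \<le> 1" using *[of a 1] a unfolding a_def[symmetric] by simp
  show "y^2 * phi y \<le> 2" using *[of "a^2" 2] E q a by simp
  have "2 * a^3 \<le> a^2 + a^4" using q(2) by (simp add: power2_eq_square power3_eq_cube power4_eq_xxxx algebra_simps)
  then have "a^3 \<le> 4 * E" using E q(3,4) by linarith
  then show "\<bar>y\<bar>^3 * phi y \<le> 4" using *[of "a^3" 4] a unfolding a_def[symmetric] by simp
qed

text \<open>\<open>heat0 s x\<close> solves the heat equation with time \<open>s\<close>; \<open>heat1\<close>, \<open>heat2\<close>, \<open>heat3\<close>, \<open>heat4\<close>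
  are its derivatives in \<open>x\<close>.\<close>

definition "heat0 s x = Qfun (x / sqrt s)"
definition "heat1 s x = - phi (x / sqrt s) / sqrt s"
definition "heat2 s x = (x / sqrt s) * phi (x / sqrt s) / s"
definition "heat3 s x = (1 - (x / sqrt s)^2) * phi (x / sqrt s) / (s * sqrt s)"
definition "heat4 s x = ((x / sqrt s)^3 - 3 * (x / sqrt s)) * phi (x / sqrt s) / s^2"

lemma heat_deriv_x:
  assumes s: "0 < s"
  shows "(heat0 s has_real_derivative heat1 s x) (at x)"
    "(heat1 s has_real_derivative heat2 s x) (at x)"
    "(heat2 s has_real_derivative heat3 s x) (at x)"
proof -
  have ss: "sqrt s * sqrt s = s" "sqrt s \<noteq> 0" using s by auto
  have y: "((\<lambda>x. x / sqrt s) has_real_derivative 1 / sqrt s) (at x)"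
    by (rule DERIV_cdivide[OF DERIV_ident])
  note P = DERIV_chain2[OF phi_deriv y]
  show "(heat0 s has_real_derivative heat1 s x) (at x)"
    unfolding heat0_def[abs_def] heat1_def
    by (rule DERIV_cong[OF DERIV_chain2[OF Qfun_deriv y]]) simp
  show "(heat1 s has_real_derivative heat2 s x) (at x)"
    unfolding heat1_def[abs_def] heat2_def
    by (rule DERIV_cong[OF DERIV_cdivide[OF DERIV_minus[OF P]]]) (use ss in \<open>simp add: field_simps\<close>)
  show "(heat2 s has_real_derivative heat3 s x) (at x)"
    unfolding heat2_def[abs_def] heat3_def
    by (rule DERIV_cong[OF DERIV_cdivide[OF DERIV_mult[OF y P]]]) (use ss s in \<open>simp add: field_simps power2_eq_square\<close>)
qed

lemma heat_deriv_s:
  assumes s: "0 < s"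
  shows "((\<lambda>s. heat0 s x) has_real_derivative heat2 s x / 2) (at s)"
    "((\<lambda>s. heat2 s x) has_real_derivative heat4 s x / 2) (at s)"
proof -
  have ss: "sqrt s * sqrt s = s" "sqrt s \<noteq> 0" using s by auto
  have y: "((\<lambda>s. x / sqrt s) has_real_derivative - (x / sqrt s) / (2 * s)) (at s)"
    by (rule DERIV_cong[OF DERIV_divide[OF DERIV_const DERIV_real_sqrt]])
      (use s ss in \<open>auto simp: field_simps\<close>)
  note P = DERIV_chain2[OF phi_deriv y]
  show "((\<lambda>s. heat0 s x) has_real_derivative heat2 s x / 2) (at s)"
    unfolding heat0_def[abs_def] heat2_def
    by (rule DERIV_cong[OF DERIV_chain2[OF Qfun_deriv y]]) (simp add: mult_ac)
  define u where "u = x / sqrt s"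
  show "((\<lambda>s. heat2 s x) has_real_derivative heat4 s x / 2) (at s)"
    unfolding heat2_def[abs_def] heat4_def
    by (rule DERIV_cong[OF DERIV_divide[OF DERIV_mult[OF y P] DERIV_ident]])
      (use s in \<open>simp_all add: u_def[symmetric] field_simps power2_eq_square power3_eq_cube\<close>)
qed

lemma heat_bounds:
  assumes s: "0 < s"
  shows "\<bar>heat0 s x\<bar> \<le> 1" "\<bar>heat1 s x\<bar> \<le> 1 / sqrt s" "\<bar>heat2 s x\<bar> \<le> 1 / s" "\<bar>heat3 s x\<bar> \<le> 3 / (s * sqrt s)" "\<bar>heat4 s x\<bar> \<le> 7 / s^2"
proof -
  interpret N: prob_space "density lborel phi" by (rule prob_space_normal_density) simp
  define y where "y = x / sqrt s"
  note b = phi_bounds[of y]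
  show "\<bar>heat0 s x\<bar> \<le> 1" by (simp add: heat0_def Qfun_def)
  show "\<bar>heat1 s x\<bar> \<le> 1 / sqrt s" unfolding heat1_def y_def[symmetric]
    using b s by (simp add: abs_mult divide_right_mono)
  show "\<bar>heat2 s x\<bar> \<le> 1 / s" unfolding heat2_def y_def[symmetric]
    using b s by (simp add: abs_mult divide_right_mono)
  have "\<bar>(1 - y^2) * phi y\<bar> \<le> 3" using b mult_nonneg_nonneg[OF zero_le_power2 b(1), of y] unfolding left_diff_distrib abs_le_iff by linarith
  then show "\<bar>heat3 s x\<bar> \<le> 3 / (s * sqrt s)" unfolding heat3_def y_def[symmetric]
    using s by (simp add: abs_mult divide_right_mono)
  have "\<bar>(y^3 - 3 * y) * phi y\<bar> \<le> \<bar>y^3 * phi y\<bar> + 3 * \<bar>y * phi y\<bar>" by (simp add: left_diff_distrib)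
  also have "\<dots> \<le> 7" using b by (simp add: abs_mult power_abs)
  finally show "\<bar>heat4 s x\<bar> \<le> 7 / s^2" unfolding heat4_def y_def[symmetric]
    using s by (simp add: abs_mult divide_right_mono)
qed

text \<open>Time \<open>v\<close> stands for an independent normal increment of variance
  \<open>v\<close>; by the heat equation its effect is v / 2 times the second space derivative,
  which is what the Lindeberg step has to match. The second time derivative is heat4 / 4, so the
  remainder has the factor 7 / 8, rounded up to 1; \<open>s0\<close> makes the bound uniform in
  \<open>s\<close>.\<close>

lemma heat_step:
  assumes s0: "0 < s0" "s0 \<le> s" and v: "0 \<le> v"
  shows "\<bar>heat0 (s + v) x - heat0 s x - v / 2 * heat2 s x\<bar> \<le> v^2 / s0^2"
proof (cases "v = 0")
  case False
  then have v: "0 < v" using v by simp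
  have "\<exists>t. s < t \<and> t < s + v \<and> heat0 (s + v) x =
      (\<Sum>m<2. ([\<lambda>s. heat0 s x, \<lambda>s. heat2 s x / 2, \<lambda>s. heat4 s x / 4] ! m) s / fact m * (s + v - s)^m) +
      ([\<lambda>s. heat0 s x, \<lambda>s. heat2 s x / 2, \<lambda>s. heat4 s x / 4] ! 2) t / fact 2 * (s + v - s)^2"
  proof (rule Taylor_up[where a = s and b = "s + v"])
    show "\<forall>m t. m < 2 \<and> s \<le> t \<and> t \<le> s + v \<longrightarrow>
      (([\<lambda>s. heat0 s x, \<lambda>s. heat2 s x / 2, \<lambda>s. heat4 s x / 4] ! m) has_real_derivative
       ([\<lambda>s. heat0 s x, \<lambda>s. heat2 s x / 2, \<lambda>s. heat4 s x / 4] ! Suc m) t) (at t)"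
    proof (intro allI impI)
      fix m :: nat and t assume mt: "m < 2 \<and> s \<le> t \<and> t \<le> s + v"
      then have "0 < t" using s0 by auto
      from heat_deriv_s(1)[OF this] DERIV_cdivide[OF heat_deriv_s(2)[OF this], of x 2]
      show "(([\<lambda>s. heat0 s x, \<lambda>s. heat2 s x / 2, \<lambda>s. heat4 s x / 4] ! m) has_real_derivative
       ([\<lambda>s. heat0 s x, \<lambda>s. heat2 s x / 2, \<lambda>s. heat4 s x / 4] ! Suc m) t) (at t)"
        using mt by (cases m) (auto simp: less_Suc_eq numeral_2_eq_2)
    qed
  qed (use v in auto)
  then obtain t where t: "s < t" "heat0 (s + v) x = heat0 s x + heat2 s x / 2 * v + heat4 t x / 8 * v^2"
    by (auto simp: numeral_2_eq_2)
  have "\<bar>heat4 t x\<bar> \<le> 7 / t^2" using t s0 by (intro heat_bounds) auto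
  also have "\<dots> \<le> 7 / s0^2" using t s0 by (intro divide_left_mono power_mono) auto
  finally have "\<bar>heat4 t x / 8\<bar> \<le> 1 / s0^2" by (simp add: field_simps)
  then have "\<bar>heat4 t x / 8\<bar> * v^2 \<le> 1 / s0^2 * v^2" by (intro mult_right_mono) auto
  then have "\<bar>heat4 t x / 8 * v^2\<bar> \<le> v^2 / s0^2" by (simp add: abs_mult)
  then show ?thesis unfolding t(2) by (simp add: algebra_simps)
qed (use assms in auto)

section \<open>Interpolation between the partial sums and a Gaussian\<close>

context mixing_seq begin

text \<open>The long-run variance, that is, the spectral density at frequency 0.\<close>

definition "v = R 0 + 2 * (\<Sum>d. R (Suc d))"

lemma window_sum: "(\<Sum>j\<in>{k - p..<k}. R (k - j)) = (\<Sum>d<min k p. R (Suc d))"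
  by (rule sum.reindex_bij_witness[of _ "\<lambda>d. k - Suc d" "\<lambda>j. k - Suc j"]) (auto simp: Suc_diff_Suc)

text \<open>\<open>SOME\<close> freezes the constant of \<open>R_tail\<close> for the whole locale,
  so that it cannot depend on the length n or the window p.\<close>

definition "tail_bound = (SOME c. 0 \<le> c \<and> (\<forall>q. \<bar>(\<Sum>d. R (Suc d)) - (\<Sum>d<q. R (Suc d))\<bar> \<le> c * exp (- \<theta> * real q)))"

lemma tail_bound: "0 \<le> tail_bound" "\<bar>(\<Sum>d. R (Suc d)) - (\<Sum>d<q. R (Suc d))\<bar> \<le> tail_bound * exp (- \<theta> * real q)"
  using someI_ex[OF R_tail[unfolded Bex_def]] unfolding tail_bound_def by blast+

lemma sum_exp_le: "(\<Sum>k<n. exp (- \<theta> * real k)) \<le> 1 / (1 - exp (- \<theta>))"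
proof -
  have "(\<Sum>k<n. exp (- \<theta> * real k)) = (\<Sum>k<n. exp (- \<theta>) ^ k)"
    by (simp add: exp_of_nat_mult[symmetric] mult.commute)
  also have "\<dots> \<le> (\<Sum>k. exp (- \<theta>) ^ k)"
    using \<theta>_pos by (intro sum_le_suminf summable_geometric) auto
  also have "\<dots> = 1 / (1 - exp (- \<theta>))" using \<theta>_pos by (intro suminf_geometric) auto
  finally show ?thesis .
qed

text \<open>Each new variable adds R 0 and twice its covariances with the earlier ones; in this form
  the variance is a sum of terms converging to \<open>v\<close>.\<close>

lemma S_second_moment: "integrable M (\<lambda>x. (S n x)^2)" "(\<integral>x. (S n x)^2 \<partial>M) = (\<Sum>k<n. R 0 + 2 * (\<Sum>d<k. R (Suc d)))"
proof -
  have SX: "integrable M (\<lambda>x. S n x * X k x)" "(\<integral>x. S n x * X k x \<partial>M) = (\<Sum>j<n. R (k - j))" if "n \<le> k" for n k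
  proof -
    have e: "S n x * X k x = (\<Sum>j<n. X j x * X k x)" for x by (simp add: S_def sum_distrib_right)
    show "integrable M (\<lambda>x. S n x * X k x)" unfolding e by (intro Bochner_Integration.integrable_sum XX_int)
    have "(\<integral>x. S n x * X k x \<partial>M) = (\<Sum>j<n. (\<integral>x. X j x * X k x \<partial>M))"
      unfolding e by (intro Bochner_Integration.integral_sum XX_int)
    also have "\<dots> = (\<Sum>j<n. R (k - j))"
    proof (rule sum.cong)
      fix j assume "j \<in> {..<n}"
      then show "(\<integral>x. X j x * X k x \<partial>M) = R (k - j)" using cov_eq[of j "k - j"] that by simp
    qed simp
    finally show "(\<integral>x. S n x * X k x \<partial>M) = (\<Sum>j<n. R (k - j))" .
  qed
  have "integrable M (\<lambda>x. (S n x)^2) \<and> (\<integral>x. (S n x)^2 \<partial>M) = (\<Sum>k<n. R 0 + 2 * (\<Sum>d<k. R (Suc d)))"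
  proof (induction n)
    case 0 show ?case by (simp add: S_def)
  next
    case (Suc n)
    have e: "(S (Suc n) x)^2 = (S n x)^2 + (X n x * X n x + 2 * (S n x * X n x))" for x
      by (simp add: S_Suc power2_eq_square algebra_simps)
    have "(\<Sum>j<n. R (n - j)) = (\<Sum>d<n. R (Suc d))" using window_sum[of n n] by (simp add: lessThan_atLeast0)
    moreover have "(\<integral>x. X n x * X n x \<partial>M) = R 0" using cov_eq[of n 0] by simp
    ultimately show ?case unfolding e using Suc SX[of n n] XX_int[of n n] by simp
  qed
  then show "integrable M (\<lambda>x. (S n x)^2)" "(\<integral>x. (S n x)^2 \<partial>M) = (\<Sum>k<n. R 0 + 2 * (\<Sum>d<k. R (Suc d)))" by auto
qed

text \<open>The k-th summand of the variance differs from \<open>v\<close> by a geometric term, so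
  the variance stays within a constant of n v.\<close>

lemma variance_limit: "(\<lambda>n. (\<integral>x. (S n x)^2 \<partial>M) / real n) \<longlonglongrightarrow> v"
proof -
  define c where "c = 2 * tail_bound * (1 / (1 - exp (- \<theta>)))"
  have b: "\<bar>(\<integral>x. (S n x)^2 \<partial>M) - n * v\<bar> \<le> c" for n
  proof -
    have "(\<integral>x. (S n x)^2 \<partial>M) - n * v = (\<Sum>k<n. R 0 + 2 * (\<Sum>d<k. R (Suc d)) - v)"
      by (simp add: S_second_moment sum_subtractf)
    also have "\<bar>\<dots>\<bar> \<le> (\<Sum>k<n. \<bar>R 0 + 2 * (\<Sum>d<k. R (Suc d)) - v\<bar>)" by (rule sum_abs)
    also have "\<dots> \<le> (\<Sum>k<n. 2 * tail_bound * exp (- \<theta> * real k))"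
    proof (rule sum_mono)
      fix k show "\<bar>R 0 + 2 * (\<Sum>d<k. R (Suc d)) - v\<bar> \<le> 2 * tail_bound * exp (- \<theta> * real k)"
        using tail_bound(2)[of k] unfolding v_def by linarith
    qed
    also have "\<dots> \<le> c" unfolding c_def sum_distrib_left[symmetric] using sum_exp_le tail_bound(1) by (intro mult_left_mono) auto
    finally show ?thesis .
  qed
  have "(\<lambda>n. (\<integral>x. (S n x)^2 \<partial>M) / real n - v) \<longlonglongrightarrow> 0"
  proof (rule tendsto_rabs_zero_cancel, rule tendsto_sandwich[of "\<lambda>_. 0" _ _ "\<lambda>n. c / real n"])
    show "\<forall>\<^sub>F n in sequentially. \<bar>(\<integral>x. (S n x)^2 \<partial>M) / real n - v\<bar> \<le> c / real n"
    proof (rule eventually_mono[OF eventually_gt_at_top[of 0]])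
      fix n :: nat assume "0 < n"
      then have "(\<integral>x. (S n x)^2 \<partial>M) / real n - v = ((\<integral>x. (S n x)^2 \<partial>M) - n * v) / real n"
        by (simp add: diff_divide_distrib)
      then show "\<bar>(\<integral>x. (S n x)^2 \<partial>M) / real n - v\<bar> \<le> c / real n" using b[of n] by (simp add: abs_divide divide_right_mono)
    qed
    show "(\<lambda>n. c / real n) \<longlonglongrightarrow> 0" by (rule lim_const_over_n)
  qed auto
  then show ?thesis by (rule LIM_zero_cancel)
qed

lemma v_nonneg: "0 \<le> v"
  by (rule LIMSEQ_le_const[OF variance_limit]) (auto intro!: divide_nonneg_nonneg integral_nonneg_AE)

lemma smooth_clt_explicit:
  fixes n p :: nat
  assumes n: "1 \<le> n" and p: "exp (- \<theta> * real p) \<le> 1 / real n"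
  shows "\<bar>(\<integral>x. heat0 (n / 2) (y + S n x) \<partial>M) - heat0 (n / 2 + n * v) y\<bar>
    \<le> (4 * cov_bound + 27 * moment_bound^2 + 2 * tail_bound * (1 / (1 - exp (- \<theta>)) + 1) + 4 * v^2) * (real p + 1)^2 / sqrt n"
proof -
  define e where "e = exp (- \<theta> * real p)"
  \<comment> \<open>After k true variables have entered, Gaussian time for the other n - k remains.
    Thus \<open>a 0\<close> is purely Gaussian and \<open>a n\<close> carries the whole sum. The
    time never drops below n / 2, the share of the noise, and this keeps all derivatives
    small.\<close>
  define s where "s k = n / 2 + (real n - real k) * v" for k
  define a where "a k = (\<integral>x. heat0 (s k) (y + S k x) \<partial>M)" for k
  define q where "q k = exp (- \<theta> * real (min k p))" for k
  define N where "N = real n"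
  have N1: "1 \<le> N" "0 < N" using n by (auto simp: N_def)
  have sn: "sqrt N \<le> N" "1 \<le> sqrt N" "0 < sqrt N" using N1 by (auto simp: sqrt_le_D real_sqrt_le_iff intro: real_le_lsqrt simp: power2_eq_square)
  define err where "err = 2 / sqrt N * cov_bound * e + (real p + 1) * (3 * moment_bound^2 * (9 / (N * sqrt N)) * (real p + 1) + 2 / N * cov_bound * e)"
  have step: "\<bar>a (Suc k) - a k\<bar> \<le> err + 2 * tail_bound / N * q k + 4 * v^2 / N^2" if k: "k < n" for k
  proof -
    define t where "t = s (Suc k)"
    have sk: "s k = t + v" by (simp add: t_def s_def algebra_simps)
    have tn: "N / 2 \<le> t" unfolding t_def s_def N_def using k v_nonneg by (simp add: mult_nonneg_nonneg)
    then have t0: "0 < t" using N1 by simp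
    have hx: "((\<lambda>x. h (y + x)) has_real_derivative h' (y + x)) (at x)"
      if "\<And>x. (h has_real_derivative h' x) (at x)" for h h' :: "real \<Rightarrow> real" and x
    proof -
      have "((\<lambda>x. y + x) has_real_derivative 1) (at x)" by (auto intro!: derivative_eq_intros)
      from DERIV_chain2[OF that this] show ?thesis by simp
    qed
    \<comment> \<open>The derivative bounds are evaluated at the least possible time N / 2, with
      sqrt 2 rounded up.\<close>
    have "1 / sqrt t \<le> 1 / sqrt (N / 2)" using tn N1 t0 by (intro divide_left_mono) auto
    also have "\<dots> = sqrt 2 / sqrt N" by (simp add: real_sqrt_divide)
    also have "\<dots> \<le> 2 / sqrt N" using sn by (intro divide_right_mono real_le_lsqrt) auto
    finally have sq: "1 / sqrt t \<le> 2 / sqrt N" .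
    have tt: "1 / t \<le> 2 / N" using tn t0 N1 by (simp add: field_simps)
    have s2: "sqrt 2 \<le> 3 / 2" by (rule real_le_lsqrt) (auto simp: power2_eq_square)
    have "3 / (t * sqrt t) \<le> 3 / (N / 2 * sqrt (N / 2))"
      using tn N1 t0 by (intro divide_left_mono mult_mono) auto
    also have "\<dots> = 6 * sqrt 2 / (N * sqrt N)" by (simp add: real_sqrt_divide)
    also have "\<dots> \<le> 9 / (N * sqrt N)" using s2 N1 by (intro divide_right_mono) auto
    finally have t3: "3 / (t * sqrt t) \<le> 9 / (N * sqrt N)" .
    have b1: "\<bar>heat1 t x\<bar> \<le> 2 / sqrt N" for x using heat_bounds(2)[OF t0, of x] sq by linarith
    have b2: "\<bar>heat2 t x\<bar> \<le> 2 / N" for x using heat_bounds(3)[OF t0, of x] tt by linarith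
    have b3: "\<bar>heat3 t x\<bar> \<le> 9 / (N * sqrt N)" for x using heat_bounds(4)[OF t0, of x] t3 by linarith
    define I2 where "I2 = (\<integral>x. heat2 t (y + S k x) \<partial>M)"
    define c where "c = R 0 / 2 + (\<Sum>d<min k p. R (Suc d))"
    have meas: "heat0 t \<in> borel_measurable borel" "heat2 t \<in> borel_measurable borel" if "0 < t" for t
      using DERIV_isCont[OF heat_deriv_x(1)[OF that]] DERIV_isCont[OF heat_deriv_x(3)[OF that]]
      by (auto intro!: borel_measurable_continuous_onI continuous_at_imp_continuous_on)
    have int0: "integrable M (\<lambda>x. heat0 t (y + S j x))" if "0 < t" for t j
      by (rule integrable_const_bound[of _ 1]) (use heat_bounds[OF that] in \<open>auto intro!: measurable_compose[OF _ meas(1)[OF that]]\<close>)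
    have int2: "integrable M (\<lambda>x. heat2 t (y + S j x))" for j
      by (rule integrable_const_bound[of _ "2 / N"]) (use b2 in \<open>auto intro!: measurable_compose[OF _ meas(2)[OF t0]]\<close>)
    have 1: "\<bar>a (Suc k) - (\<integral>x. heat0 t (y + S k x) \<partial>M) - c * I2\<bar> \<le> err"
      using lindeberg_step[of "\<lambda>x. heat0 t (y + x)" "\<lambda>x. heat1 t (y + x)" "\<lambda>x. heat2 t (y + x)" "\<lambda>x. heat3 t (y + x)"
          1 "2 / sqrt N" "2 / N" "9 / (N * sqrt N)" k p] b1 b2 b3 heat_bounds(1)[OF t0]
        hx[OF heat_deriv_x(1)[OF t0]] hx[OF heat_deriv_x(2)[OF t0]] hx[OF heat_deriv_x(3)[OF t0]]
      unfolding a_def t_def[symmetric] c_def I2_def err_def e_def window_sum by simp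
    have hs: "\<bar>heat0 (t + v) z - heat0 t z - v / 2 * heat2 t z\<bar> \<le> 4 * v^2 / N^2" for z
      using heat_step[OF _ tn v_nonneg, of z] N1 by (simp add: power_divide field_simps)
    have "\<bar>\<integral>x. heat0 (t + v) (y + S k x) - heat0 t (y + S k x) - v / 2 * heat2 t (y + S k x) \<partial>M\<bar> \<le> (\<integral>x. 4 * v^2 / N^2 \<partial>M)"
      by (rule integral_dominated(2)[OF _ _ hs])
        (use int0[of "t + v" k] int0[OF t0, of k] int2[of k] t0 v_nonneg in auto)
    then have 2: "\<bar>a k - (\<integral>x. heat0 t (y + S k x) \<partial>M) - v / 2 * I2\<bar> \<le> 4 * v^2 / N^2"
      using int0[of "t + v" k] int0[OF t0, of k] int2[of k] t0 v_nonneg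
      unfolding I2_def a_def sk by (simp add: prob_space)
    have "\<bar>I2\<bar> \<le> (\<integral>x. 2 / N \<partial>M)" unfolding I2_def
      by (rule integral_dominated(2)[OF _ _ b2]) (use int2[of k] in auto)
    then have "\<bar>I2\<bar> \<le> 2 / N" by (simp add: prob_space)
    \<comment> \<open>The Lindeberg step sees only the first \<open>min k p\<close> covariances,
      whereas the loss of time \<open>v\<close> accounts for all. The missing tail is geometric:
      summed over k it gives a constant for the early steps and n exp (- \<theta> p) <= 1 for the
      cut at p.\<close>
    moreover have vc: "v / 2 - c = (\<Sum>d. R (Suc d)) - (\<Sum>d<min k p. R (Suc d))" by (simp add: v_def c_def field_simps)
    have "\<bar>v / 2 - c\<bar> \<le> tail_bound * q k" unfolding vc q_def by (rule tail_bound(2))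
    moreover note this
    ultimately have "\<bar>v / 2 - c\<bar> * \<bar>I2\<bar> \<le> (tail_bound * q k) * (2 / N)" by (intro mult_mono) auto
    then have 3: "\<bar>v / 2 * I2 - c * I2\<bar> \<le> 2 * tail_bound / N * q k" unfolding abs_mult[symmetric] by (simp add: algebra_simps)
    show ?thesis using 1 2 3 by linarith
  qed
  have "\<bar>a n - a 0\<bar> \<le> (\<Sum>k<n. \<bar>a (Suc k) - a k\<bar>)"
    unfolding sum_lessThan_telescope[symmetric] by (rule sum_abs)
  also have "\<dots> \<le> (\<Sum>k<n. err + 2 * tail_bound / N * q k + 4 * v^2 / N^2)" using step by (intro sum_mono) auto
  also have "\<dots> = N * err + 2 * tail_bound / N * (\<Sum>k<n. q k) + 4 * v^2 / N"
    using N1 by (simp add: sum.distrib sum_distrib_left N_def[symmetric] power2_eq_square)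
  finally have tot: "\<bar>a n - a 0\<bar> \<le> N * err + 2 * tail_bound / N * (\<Sum>k<n. q k) + 4 * v^2 / N" .
  have e: "e \<le> 1 / N" "0 \<le> e" using p by (auto simp: e_def N_def)
  have "(\<Sum>k<n. q k) \<le> (\<Sum>k<n. exp (- \<theta> * real k) + e)"
    by (intro sum_mono) (auto simp: q_def e_def min_def)
  also have "\<dots> \<le> 1 / (1 - exp (- \<theta>)) + N * e" using sum_exp_le[of n] by (simp add: sum.distrib N_def)
  also have "N * e \<le> 1" using e N1 by (simp add: field_simps)
  finally have sq: "(\<Sum>k<n. q k) \<le> 1 / (1 - exp (- \<theta>)) + 1" by simp
  define G where "G = 1 / (1 - exp (- \<theta>)) + 1"
  have G0: "0 \<le> G" using \<theta>_pos by (simp add: G_def)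
  define P where "P = real p + 1"
  have P: "1 \<le> P" "P \<le> P^2" "1 \<le> P^2" by (auto simp: P_def power2_eq_square algebra_simps)
  have Ni: "1 / N \<le> 1 / sqrt N" using sn N1 by (intro divide_left_mono) auto
  have "N * err = 2 / sqrt N * cov_bound * (N * e) + 27 * moment_bound^2 * P^2 / sqrt N + 2 / N * cov_bound * P * (N * e)"
    using N1 unfolding err_def P_def[symmetric] by (simp add: field_simps power2_eq_square)
  also have "\<dots> \<le> 2 / sqrt N * cov_bound * 1 + 27 * moment_bound^2 * P^2 / sqrt N + 2 / N * cov_bound * P * 1"
    using \<open>N * e \<le> 1\<close> cov_bound_nonneg N1 P sn e by (intro add_mono mult_left_mono) auto
  also have "2 / N * cov_bound * P * 1 \<le> 2 / sqrt N * cov_bound * P^2"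
  proof -
    have "1 / N * P \<le> 1 / sqrt N * P^2" using Ni P N1 sn by (intro mult_mono) auto
    then have "2 * cov_bound * (1 / N * P) \<le> 2 * cov_bound * (1 / sqrt N * P^2)" using cov_bound_nonneg by (intro mult_left_mono) auto
    then show ?thesis by (simp add: mult_ac)
  qed
  also have "2 / sqrt N * cov_bound * 1 \<le> 2 / sqrt N * cov_bound * P^2" using P cov_bound_nonneg sn by (intro mult_left_mono) auto
  finally have E1: "N * err \<le> (4 * cov_bound + 27 * moment_bound^2) * P^2 / sqrt N" by (simp add: ring_distribs add_divide_distrib mult_ac)
  have "2 * tail_bound / N * (\<Sum>k<n. q k) \<le> 2 * tail_bound * (1 / N) * G"
    using sq tail_bound(1) N1 unfolding G_def by (simp add: mult_left_mono divide_right_mono)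
  also have "\<dots> \<le> 2 * tail_bound * (1 / sqrt N) * (G * P^2)"
    using Ni tail_bound(1) G0 P N1 sn mult_left_mono[OF P(3) G0] by (intro mult_mono) auto
  finally have E2: "2 * tail_bound / N * (\<Sum>k<n. q k) \<le> (2 * tail_bound * G) * P^2 / sqrt N" by (simp add: field_simps)
  have "4 * v^2 / N = 4 * v^2 * (1 / N)" by simp
  also have "\<dots> \<le> 4 * v^2 * (P^2 / sqrt N)" 
    using Ni P(3) sn by (intro mult_left_mono order_trans[OF Ni] divide_right_mono) auto
  finally have E3: "4 * v^2 / N \<le> (4 * v^2) * P^2 / sqrt N" by (simp add: field_simps)
  have a: "a n = (\<integral>x. heat0 (n / 2) (y + S n x) \<partial>M)" "a 0 = heat0 (n / 2 + n * v) y"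
    by (auto simp: a_def s_def S_def prob_space)
  show ?thesis
    using tot E1 E2 E3 unfolding a G_def[symmetric] P_def[symmetric] N_def[symmetric]
    by (simp add: add_divide_distrib ring_distribs)
qed

theorem smooth_clt:
  "\<exists>C\<ge>0. \<forall>n\<ge>3. \<forall>y. \<bar>(\<integral>x. heat0 (real n / 2) (y + S n x) \<partial>M) - heat0 (real n / 2 + real n * v) y\<bar> \<le> C * (ln (real n))^2 / sqrt (real n)"
proof -
  define C where "C = 4 * cov_bound + 27 * moment_bound^2 + 2 * tail_bound * (1 / (1 - exp (- \<theta>)) + 1) + 4 * v^2"
  have C_nonneg: "0 \<le> C" unfolding C_def using cov_bound_nonneg tail_bound(1) \<theta>_pos by (intro add_nonneg_nonneg mult_nonneg_nonneg) auto
  show ?thesis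
  proof (intro exI[of _ "C * (1 / \<theta> + 2)^2"] conjI allI impI)
    show "0 \<le> C * (1 / \<theta> + 2)^2" using C_nonneg by simp
    fix n :: nat and y :: real assume n: "3 \<le> n"
    define l where "l = ln (real n)"
    \<comment> \<open>As 3 > e, ln n >= 1, so additive constants can be absorbed into ln n.\<close>
    have "ln (exp 1) \<le> l" unfolding l_def using n exp_le by (subst ln_le_cancel_iff) auto
    then have l1: "1 \<le> l" by simp
    \<comment> \<open>The shortest window for which exp (- \<theta> p) <= 1 / n, so that the n
      decoupling errors stay within the target.\<close>
    define p where "p = nat \<lceil>l / \<theta>\<rceil>"
    have p: "l / \<theta> \<le> real p" "real p \<le> l / \<theta> + 1" using l1 \<theta>_pos unfolding p_def by (auto simp: of_nat_nat)
    have "exp (- \<theta> * real p) \<le> exp (- l)" using p \<theta>_pos by (simp add: field_simps)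
    also have "\<dots> = 1 / real n" using n by (simp add: l_def exp_minus field_simps)
    finally have "exp (- \<theta> * real p) \<le> 1 / real n" .
    from smooth_clt_explicit[OF _ this, of y] n
    have "\<bar>(\<integral>x. heat0 (real n / 2) (y + S n x) \<partial>M) - heat0 (real n / 2 + real n * v) y\<bar> \<le> C * (real p + 1)^2 / sqrt n"
      unfolding C_def by simp
    also have "\<dots> \<le> C * ((1 / \<theta> + 2) * l)^2 / sqrt n"
    proof (intro divide_right_mono mult_left_mono power_mono C_nonneg)
      have "real p + 1 \<le> l / \<theta> + 2 * l" using p l1 by linarith
      then show "real p + 1 \<le> (1 / \<theta> + 2) * l" by (simp add: algebra_simps)
    qed auto
    also have "\<dots> = C * (1 / \<theta> + 2)^2 * (ln (real n))^2 / sqrt n" by (simp add: l_def power_mult_distrib)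
    finally show "\<bar>(\<integral>x. heat0 (real n / 2) (y + S n x) \<partial>M) - heat0 (real n / 2 + real n * v) y\<bar> \<le> C * (1 / \<theta> + 2)^2 * (ln (real n))^2 / sqrt (real n)" .
  qed
qed

end

section \<open>Law of the noise radius\<close>

text \<open>Lebesgue measure on R^n as a product measure: its vectors are extensional functions on
  \<open>{..<n}\<close>, whereas the points of \<open>Rn n\<close> vanish from n on. Only the first
  n coordinates are ever compared.\<close>

definition vol :: "nat \<Rightarrow> (nat \<Rightarrow> real) measure" where
  "vol n = (\<Pi>\<^sub>M i\<in>{..<n}. lborel)"

definition "vnorm n z = sqrt (\<Sum>i<n. (z i)^2)" for z :: "nat \<Rightarrow> real"

text \<open>Log-volume of the ball of radius \<open>vnorm n z\<close>. It has no meaning at the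
  origin, hence the detours through \<open>AE_vnorm_pos\<close>.\<close>

definition "lnvol n z = ln (unit_ball_vol n) + n * ln (vnorm n z)"

lemma space_vol: "space (vol n) = extensional {..<n}"
  by (auto simp: vol_def space_PiM PiE_def)

lemma unit_ball_vol_nz[simp]: "unit_ball_vol (real n) \<noteq> 0"
  using unit_ball_vol_pos[of "real n"] by linarith

lemma measurable_vol_component: "i < n \<Longrightarrow> (\<lambda>z. z i) \<in> borel_measurable (vol n)"
  unfolding vol_def by (rule measurable_component_singleton[of _ _ "\<lambda>_. lborel", unfolded measurable_lborel1]) auto

lemma measurable_vnorm[measurable]: "vnorm n \<in> borel_measurable (vol n)"
proof -
  have "(\<lambda>z. \<Sum>i<n. (z i)^2) \<in> borel_measurable (vol n)"
    by (intro borel_measurable_sum borel_measurable_power measurable_vol_component) auto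
  then show ?thesis unfolding vnorm_def[abs_def] by measurable
qed

lemma measurable_lnvol[measurable]: "lnvol n \<in> borel_measurable (vol n)"
  unfolding lnvol_def[abs_def] by measurable

lemma vnorm_nonneg: "0 \<le> vnorm n z" by (simp add: vnorm_def sum_nonneg)

lemma emeasure_vol_ball:
  assumes "0 < r" shows "emeasure (vol n) {z \<in> space (vol n). vnorm n z \<le> r} = ennreal (unit_ball_vol n * r ^ n)"
  using emeasure_cball_aux[of "{..<n}" r] assms unfolding vol_def vnorm_def by (simp add: Int_def conj_commute)

lemma AE_vnorm_pos: assumes "1 \<le> n" shows "AE z in vol n. 0 < vnorm n z"
proof -
  define V where "V = unit_ball_vol (real n)"
  have V: "0 < V" unfolding V_def by simp
  have "emeasure (vol n) {z \<in> space (vol n). vnorm n z \<le> 0} \<le> 0"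
  proof (rule ennreal_le_epsilon)
    fix e :: real assume e: "0 < e"
    define r where "r = min 1 (e / V)"
    have r: "0 < r" "r \<le> 1" "V * r \<le> e" using e V by (auto simp: r_def field_simps min_def)
    have "emeasure (vol n) {z \<in> space (vol n). vnorm n z \<le> 0} \<le> emeasure (vol n) {z \<in> space (vol n). vnorm n z \<le> r}"
      using r by (intro emeasure_mono) auto
    also have "\<dots> = ennreal (V * r ^ n)" using emeasure_vol_ball[OF r(1)] by (simp add: V_def)
    also have "\<dots> \<le> ennreal e"
    proof (rule ennreal_leI)
      have "r ^ n \<le> r ^ 1" using r assms by (intro power_decreasing) auto
      then have "V * r ^ n \<le> V * r" using V by simp
      then show "V * r ^ n \<le> e" using r by simp
    qed
    finally show "emeasure (vol n) {z \<in> space (vol n). vnorm n z \<le> 0} \<le> 0 + ennreal e" by simp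
  qed
  then have z: "emeasure (vol n) {z \<in> space (vol n). vnorm n z \<le> 0} = 0" by simp
  show ?thesis by (rule AE_I[OF _ z]) (auto simp: not_less)
qed

lemma lnvol_le_iff:
  assumes "1 \<le> n" "0 < vnorm n z"
  shows "lnvol n z \<le> u \<longleftrightarrow> unit_ball_vol n * vnorm n z ^ n \<le> exp u"
proof -
  have V: "0 < unit_ball_vol (real n)" by simp
  have "lnvol n z = ln (unit_ball_vol n * vnorm n z ^ n)"
    using assms V by (simp add: lnvol_def ln_mult ln_realpow)
  then show ?thesis using assms V by (metis exp_le_cancel_iff exp_ln mult_pos_pos zero_less_power)
qed

lemma nn_integral_exp_atMost: "(\<integral>\<^sup>+t. ennreal (exp t) * indicator {..u} t \<partial>lborel) = ennreal (exp u)"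
proof -
  have "(\<integral>\<^sup>+t. ennreal (exp t) * indicator {..u} t \<partial>lborel) = (\<integral>\<^sup>+s. ennreal (exp (u + (-1) * s)) * indicator {..u} (u + (-1) * s) \<partial>lborel)"
    by (subst nn_integral_real_affine[where c = "-1" and t = u]) auto
  also have "\<dots> = (\<integral>\<^sup>+s. ennreal (exp u) * (ennreal (s ^ 0 * exp (- s)) * indicator {0..} s) \<partial>lborel)"
    by (intro nn_integral_cong) (auto simp: indicator_def exp_diff exp_minus ennreal_mult[symmetric] field_simps)
  also have "\<dots> = ennreal (exp u) * (\<integral>\<^sup>+s. ennreal (s ^ 0 * exp (- s)) * indicator {0..} s \<partial>lborel)"
    by (rule nn_integral_cmult) auto
  also have "\<dots> = ennreal (exp u)" using nn_intergal_power_times_exp_Ici[of 0] by simp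
  finally show ?thesis .
qed

text \<open>The ball on which \<open>lnvol\<close> is at most u has volume exp u by construction, so
  in this coordinate Lebesgue measure has density exp. Integrals of radial functions thereby become
  one-dimensional, without polar coordinates.\<close>

lemma distr_lnvol:
  assumes n: "1 \<le> n"
  shows "distr (vol n) borel (lnvol n) = density lborel (\<lambda>t. ennreal (exp t))"
proof (rule measure_eqI_generator_eq[where E = "range atMost" and \<Omega> = UNIV and A = "\<lambda>i. {..real i}"])
  have e: "emeasure (distr (vol n) borel (lnvol n)) {..u} = ennreal (exp u)" for u
  proof -
    define r where "r = (exp u / unit_ball_vol n) powr (1 / n)"
    have V: "0 < unit_ball_vol (real n)" by simp
    have q: "0 < exp u / unit_ball_vol n" using V by simp
    have r: "0 < r" unfolding r_def powr_gt_zero using q by linarith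
    have rn: "unit_ball_vol n * r ^ n = exp u"
    proof -
      have "r ^ n = r powr n" using r by (simp add: powr_realpow)
      also have "\<dots> = (exp u / unit_ball_vol n) powr 1" unfolding r_def powr_powr using n by simp
      also have "\<dots> = exp u / unit_ball_vol n" using q by simp
      finally show ?thesis using V by simp
    qed
    have le: "lnvol n z \<le> u \<longleftrightarrow> vnorm n z \<le> r" if z: "0 < vnorm n z" for z
    proof -
      have "lnvol n z \<le> u \<longleftrightarrow> vnorm n z ^ n \<le> r ^ n"
        unfolding lnvol_le_iff[OF n z] rn[symmetric] using V by simp
      also have "\<dots> \<longleftrightarrow> vnorm n z \<le> r" using z r n by (intro power_mono_iff) auto
      finally show ?thesis .
    qed
    have "emeasure (distr (vol n) borel (lnvol n)) {..u} = emeasure (vol n) {z \<in> space (vol n). lnvol n z \<le> u}"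
      by (subst emeasure_distr) (auto intro!: arg_cong[where f = "emeasure _"])
    also have "\<dots> = emeasure (vol n) {z \<in> space (vol n). vnorm n z \<le> r}"
      by (rule emeasure_eq_AE) (use AE_vnorm_pos[OF n] le in auto)
    also have "\<dots> = ennreal (exp u)" using emeasure_vol_ball[OF r] rn by simp
    finally show ?thesis .
  qed
  fix X assume "X \<in> range (atMost :: real \<Rightarrow> real set)"
  then obtain u where "X = {..u}" by auto
  then show "emeasure (distr (vol n) borel (lnvol n)) X = emeasure (density lborel (\<lambda>t. ennreal (exp t))) X"
    using e[of u] nn_integral_exp_atMost[of u] by (simp add: emeasure_density)
next
  fix i show "emeasure (distr (vol n) borel (lnvol n)) {..real i} \<noteq> \<infinity>"
  proof -
    have "emeasure (distr (vol n) borel (lnvol n)) {..real i} = emeasure (vol n) {z \<in> space (vol n). lnvol n z \<le> real i}"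
      by (subst emeasure_distr) (auto intro!: arg_cong[where f = "emeasure _"])
    also have "\<dots> \<le> emeasure (vol n) {z \<in> space (vol n). vnorm n z \<le> exp ((real i - ln (unit_ball_vol n)) / n)}"
    proof (rule emeasure_mono_AE)
      show "AE x in vol n. x \<in> {z \<in> space (vol n). lnvol n z \<le> real i} \<longrightarrow> x \<in> {z \<in> space (vol n). vnorm n z \<le> exp ((real i - ln (unit_ball_vol n)) / n)}"
        using AE_vnorm_pos[OF n]
      proof eventually_elim
        case (elim x)
        have "ln (vnorm n x) \<le> (real i - ln (unit_ball_vol n)) / n" if "lnvol n x \<le> real i"
          using that n unfolding lnvol_def by (simp add: field_simps)
        then show ?case using elim by (metis (no_types, lifting) exp_le_cancel_iff exp_ln mem_Collect_eq)
      qed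
    qed measurable
    also have "\<dots> < \<infinity>" by (subst emeasure_vol_ball) auto
    finally show ?thesis by simp
  qed
next
  show "(\<Union>i. {..real i}) = UNIV" using real_arch_simple by auto
  show "Int_stable (range (atMost :: real \<Rightarrow> real set))" by (auto simp: Int_stable_def Int_atMost)
  show "sets (distr (vol n) borel (lnvol n)) = sigma_sets UNIV (range atMost)"
    by (simp add: borel_eq_atMost)
  show "sets (density lborel (\<lambda>t. ennreal (exp t))) = sigma_sets UNIV (range atMost)"
    by (simp add: borel_eq_atMost)
qed auto

lemma nn_integral_lnvol:
  assumes "1 \<le> n" "g \<in> borel_measurable borel"
  shows "(\<integral>\<^sup>+z. g (lnvol n z) \<partial>vol n) = (\<integral>\<^sup>+u. ennreal (exp u) * g u \<partial>lborel)"
proof -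
  have "(\<integral>\<^sup>+z. g (lnvol n z) \<partial>vol n) = (\<integral>\<^sup>+u. g u \<partial>distr (vol n) borel (lnvol n))"
    using assms by (intro nn_integral_distr[symmetric]) auto
  then show ?thesis unfolding distr_lnvol[OF assms(1)] using assms by (simp add: nn_integral_density)
qed

definition "rho n \<sigma> z = (1 / sqrt (2 * pi * \<sigma>^2)) ^ n * exp (- ((vnorm n z)^2) / (2 * \<sigma>^2))"

lemma rho_prod: "rho n \<sigma> z = (\<Prod>i<n. normal_density 0 \<sigma> (z i))"
proof -
  have "(vnorm n z)^2 = (\<Sum>i<n. (z i)^2)" unfolding vnorm_def by (simp add: sum_nonneg)
  then show ?thesis unfolding rho_def normal_density_def
    by (simp add: prod.distrib exp_sum[symmetric] sum_negf sum_divide_distrib prod_dividef power_one_over)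
qed

lemma rho_meas[measurable]: "rho n \<sigma> \<in> borel_measurable (vol n)"
  unfolding rho_def[abs_def] by measurable

lemma noise_eq_density:
  assumes "\<sigma> > 0"
  shows "noise n \<sigma> = density (vol n) (\<lambda>z. ennreal (rho n \<sigma> z))"
proof -
  interpret N: prob_space "density lborel (normal_density 0 \<sigma>)" using assms by (rule prob_space_normal_density)
  interpret L: product_sigma_finite "\<lambda>_::nat. lborel :: real measure" by standard
  interpret P: product_sigma_finite "\<lambda>_::nat. density lborel (normal_density 0 \<sigma>)" by standard
  have "density (vol n) (\<lambda>z. ennreal (rho n \<sigma> z)) = PiM {..<n} (\<lambda>_. density lborel (normal_density 0 \<sigma>))"
  proof (rule P.PiM_eqI)
    show "sets (density (vol n) (\<lambda>z. ennreal (rho n \<sigma> z))) = sets (Pi\<^sub>M {..<n} (\<lambda>_. density lborel (normal_density 0 \<sigma>)))"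
      unfolding vol_def by (simp cong: sets_PiM_cong)
    fix A :: "nat \<Rightarrow> real set" assume "\<And>i. i \<in> {..<n} \<Longrightarrow> A i \<in> sets (density lborel (normal_density 0 \<sigma>))"
    then have A: "\<And>i. i \<in> {..<n} \<Longrightarrow> A i \<in> sets borel" by simp
    then have AP: "Pi\<^sub>E {..<n} A \<in> sets (vol n)" unfolding vol_def by (intro sets_PiM_I_finite) auto
    have "emeasure (density (vol n) (\<lambda>z. ennreal (rho n \<sigma> z))) (Pi\<^sub>E {..<n} A) = (\<integral>\<^sup>+z. ennreal (rho n \<sigma> z) * indicator (Pi\<^sub>E {..<n} A) z \<partial>vol n)"
      using AP by (intro emeasure_density) auto
    also have "\<dots> = (\<integral>\<^sup>+z. (\<Prod>i<n. ennreal (normal_density 0 \<sigma> (z i)) * indicator (A i) (z i)) \<partial>vol n)"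
    proof (rule nn_integral_cong)
      fix z assume "z \<in> space (vol n)"
      then have "indicator (Pi\<^sub>E {..<n} A) z = (\<Prod>i<n. indicator (A i) (z i) :: ennreal)"
        by (auto simp: indicator_def space_vol PiE_iff)
      then show "ennreal (rho n \<sigma> z) * indicator (Pi\<^sub>E {..<n} A) z = (\<Prod>i<n. ennreal (normal_density 0 \<sigma> (z i)) * indicator (A i) (z i))"
        by (simp add: rho_prod prod.distrib prod_ennreal)
    qed
    also have "\<dots> = (\<Prod>i<n. (\<integral>\<^sup>+x. ennreal (normal_density 0 \<sigma> x) * indicator (A i) x \<partial>lborel))"
      unfolding vol_def using A by (intro L.product_nn_integral_prod) auto
    also have "\<dots> = (\<Prod>i<n. emeasure (density lborel (normal_density 0 \<sigma>)) (A i))"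
      using A by (intro prod.cong) (auto simp: emeasure_density)
    finally show "emeasure (density (vol n) (\<lambda>z. ennreal (rho n \<sigma> z))) (Pi\<^sub>E {..<n} A) = (\<Prod>i<n. emeasure (density lborel (normal_density 0 \<sigma>)) (A i))" .
  qed simp
  then show ?thesis by (simp add: noise_def)
qed

lemma prob_space_noise: "0 < \<sigma> \<Longrightarrow> prob_space (noise n \<sigma>)"
  unfolding noise_def by (intro prob_space_PiM prob_space_normal_density)

lemma sets_noise: "sets (noise n \<sigma>) = sets (vol n)" and space_noise: "space (noise n \<sigma>) = space (vol n)"
  unfolding noise_def vol_def by (auto cong: sets_PiM_cong simp: space_PiM)

text \<open>At log-volume centre + n x, the volume element contributes exp (n x) and the Gaussian
  exp (- (n/2) exp (2 x)); this is the resulting decay exponent per dimension, normalised to 0 at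
  its minimum x = 0, where it behaves like x^2.\<close>

definition "radial_rate x = (exp (2 * x) - 1) / 2 - x" for x :: real

lemma radial_rate_taylor:
  obtains t where "x < 0 \<Longrightarrow> t \<le> 0" "t \<le> 2 * \<bar>x\<bar>" "radial_rate x = x^2 + 2 / 3 * exp t * x^3"
proof (cases "x = 0")
  case True then show ?thesis using that[of 0] by (simp add: radial_rate_def)
next
  case False
  have "\<exists>t. (if 2 * x < 0 then 2 * x < t \<and> t < 0 else 0 < t \<and> t < 2 * x) \<and>
    exp (2 * x) = (\<Sum>m<3. (exp 0 / fact m) * (2 * x - 0)^m) + (exp t / fact 3) * (2 * x - 0)^3"
    using False abs_ge_self[of x] abs_ge_minus_self[of x]
    by (intro Taylor[where a = "- 2 * \<bar>x\<bar>" and b = "2 * \<bar>x\<bar>" and f = exp and diff = "\<lambda>_. exp"]) auto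
  then obtain t where t: "if 2 * x < 0 then 2 * x < t \<and> t < 0 else 0 < t \<and> t < 2 * x"
    "exp (2 * x) = 1 + 2 * x + 2 * x^2 + exp t * 4 / 3 * x^3"
    by (auto simp: numeral_3_eq_3 power2_eq_square fact_numeral)
  show ?thesis
  proof (rule that)
    show "radial_rate x = x^2 + 2 / 3 * exp t * x^3" unfolding radial_rate_def t(2) by (simp add: field_simps)
  qed (use t(1) in \<open>auto split: if_splits\<close>)
qed

lemma radial_rate_pos: assumes "0 \<le> x" shows "x^2 \<le> radial_rate x"
  using radial_rate_taylor[of x] assms by (metis add_increasing2 exp_ge_zero mult_nonneg_nonneg order_refl zero_le_power zero_le_divide_iff zero_le_numeral)

text \<open>For negative x the cubic term has the wrong sign, but on this interval it consumes at
  most two thirds of x^2.\<close>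

lemma radial_rate_neg: assumes "- 1 \<le> x" "x \<le> 0" shows "x^2 / 3 \<le> radial_rate x"
proof (cases "x = 0")
  case True then show ?thesis by (simp add: radial_rate_def)
next
  case False
  obtain t where t: "x < 0 \<Longrightarrow> t \<le> 0" "radial_rate x = x^2 + 2 / 3 * exp t * x^3" using radial_rate_taylor by metis
  have e: "exp t \<le> 1" using t(1) False assms by simp
  have "- (x^3) = x^2 * (- x)" by (simp add: power2_eq_square power3_eq_cube)
  also have "\<dots> \<le> x^2 * 1" using assms by (intro mult_left_mono) auto
  finally have x3: "- (x^3) \<le> x^2" "0 \<le> - (x^3)" using assms by auto
  have "exp t * (- (x^3)) \<le> 1 * x^2" using e x3 by (intro mult_mono) auto
  then have "- (2 / 3 * exp t * x^3) \<le> 2 / 3 * x^2" by simp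
  then show ?thesis unfolding t(2) by simp
qed

text \<open>Far to the left the rate grows only linearly, which is why the envelope below is
  exponential and not Gaussian.\<close>

lemma radial_rate_far: assumes "x \<le> - 1" shows "\<bar>x\<bar> / 2 \<le> radial_rate x"
proof -
  have "0 \<le> exp (2 * x)" "\<bar>x\<bar> = - x" using assms by auto
  moreover have "radial_rate x = exp (2 * x) / 2 - 1 / 2 - x" by (simp add: radial_rate_def field_simps)
  ultimately show ?thesis using assms by linarith
qed

lemma radial_rate_close: assumes "\<bar>x\<bar> \<le> 1" shows "\<bar>radial_rate x - x^2\<bar> \<le> 6 * \<bar>x\<bar>^3"
proof -
  obtain t where t: "t \<le> 2 * \<bar>x\<bar>" "radial_rate x = x^2 + 2 / 3 * exp t * x^3" using radial_rate_taylor by metis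
  have "exp t \<le> exp (1 + 1)" using t assms by simp
  also have "\<dots> = exp 1 * exp 1" by (simp only: exp_add)
  also have "\<dots> \<le> 3 * 3" using exp_le by (intro mult_mono) auto
  finally have "2 / 3 * exp t \<le> 6" by simp
  then have "2 / 3 * exp t * \<bar>x\<bar>^3 \<le> 6 * \<bar>x\<bar>^3" by (intro mult_right_mono) auto
  then show ?thesis unfolding t(2) by (simp add: abs_mult power_abs)
qed

text \<open>Unnormalised density of the log-volume in the standard coordinate w = (lnvol - centre) /
  sqrt (n / 2); then x = sqrt (n / 2) w / n = w / sqrt (2 n).\<close>

definition "radial_profile n w = exp (- (real n * radial_rate (w / sqrt (2 * real n))))" for n :: nat

lemma radial_profile_meas[measurable]: "radial_profile n \<in> borel_measurable borel"
  unfolding radial_profile_def[abs_def] radial_rate_def[abs_def] by measurable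

text \<open>Completing the square puts the quadratic regime of \<open>radial_rate\<close> under the
  same exponential envelope as the linear one.\<close>

lemma exp_quarter_bound: fixes w :: real shows "w^2 / 6 \<le> y \<Longrightarrow> exp (- y) \<le> 2 * exp (- \<bar>w\<bar> / 4)"
proof -
  assume y: "w^2 / 6 \<le> y"
  have "0 \<le> (\<bar>w\<bar> - 3 / 4)^2" by simp
  moreover have "(\<bar>w\<bar> - 3 / 4)^2 = w^2 - 3 / 2 * \<bar>w\<bar> + 9 / 16" by (simp add: power2_eq_square algebra_simps)
  ultimately have "\<bar>w\<bar> / 4 - 3 / 32 \<le> w^2 / 6" by linarith
  then have "exp (- y) \<le> exp (3 / 32 + - \<bar>w\<bar> / 4)" using y by simp
  also have "\<dots> = exp (3 / 32) * exp (- \<bar>w\<bar> / 4)" by (simp only: exp_add)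
  also have "exp (3 / 32) \<le> (2::real)" using exp_bound[of "3 / 32"] by (simp add: power2_eq_square)
  finally show ?thesis by simp
qed

lemma radial_profile_le: assumes n: "1 \<le> n" shows "radial_profile n w \<le> 2 * exp (- \<bar>w\<bar> / 4)"
proof -
  define r where "r = sqrt (2 * real n)"
  have r: "1 \<le> r" "real n = r^2 / 2" using n by (auto simp: r_def)
  consider "0 \<le> w / r" | "- 1 \<le> w / r" "w / r \<le> 0" | "w / r \<le> - 1" by linarith
  then show ?thesis
  proof cases
    case 1
    have "r^2 / 2 * (w / r)^2 \<le> n * radial_rate (w / r)" unfolding r(2) using radial_rate_pos[OF 1] by (intro mult_left_mono) auto
    moreover have "r^2 / 2 * (w / r)^2 = w^2 / 2" using r(1) by (simp add: power_divide)
    ultimately have "w^2 / 6 \<le> n * radial_rate (w / r)" using zero_le_power2[of w] by linarith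
    then show ?thesis unfolding radial_profile_def r_def[symmetric] by (rule exp_quarter_bound)
  next
    case 2
    have "r^2 / 2 * ((w / r)^2 / 3) \<le> n * radial_rate (w / r)" unfolding r(2) using radial_rate_neg[OF 2] by (intro mult_left_mono) auto
    moreover have "r^2 / 2 * ((w / r)^2 / 3) = w^2 / 6" using r(1) by (simp add: power_divide)
    ultimately have "w^2 / 6 \<le> n * radial_rate (w / r)" by linarith
    then show ?thesis unfolding radial_profile_def r_def[symmetric] by (rule exp_quarter_bound)
  next
    case 3
    have "r^2 / 2 * (\<bar>w / r\<bar> / 2) \<le> n * radial_rate (w / r)" unfolding r(2) using radial_rate_far[OF 3] by (intro mult_left_mono) auto
    moreover have "r^2 / 2 * (\<bar>w / r\<bar> / 2) = r * \<bar>w\<bar> / 4" using r(1) by (simp add: abs_divide power2_eq_square)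
    ultimately have "r * \<bar>w\<bar> / 4 \<le> n * radial_rate (w / r)" by linarith
    moreover have "1 * \<bar>w\<bar> \<le> r * \<bar>w\<bar>" using r by (intro mult_right_mono) auto
    ultimately have "exp (- (n * radial_rate (w / r))) \<le> exp (- \<bar>w\<bar> / 4)" by simp
    then show ?thesis unfolding radial_profile_def r_def[symmetric] using exp_ge_zero[of "- \<bar>w\<bar> / 4"] by linarith
  qed
qed

lemma exp_diff_le:
  fixes a b c :: real assumes "exp (- a) \<le> c" "exp (- b) \<le> c" shows "\<bar>exp (- a) - exp (- b)\<bar> \<le> c * \<bar>a - b\<bar>"
proof -
  have *: "exp (- a) - exp (- b) \<le> c * \<bar>a - b\<bar>" if "exp (- a) \<le> c" for a b
  proof -
    have "exp (- a) - exp (- b) = exp (- a) * (1 - exp (a - b))" by (simp add: algebra_simps mult_exp_exp)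
    also have "\<dots> \<le> exp (- a) * \<bar>a - b\<bar>" using exp_ge_add_one_self[of "a - b"] by (intro mult_left_mono) (linarith, simp)
    also have "\<dots> \<le> c * \<bar>a - b\<bar>" using that by (intro mult_right_mono) auto
    finally show ?thesis .
  qed
  show ?thesis using *[of a b] *[of b a] assms by (auto simp: abs_le_iff abs_minus_commute)
qed

text \<open>Within |w| <= sqrt (2 n) the cubic error of \<open>radial_rate\<close>, multiplied by n,
  is of order |w|^3 / sqrt n. Beyond that range both functions lie under the envelope, and |w|^3 /
  sqrt (2 n) >= 1 makes the bound trivial.\<close>

lemma radial_profile_close: assumes n: "1 \<le> n" shows "\<bar>radial_profile n w - exp (- (w^2 / 2))\<bar> \<le> 6 * (\<bar>w\<bar>^3 * exp (- \<bar>w\<bar> / 4)) / sqrt n"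
proof -
  define r where "r = sqrt (2 * real n)"
  have r: "1 \<le> r" "real n = r^2 / 2" "sqrt n \<le> r" "0 < sqrt n" using n by (auto simp: r_def)
  have e: "exp (- (w^2 / 2)) \<le> 2 * exp (- \<bar>w\<bar> / 4)" by (rule exp_quarter_bound) simp
  have "\<bar>radial_profile n w - exp (- (w^2 / 2))\<bar> \<le> 6 * (\<bar>w\<bar>^3 * exp (- \<bar>w\<bar> / 4)) / r"
  proof (cases "\<bar>w / r\<bar> \<le> 1")
    case True
    have "\<bar>n * radial_rate (w / r) - w^2 / 2\<bar> = n * \<bar>radial_rate (w / r) - (w / r)^2\<bar>"
    proof -
      have "real n * (w / r)^2 = w^2 / 2" using r(1) unfolding r(2) by (simp add: power_divide)
      then have "n * radial_rate (w / r) - w^2 / 2 = n * (radial_rate (w / r) - (w / r)^2)" by (simp add: right_diff_distrib)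
      then show ?thesis by (simp add: abs_mult)
    qed
    also have "\<dots> \<le> n * (6 * \<bar>w / r\<bar>^3)" using radial_rate_close[OF True] by (intro mult_left_mono) auto
    also have "\<dots> = 3 * \<bar>w\<bar>^3 / r" using r(1) unfolding r(2) by (simp add: abs_divide power_divide power2_eq_square power3_eq_cube)
    finally have 1: "\<bar>n * radial_rate (w / r) - w^2 / 2\<bar> \<le> 3 * \<bar>w\<bar>^3 / r" .
    have "\<bar>radial_profile n w - exp (- (w^2 / 2))\<bar> \<le> 2 * exp (- \<bar>w\<bar> / 4) * \<bar>n * radial_rate (w / r) - w^2 / 2\<bar>"
      unfolding radial_profile_def r_def[symmetric] by (rule exp_diff_le) (use radial_profile_le[OF n, of w] e in \<open>auto simp: radial_profile_def r_def\<close>)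
    also have "\<dots> \<le> 2 * exp (- \<bar>w\<bar> / 4) * (3 * \<bar>w\<bar>^3 / r)" using 1 by (intro mult_left_mono) auto
    finally show ?thesis by (simp add: mult_ac)
  next
    case False
    then have w: "r \<le> \<bar>w\<bar>" using r by (simp add: abs_divide field_simps)
    have "1 \<le> \<bar>w\<bar>^2" using w r by (intro one_le_power) linarith
    then have "r * 1 \<le> \<bar>w\<bar> * \<bar>w\<bar>^2" using w r by (intro mult_mono) linarith+
    then have w3: "1 \<le> \<bar>w\<bar>^3 / r" using r by (simp add: power3_eq_cube power2_eq_square)
    have "0 \<le> radial_profile n w" by (simp add: radial_profile_def)
    then have "\<bar>radial_profile n w - exp (- (w^2 / 2))\<bar> \<le> 2 * exp (- \<bar>w\<bar> / 4) * 1"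
      using radial_profile_le[OF n, of w] e by (auto simp: abs_le_iff) (smt (verit) exp_ge_zero)+
    also have "\<dots> \<le> 2 * exp (- \<bar>w\<bar> / 4) * (\<bar>w\<bar>^3 / r)" using w3 by (intro mult_left_mono) auto
    also have "\<dots> \<le> 6 * (\<bar>w\<bar>^3 * exp (- \<bar>w\<bar> / 4)) / r" using r by (simp add: field_simps)
    finally show ?thesis .
  qed
  also have "\<dots> \<le> 6 * (\<bar>w\<bar>^3 * exp (- \<bar>w\<bar> / 4)) / sqrt n" using r by (intro divide_left_mono) auto
  finally show ?thesis .
qed

lemma integrable_abs_power_exp: "integrable lborel (\<lambda>w::real. \<bar>w\<bar>^k * exp (- \<bar>w\<bar> / 4))"
proof -
  define f where "f x = x^k * exp (- x) * indicator {0<..} x" for x :: real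
  have f: "integrable lborel f" unfolding f_def using has_bochner_integral_I0i_power_exp_m[of k] by (rule integrable.intros)
  have "integrable lborel (\<lambda>w. 4^k * f (0 + (1/4) * w) + 4^k * f (0 + (- 1/4) * w))"
    by (intro Bochner_Integration.integrable_add integrable_mult_right lborel_integrable_real_affine f) auto
  then show ?thesis
  proof (rule integrable_cong_AE_imp)
    show "AE w in lborel. 4^k * f (0 + (1/4) * w) + 4^k * f (0 + (- 1/4) * w) = \<bar>w\<bar>^k * exp (- \<bar>w\<bar> / 4)"
      using AE_lborel_singleton[of "0::real"]
    proof eventually_elim
      case (elim w)
      then show ?case by (cases "0 < w") (auto simp: f_def indicator_def power_divide power_minus' abs_if)
    qed
  qed measurable
qed

lemma radial_profile_integrable: assumes "1 \<le> n" shows "integrable lborel (radial_profile n)"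
proof (rule integral_dominated(1))
  show "integrable lborel (\<lambda>w::real. 2 * (\<bar>w\<bar>^0 * exp (- \<bar>w\<bar> / 4)))" by (intro integrable_mult_right integrable_abs_power_exp)
  show "\<bar>radial_profile n x\<bar> \<le> 2 * (\<bar>x\<bar>^0 * exp (- \<bar>x\<bar> / 4))" for x using radial_profile_le[OF assms, of x] by (simp add: radial_profile_def)
qed auto

lemma gauss_eq: "exp (- (w^2 / 2)) = sqrt (2 * pi) * phi w"
  by (simp add: std_normal_density_def)

definition "radial_error = 6 * (\<integral>w. \<bar>w::real\<bar>^3 * exp (- \<bar>w\<bar> / 4) \<partial>lborel)"

lemma radial_error_nonneg: "0 \<le> radial_error" unfolding radial_error_def by (intro mult_nonneg_nonneg integral_nonneg_AE) auto

lemma radial_profile_L1: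
  assumes n: "1 \<le> n" and A: "A \<in> sets borel"
  shows "\<bar>(\<integral>w. indicator A w * radial_profile n w \<partial>lborel) - sqrt (2 * pi) * (\<integral>w. indicator A w * phi w \<partial>lborel)\<bar> \<le> radial_error / sqrt n"
proof -
  have i: "integrable lborel (\<lambda>w. indicator A w * radial_profile n w)" "integrable lborel (\<lambda>w. indicator A w * phi w)"
    using integrable_mult_indicator[of A lborel "radial_profile n"] integrable_mult_indicator[of A lborel phi] A radial_profile_integrable[OF n] by auto
  have b: "\<bar>indicator A w * radial_profile n w - sqrt (2 * pi) * (indicator A w * phi w)\<bar> \<le> 6 * (\<bar>w\<bar>^3 * exp (- \<bar>w\<bar> / 4)) / sqrt n" for w
    using radial_profile_close[OF n, of w] unfolding gauss_eq by (auto simp: indicator_def)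
  have "\<bar>\<integral>w. indicator A w * radial_profile n w - sqrt (2 * pi) * (indicator A w * phi w) \<partial>lborel\<bar> \<le> (\<integral>w. 6 * (\<bar>w\<bar>^3 * exp (- \<bar>w\<bar> / 4)) / sqrt n \<partial>lborel)"
    by (rule integral_dominated(2)[OF _ _ b]) (use A integrable_abs_power_exp in auto)
  then show ?thesis using i unfolding radial_error_def by simp
qed

definition "radial_mass n = (\<integral>w. radial_profile n w \<partial>lborel)"

lemma radial_mass_close: assumes "1 \<le> n" shows "\<bar>radial_mass n - sqrt (2 * pi)\<bar> \<le> radial_error / sqrt n"
  using radial_profile_L1[OF assms, of UNIV] by (simp add: radial_mass_def)

text \<open>Log-volume of the ball whose radius \<sigma> sqrt n is the typical length of the noise;
  it is the mode of the log-volume of the noise.\<close>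

definition "lnvol_center n \<sigma> = ln (unit_ball_vol (real n)) + n * ln (\<sigma> * sqrt n)"

text \<open>The noise density is a function of the log-volume alone, so
  \<open>nn_integral_lnvol\<close> and an affine change of variable suffice. \<open>\<kappa>\<close>
  collects the scale sqrt (n / 2), the Gaussian normalisation and the peak value; it is never
  computed directly.\<close>

lemma noise_lnvol:
  assumes n: "1 \<le> n" and \<sigma>: "0 < \<sigma>" and A: "A \<in> sets borel"
  defines "\<kappa> \<equiv> sqrt (n / 2) * (1 / sqrt (2 * pi * \<sigma>^2))^n * exp (lnvol_center n \<sigma>) * exp (- real n / 2)"
  shows "emeasure (noise n \<sigma>) {z \<in> space (noise n \<sigma>). lnvol n z \<in> A} =
    ennreal (\<kappa> * (\<integral>w. indicator A (lnvol_center n \<sigma> + sqrt (n / 2) * w) * radial_profile n w \<partial>lborel))"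
proof -
  define a where "a = lnvol_center n \<sigma>"
  define c where "c = sqrt (real n / 2)"
  have c0: "0 < c" using n by (simp add: c_def)
  define k where "k = (1 / sqrt (2 * pi * \<sigma>^2))^n"
  have k0: "0 \<le> k" unfolding k_def by (intro zero_le_power) auto
  define rr where "rr u = k * exp (- (real n / 2) * exp (2 * (u - a) / n))" for u
  have [measurable]: "rr \<in> borel_measurable borel" unfolding rr_def[abs_def] by measurable
  have rho: "rho n \<sigma> z = rr (lnvol n z)" if z: "0 < vnorm n z" for z
  proof -
    have "2 * (lnvol n z - a) / n = 2 * ln (vnorm n z) - 2 * ln (\<sigma> * sqrt n)"
      unfolding lnvol_def a_def lnvol_center_def using n by (simp add: field_simps)
    also have "exp \<dots> = (vnorm n z)^2 / (\<sigma> * sqrt n)^2"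
      using z \<sigma> n by (simp add: exp_diff exp_double)
    finally show ?thesis unfolding rr_def rho_def k_def[symmetric] using n \<sigma> by (simp add: power_mult_distrib)
  qed
  have S: "{z \<in> space (vol n). lnvol n z \<in> A} \<in> sets (vol n)"
    using measurable_sets[OF measurable_lnvol A, of n] by (simp add: vimage_def Int_def conj_commute)
  have "emeasure (noise n \<sigma>) {z \<in> space (noise n \<sigma>). lnvol n z \<in> A} =
    (\<integral>\<^sup>+z. ennreal (rho n \<sigma> z) * indicator {z \<in> space (vol n). lnvol n z \<in> A} z \<partial>vol n)"
    unfolding space_noise unfolding noise_eq_density[OF \<sigma>] using S by (intro emeasure_density) auto
  also have "\<dots> = (\<integral>\<^sup>+z. ennreal (rr (lnvol n z)) * indicator A (lnvol n z) \<partial>vol n)"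
    by (rule nn_integral_cong_AE, use AE_vnorm_pos[OF n] AE_space in eventually_elim) (auto simp: rho indicator_def)
  also have "\<dots> = (\<integral>\<^sup>+u. ennreal (exp u) * (ennreal (rr u) * indicator A u) \<partial>lborel)"
    using A by (intro nn_integral_lnvol[OF n, of "\<lambda>u. ennreal (rr u) * indicator A u"]) auto
  also have "\<dots> = ennreal \<bar>c\<bar> * (\<integral>\<^sup>+w. ennreal (exp (a + c * w)) * (ennreal (rr (a + c * w)) * indicator A (a + c * w)) \<partial>lborel)"
    using A c0 by (intro nn_integral_real_affine) auto
  also have "\<dots> = (\<integral>\<^sup>+w. ennreal \<bar>c\<bar> * (ennreal (exp (a + c * w)) * (ennreal (rr (a + c * w)) * indicator A (a + c * w))) \<partial>lborel)"
    using A by (intro nn_integral_cmult[symmetric]) auto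
  also have "\<dots> = (\<integral>\<^sup>+w. ennreal (\<kappa> * (indicator A (a + c * w) * radial_profile n w)) \<partial>lborel)"
  proof (rule nn_integral_cong)
    fix w :: real
    define x where "x = w / sqrt (2 * real n)"
    have s2: "sqrt (real n) * sqrt (real n) = n" "sqrt 2 * sqrt 2 = (2::real)" by auto
    have cw: "c * w = real n * x" unfolding c_def x_def using n
      by (simp add: real_sqrt_mult real_sqrt_divide field_simps s2)
    have "c * (exp (a + c * w) * rr (a + c * w)) = c * k * (exp (a + c * w) * exp (- (real n / 2) * exp (2 * x)))"
      unfolding rr_def cw using n by simp
    also have "exp (a + c * w) * exp (- (real n / 2) * exp (2 * x)) = exp a * exp (- real n / 2) * radial_profile n w"
      unfolding radial_profile_def x_def[symmetric] exp_add[symmetric] cw radial_rate_def mult_exp_exp by (simp add: field_simps)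
    finally have e: "c * (exp (a + c * w) * rr (a + c * w)) = \<kappa> * radial_profile n w" unfolding \<kappa>_def c_def k_def a_def by (simp add: mult_ac)
    have "0 \<le> rr (a + c * w)" using k0 by (simp add: rr_def)
    then have "ennreal \<bar>c\<bar> * (ennreal (exp (a + c * w)) * ennreal (rr (a + c * w))) = ennreal (\<kappa> * radial_profile n w)"
      unfolding e[symmetric] using c0 by (simp add: ennreal_mult)
    then show "ennreal \<bar>c\<bar> * (ennreal (exp (a + c * w)) * (ennreal (rr (a + c * w)) * indicator A (a + c * w))) = ennreal (\<kappa> * (indicator A (a + c * w) * radial_profile n w))"
      by (auto simp: indicator_def)
  qed
  also have "\<dots> = ennreal (\<integral>w. \<kappa> * (indicator A (a + c * w) * radial_profile n w) \<partial>lborel)"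
  proof (rule nn_integral_eq_integral)
    have "integrable lborel (\<lambda>w. indicator {w. a + c * w \<in> A} w *\<^sub>R radial_profile n w)"
    proof (rule integrable_mult_indicator[OF _ radial_profile_integrable[OF n]])
      have "(\<lambda>w. a + c * w) -` A \<inter> space borel \<in> sets borel" by (rule measurable_sets[OF _ A]) measurable
      then show "{w. a + c * w \<in> A} \<in> sets lborel" by (simp add: vimage_def)
    qed
    then show "integrable lborel (\<lambda>w. \<kappa> * (indicator A (a + c * w) * radial_profile n w))"
      by (intro integrable_mult_right) (simp add: indicator_def)
    show "AE w in lborel. 0 \<le> \<kappa> * (indicator A (a + c * w) * radial_profile n w)"
      unfolding \<kappa>_def k_def[symmetric] using k0 by (auto simp: radial_profile_def)
  qed
  finally show ?thesis unfolding a_def c_def by simp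
qed

text \<open>The total mass of the noise is one. The identity normalises the profile and, read
  backwards, also determines the asymptotics of the ball volume.\<close>

lemma kappa_inverse:
  assumes n: "1 \<le> n" and \<sigma>: "0 < \<sigma>"
  shows "(sqrt (n / 2) * (1 / sqrt (2 * pi * \<sigma>^2))^n * exp (lnvol_center n \<sigma>) * exp (- real n / 2)) * radial_mass n = 1" (is "?k * _ = _")
proof -
  interpret prob_space "noise n \<sigma>" using \<sigma> by (rule prob_space_noise)
  have "ennreal (?k * radial_mass n) = 1"
    using noise_lnvol[OF n \<sigma>, of UNIV] emeasure_space_1 unfolding radial_mass_def by simp
  then show ?thesis by (metis ennreal_eq_1)
qed

text \<open>The tail of the profile and its total mass are each off by \<open>radial_error\<close> /
  sqrt n; the ratio of tail to mass is at most 1, and division by sqrt (2 pi) >= 2 merges the two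
  errors into one.\<close>

lemma noise_tail:
  assumes n: "1 \<le> n" and \<sigma>: "0 < \<sigma>"
  shows "\<bar>measure (noise n \<sigma>) {z \<in> space (noise n \<sigma>). t < lnvol n z} - heat0 (n / 2) (t - lnvol_center n \<sigma>)\<bar> \<le> radial_error / sqrt n"
proof -
  define \<kappa> where "\<kappa> = (sqrt (n / 2) * (1 / sqrt (2 * pi * \<sigma>^2))^n * exp (lnvol_center n \<sigma>) * exp (- real n / 2))"
  have k1: "\<kappa> * radial_mass n = 1" unfolding \<kappa>_def by (rule kappa_inverse[OF n \<sigma>])
  have I0: "0 \<le> radial_mass n" unfolding radial_mass_def by (intro integral_nonneg_AE) (auto simp: radial_profile_def)
  moreover have "radial_mass n \<noteq> 0" using k1 by auto
  ultimately have I: "0 < radial_mass n" "\<kappa> = 1 / radial_mass n" using k1 by (auto simp: field_simps order_less_le)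
  define x where "x = (t - lnvol_center n \<sigma>) / sqrt (n / 2)"
  define U where "U = (\<integral>w. indicator {x<..} w * radial_profile n w \<partial>lborel)"
  have U0: "0 \<le> U" unfolding U_def by (intro integral_nonneg_AE) (auto simp: radial_profile_def)
  have "U \<le> radial_mass n" unfolding U_def radial_mass_def
    using integrable_mult_indicator[of "{x<..}" lborel "radial_profile n"] radial_profile_integrable[OF n]
    by (intro integral_mono) (auto simp: indicator_def radial_profile_def)
  have ind: "indicator {t<..} (lnvol_center n \<sigma> + sqrt (n / 2) * w) = (indicator {x<..} w :: real)" for w
    using n unfolding x_def by (auto simp: indicator_def field_simps)
  have "measure (noise n \<sigma>) {z \<in> space (noise n \<sigma>). t < lnvol n z} = \<kappa> * U"
    using noise_lnvol[OF n \<sigma>, of "{t<..}"] I U0 unfolding \<kappa>_def[symmetric] ind U_def[symmetric] by (simp add: measure_def)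
  moreover have "heat0 (n / 2) (t - lnvol_center n \<sigma>) = (\<integral>w. indicator {x<..} w * phi w \<partial>lborel)"
    unfolding heat0_def x_def[symmetric] Qfun_def by (simp add: measure_density_normal)
  moreover define W where "W = (\<integral>w. indicator {x<..} w * phi w \<partial>lborel)"
  moreover define p where "p = sqrt (2 * pi)"
  moreover have "\<bar>U - p * W\<bar> \<le> radial_error / sqrt n" unfolding U_def p_def W_def by (rule radial_profile_L1[OF n]) simp
  moreover have "\<bar>radial_mass n - p\<bar> \<le> radial_error / sqrt n" unfolding p_def by (rule radial_mass_close[OF n])
  moreover have "2 \<le> p" unfolding p_def using pi_gt3 by (intro real_le_rsqrt) auto
  moreover have "\<bar>\<kappa> * U - W\<bar> \<le> (\<bar>U - p * W\<bar> + \<bar>radial_mass n - p\<bar>) / p"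
  proof -
    have "p * (\<kappa> * U - W) = (U - p * W) + (p - radial_mass n) * (U / radial_mass n)"
      using I by (simp add: field_simps)
    also have "\<bar>\<dots>\<bar> \<le> \<bar>U - p * W\<bar> + \<bar>p - radial_mass n\<bar> * \<bar>U / radial_mass n\<bar>" unfolding abs_mult[symmetric] by (rule abs_triangle_ineq)
    also have "\<dots> \<le> \<bar>U - p * W\<bar> + \<bar>p - radial_mass n\<bar> * 1" using I U0 \<open>U \<le> radial_mass n\<close> by (intro add_left_mono mult_left_mono) auto
    finally have "p * \<bar>\<kappa> * U - W\<bar> \<le> \<bar>U - p * W\<bar> + \<bar>radial_mass n - p\<bar>" using \<open>2 \<le> p\<close>
      by (simp add: abs_mult abs_minus_commute)
    then show ?thesis using \<open>2 \<le> p\<close> by (subst pos_le_divide_eq) (auto simp only: mult.commute)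
  qed
  ultimately have "\<bar>\<kappa> * U - W\<bar> \<le> (radial_error / sqrt n + radial_error / sqrt n) / p" 
    by (smt (verit) divide_right_mono)
  also have "\<dots> \<le> (radial_error / sqrt n + radial_error / sqrt n) / 2" using \<open>2 \<le> p\<close> radial_error_nonneg by (intro divide_left_mono) auto
  finally show ?thesis
    using \<open>measure _ _ = \<kappa> * U\<close> \<open>heat0 _ _ = _\<close> unfolding W_def by simp
qed

text \<open>Takes the place of Stirling's formula: \<open>kappa_inverse\<close> is solved for
  \<open>lnvol_center\<close>, which leaves - ln (sqrt (n / 2)) and the logarithm of
  \<open>radial_mass\<close>. The latter lies in [0, 3], as the mass is within 1 of sqrt (2 pi) once
  n >= radial_error^2.\<close>

lemma lnvol_center_asymp:
  assumes \<sigma>: "0 < \<sigma>"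
  shows "\<exists>N. \<forall>n\<ge>N. \<bar>lnvol_center n \<sigma> - n / 2 * ln (2 * pi * exp 1 * \<sigma>^2)\<bar> \<le> ln n + 3"
proof (intro exI allI impI)
  fix n :: nat assume "nat \<lceil>radial_error^2\<rceil> + 2 \<le> n"
  then have n: "2 \<le> n" "radial_error^2 \<le> n" by linarith+
  have "radial_error \<le> sqrt n" using n by (intro real_le_rsqrt)
  then have "radial_error / sqrt n \<le> 1" using n by simp
  then have "\<bar>radial_mass n - sqrt (2 * pi)\<bar> \<le> 1" using radial_mass_close[of n] n by linarith
  moreover have "2 \<le> sqrt (2 * pi)" using pi_gt3 by (intro real_le_rsqrt) auto
  moreover have "sqrt (2 * pi) \<le> 3" using pi_less_4 by (intro real_le_lsqrt) auto
  ultimately have I: "1 \<le> radial_mass n" "radial_mass n \<le> 4" by linarith+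
  have lI: "0 \<le> ln (radial_mass n)" "ln (radial_mass n) \<le> 3" using I ln_le_minus_one[of "radial_mass n"] by auto
  define k where "k = 1 / sqrt (2 * pi * \<sigma>^2)"
  have k: "0 < k" using \<sigma> unfolding k_def by (intro divide_pos_pos) auto
  have "lnvol_center n \<sigma> = - ln (radial_mass n) - ln (sqrt (n / 2)) - n * ln k + n / 2"
  proof -
    have "ln (sqrt (n / 2) * k^n * exp (lnvol_center n \<sigma>) * exp (- real n / 2) * radial_mass n) = 0"
      using kappa_inverse[OF _ \<sigma>, of n] n unfolding k_def[symmetric] by simp
    moreover have "ln (sqrt (n / 2) * k^n * exp (lnvol_center n \<sigma>) * exp (- real n / 2) * radial_mass n) = ln (sqrt (n / 2)) + n * ln k + lnvol_center n \<sigma> - n / 2 + ln (radial_mass n)"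
      using n k I by (simp add: ln_mult ln_realpow)
    ultimately show ?thesis by linarith
  qed
  moreover have "ln k = - ln (2 * pi * \<sigma>^2) / 2" using \<sigma> unfolding k_def by (simp add: ln_div ln_sqrt)
  moreover have "ln (2 * pi * exp 1 * \<sigma>^2) = ln (2 * pi * \<sigma>^2) + 1" using \<sigma> by (simp add: ln_mult)
  ultimately have e: "lnvol_center n \<sigma> - n / 2 * ln (2 * pi * exp 1 * \<sigma>^2) = - ln (radial_mass n) - ln (sqrt (n / 2))"
    by (simp add: field_simps)
  have "0 \<le> ln (sqrt (n / 2))" "ln (sqrt (n / 2)) \<le> ln n"
  proof -
    have "0 \<le> ln (real n / 2)" "ln (real n / 2) \<le> ln (real n)" "0 \<le> ln (real n)" using n by auto
    moreover have e: "ln (sqrt (n / 2)) = ln (real n / 2) / 2" using n by (intro ln_sqrt) auto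
    ultimately show "0 \<le> ln (sqrt (n / 2))" "ln (sqrt (n / 2)) \<le> ln n" unfolding e by linarith+
  qed
  then show "\<bar>lnvol_center n \<sigma> - n / 2 * ln (2 * pi * exp 1 * \<sigma>^2)\<bar> \<le> ln n + 3" unfolding e using lI by linarith
qed

section \<open>Sphere packing and the converse\<close>

text \<open>Translation followed by restriction, so that the result stays extensional.\<close>

definition "vshift n y z = (\<lambda>i\<in>{..<n}. y i + z i)" for y z :: "nat \<Rightarrow> real"

lemma shift_measurable[measurable]: "vshift n y \<in> measurable (vol n) (vol n)"
  unfolding vshift_def[abs_def] by (subst (2) vol_def, intro measurable_restrict) (auto intro!: borel_measurable_add measurable_vol_component)

lemma distr_shift: "distr (vol n) (vol n) (vshift n y) = vol n"
proof -
  interpret L: product_sigma_finite "\<lambda>_::nat. lborel :: real measure" by standard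
  have "distr (vol n) (vol n) (vshift n y) = PiM {..<n} (\<lambda>_. lborel)"
  proof (rule L.PiM_eqI)
    show "sets (distr (vol n) (vol n) (vshift n y)) = sets (Pi\<^sub>M {..<n} (\<lambda>_. lborel))" by (simp add: vol_def)
    fix A :: "nat \<Rightarrow> real set" assume "\<And>i. i \<in> {..<n} \<Longrightarrow> A i \<in> sets lborel"
    then have A: "\<And>i. i \<in> {..<n} \<Longrightarrow> A i \<in> sets borel" by simp
    have AP: "Pi\<^sub>E {..<n} A \<in> sets (vol n)" unfolding vol_def using A by (intro sets_PiM_I_finite) auto
    have e: "vshift n y -` Pi\<^sub>E {..<n} A \<inter> space (vol n) = Pi\<^sub>E {..<n} (\<lambda>i. (+) (y i) -` A i)"
      unfolding space_vol by (rule set_eqI) (simp add: vshift_def PiE_iff)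
    have m: "(+) (y i) -` A i \<in> sets borel" if "i \<in> {..<n}" for i
      using measurable_sets[of "(+) (y i)" borel borel "A i"] A[OF that] by simp
    have "emeasure (distr (vol n) (vol n) (vshift n y)) (Pi\<^sub>E {..<n} A) = emeasure (vol n) (Pi\<^sub>E {..<n} (\<lambda>i. (+) (y i) -` A i))"
      unfolding e[symmetric] using AP by (intro emeasure_distr) auto
    also have "\<dots> = (\<Prod>i<n. emeasure lborel ((+) (y i) -` A i))"
      unfolding vol_def using m by (intro L.emeasure_PiM) auto
    also have "\<dots> = (\<Prod>i<n. emeasure lborel (A i))"
    proof (rule prod.cong)
      fix i assume "i \<in> {..<n}"
      then have "emeasure (distr lborel borel ((+) (y i))) (A i) = emeasure lborel ((+) (y i) -` A i)"
        using A by (subst emeasure_distr) auto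
      then show "emeasure lborel ((+) (y i) -` A i) = emeasure lborel (A i)" by (simp add: lborel_distr_plus)
    qed simp
    finally show "emeasure (distr (vol n) (vol n) (vshift n y)) (Pi\<^sub>E {..<n} A) = (\<Prod>i\<in>{..<n}. emeasure lborel (A i))" .
  qed simp
  then show ?thesis by (simp add: vol_def)
qed

lemma emeasure_shift: "E \<in> sets (vol n) \<Longrightarrow> emeasure (vol n) (vshift n y -` E \<inter> space (vol n)) = emeasure (vol n) E"
  using emeasure_distr[of "vshift n y" "vol n" "vol n" E] by (simp add: distr_shift)

text \<open>Fubini in coordinate \<open>j\<close>: once the other coordinates are fixed, at most the
  single value \<open>d\<close> lies on the hyperplane.\<close>

lemma hyperplane_null:
  assumes j: "j < n" "c j \<noteq> (0::real)"
  shows "emeasure (vol n) {x \<in> space (vol n). (\<Sum>i<n. c i * x i) = b} = 0"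
proof -
  interpret L: product_sigma_finite "\<lambda>_::nat. lborel :: real measure" by standard
  define E where "E = {x \<in> space (vol n). (\<Sum>i<n. c i * x i) = b}"
  have E: "E \<in> sets (vol n)" unfolding E_def
    by (intro measurable_equality_set borel_measurable_sum borel_measurable_times measurable_vol_component) auto
  have ins: "insert j ({..<n} - {j}) = {..<n}" using j by auto
  have Em: "indicator E \<in> borel_measurable (PiM (insert j ({..<n} - {j})) (\<lambda>_. lborel))"
    unfolding ins vol_def[symmetric] using E by simp
  have "emeasure (vol n) E = (\<integral>\<^sup>+x. indicator E x \<partial>PiM (insert j ({..<n} - {j})) (\<lambda>_. lborel))"
    using E unfolding ins vol_def[symmetric] by simp
  also have "\<dots> = (\<integral>\<^sup>+x. (\<integral>\<^sup>+y. indicator E (x(j := y)) \<partial>lborel) \<partial>PiM ({..<n} - {j}) (\<lambda>_. lborel))"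
    by (intro L.product_nn_integral_insert Em) auto
  also have "\<dots> = (\<integral>\<^sup>+x. 0 \<partial>PiM ({..<n} - {j}) (\<lambda>_. lborel :: real measure))"
  proof (rule nn_integral_cong)
    fix x :: "nat \<Rightarrow> real"
    define d where "d = (b - (\<Sum>i\<in>{..<n} - {j}. c i * x i)) / c j"
    have "indicator E (x(j := y)) \<le> (indicator {d} y :: ennreal)" for y
    proof (cases "x(j := y) \<in> E")
      case True
      then have "(\<Sum>i<n. c i * (x(j := y)) i) = b" unfolding E_def by blast
      moreover have "(\<Sum>i<n. c i * (x(j := y)) i) = c j * (x(j := y)) j + (\<Sum>i\<in>{..<n} - {j}. c i * (x(j := y)) i)"
        using j by (intro sum.remove) auto
      moreover have "(\<Sum>i\<in>{..<n} - {j}. c i * (x(j := y)) i) = (\<Sum>i\<in>{..<n} - {j}. c i * x i)"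
        by (intro sum.cong) auto
      ultimately have "c j * y + (\<Sum>i\<in>{..<n} - {j}. c i * x i) = b" by simp
      then have "y = d" using j unfolding d_def by (simp add: field_simps)
      then show ?thesis by (simp add: indicator_def)
    qed simp
    then have "(\<integral>\<^sup>+y. indicator E (x(j := y)) \<partial>lborel) \<le> (\<integral>\<^sup>+y. indicator {d} y \<partial>lborel)" by (intro nn_integral_mono)
    then show "(\<integral>\<^sup>+y. indicator E (x(j := y)) \<partial>lborel) = 0" by simp
  qed
  finally show ?thesis by (simp add: E_def)
qed

lemma sqdist_meas: "(\<lambda>r. sqdist n r y) \<in> borel_measurable (vol n)"
  unfolding sqdist_def by (intro borel_measurable_sum borel_measurable_power borel_measurable_diff measurable_vol_component) auto

lemma sqdist_shift: "sqdist n (vshift n y z) y' = sqdist n (\<lambda>i. y i + z i) y'"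
  by (simp add: sqdist_def vshift_def)

text \<open>The quadratic terms cancel and leave a hyperplane. Voronoi cells, which include their
  ties, are therefore disjoint up to null sets.\<close>

lemma bisector_null:
  assumes "y \<in> Rn n" "y' \<in> Rn n" "y \<noteq> y'"
  shows "emeasure (vol n) {x \<in> space (vol n). sqdist n x y = sqdist n x y'} = 0"
proof -
  obtain j where j: "y j \<noteq> y' j" using assms(3) by auto
  then have jn: "j < n" using assms unfolding Rn_def mem_Collect_eq by (metis not_le)
  have "{x \<in> space (vol n). sqdist n x y = sqdist n x y'} =
    {x \<in> space (vol n). (\<Sum>i<n. (2 * (y' i - y i)) * x i) = (\<Sum>i<n. (y' i)^2 - (y i)^2)}"
  proof (rule Collect_cong)
    fix x
    have "sqdist n x y - sqdist n x y' = (\<Sum>i<n. (2 * (y' i - y i)) * x i - ((y' i)^2 - (y i)^2))"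
      unfolding sqdist_def sum_subtractf[symmetric] by (intro sum.cong) (auto simp: power2_eq_square algebra_simps)
    also have "\<dots> = (\<Sum>i<n. (2 * (y' i - y i)) * x i) - (\<Sum>i<n. (y' i)^2 - (y i)^2)" by (rule sum_subtractf)
    finally show "(x \<in> space (vol n) \<and> sqdist n x y = sqdist n x y') \<longleftrightarrow>
      (x \<in> space (vol n) \<and> (\<Sum>i<n. (2 * (y' i - y i)) * x i) = (\<Sum>i<n. (y' i)^2 - (y i)^2))" by auto
  qed
  then show ?thesis using hyperplane_null[OF jn, of "\<lambda>i. 2 * (y' i - y i)"] j by simp
qed

lemma emeasure_box:
  assumes "\<And>i. i < n \<Longrightarrow> 0 \<le> b i"
  shows "emeasure (vol n) (Pi\<^sub>E {..<n} (\<lambda>i. {- b i..b i})) = ennreal (\<Prod>i<n. 2 * b i)"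
proof -
  interpret L: product_sigma_finite "\<lambda>_::nat. lborel :: real measure" by standard
  have "emeasure (vol n) (Pi\<^sub>E {..<n} (\<lambda>i. {- b i..b i})) = (\<Prod>i<n. emeasure lborel {- b i..b i})"
    unfolding vol_def by (rule L.emeasure_PiM) auto
  also have "\<dots> = (\<Prod>i<n. ennreal (2 * b i))" using assms by (intro prod.cong) auto
  also have "\<dots> = ennreal (\<Prod>i<n. 2 * b i)" using assms by (intro prod_ennreal) auto
  finally show ?thesis .
qed

lemma emeasure_lnvol_le: assumes "1 \<le> n" shows "emeasure (vol n) {z \<in> space (vol n). lnvol n z \<le> t} = ennreal (exp t)"
proof -
  have "emeasure (vol n) {z \<in> space (vol n). lnvol n z \<le> t} = emeasure (distr (vol n) borel (lnvol n)) {..t}"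
    by (subst emeasure_distr) (auto intro!: arg_cong[where f = "emeasure _"])
  then show ?thesis unfolding distr_lnvol[OF assms] using nn_integral_exp_atMost[of t] by (simp add: emeasure_density)
qed

text \<open>The noise density is radially decreasing, so its superlevel sets are balls, and a Lagrange
  multiplier \<open>l\<close> trades probability against volume.\<close>

lemma sphere_packing_multiplier:
  assumes n: "1 \<le> n" and \<sigma>: "0 < \<sigma>"
  shows "\<exists>l\<ge>0. \<forall>E\<in>sets (vol n).
    emeasure (noise n \<sigma>) E + ennreal (l * exp t) \<le> emeasure (noise n \<sigma>) {z \<in> space (vol n). lnvol n z \<le> t} + ennreal l * emeasure (vol n) E"
proof -
  \<comment> \<open>\<open>r\<close> is the radius of the ball of log-volume \<open>t\<close>, and
    \<open>l\<close> the noise density on its surface.\<close>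
  define r where "r = exp ((t - ln (unit_ball_vol (real n))) / n)"
  define l where "l = (1 / sqrt (2 * pi * \<sigma>^2)) ^ n * exp (- (r^2) / (2 * \<sigma>^2))"
  have l0: "0 \<le> l" unfolding l_def by (intro mult_nonneg_nonneg zero_le_power) auto
  define B where "B = {z \<in> space (vol n). lnvol n z \<le> t}"
  have B: "B \<in> sets (vol n)" unfolding B_def by measurable
  have iff: "lnvol n z \<le> t \<longleftrightarrow> vnorm n z \<le> r" if "0 < vnorm n z" for z
  proof -
    have "lnvol n z \<le> t \<longleftrightarrow> ln (vnorm n z) \<le> (t - ln (unit_ball_vol (real n))) / n"
      using n unfolding lnvol_def by (simp add: field_simps)
    also have "\<dots> \<longleftrightarrow> vnorm n z \<le> r" unfolding r_def using that by (metis exp_le_cancel_iff exp_ln)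
    finally show ?thesis .
  qed
  have mono: "rho n \<sigma> z \<le> l" if "r \<le> vnorm n z" for z
    unfolding rho_def l_def using that power_mono[OF that, of 2] \<sigma> by (intro mult_left_mono zero_le_power) (auto simp: r_def divide_right_mono)
  have mono': "l \<le> rho n \<sigma> z" if "vnorm n z \<le> r" for z
    unfolding rho_def l_def using power_mono[OF that vnorm_nonneg, of 2] \<sigma> by (intro mult_left_mono zero_le_power) (auto simp: r_def divide_right_mono)
  show ?thesis
  proof (intro exI[of _ l] conjI ballI l0)
    fix E assume E: "E \<in> sets (vol n)"
    have en: "emeasure (noise n \<sigma>) A = (\<integral>\<^sup>+z. ennreal (rho n \<sigma> z) * indicator A z \<partial>vol n)" if "A \<in> sets (vol n)" for A
      unfolding noise_eq_density[OF \<sigma>] using that by (intro emeasure_density) auto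
    have "emeasure (noise n \<sigma>) E + ennreal (l * exp t) = (\<integral>\<^sup>+z. ennreal (rho n \<sigma> z) * indicator E z + ennreal l * indicator B z \<partial>vol n)"
      using E B l0 emeasure_lnvol_le[OF n, of t]
      by (subst nn_integral_add) (auto simp: en nn_integral_cmult_indicator B_def[symmetric] ennreal_mult)
    \<comment> \<open>The integrated form of (rho - l) (1_E - 1_B) <= 0, rearranged so that no
      subtraction of extended reals occurs.\<close>
    also have "\<dots> \<le> (\<integral>\<^sup>+z. ennreal (rho n \<sigma> z) * indicator B z + ennreal l * indicator E z \<partial>vol n)"
    proof (rule nn_integral_mono_AE)
      show "AE z in vol n. ennreal (rho n \<sigma> z) * indicator E z + ennreal l * indicator B z \<le> ennreal (rho n \<sigma> z) * indicator B z + ennreal l * indicator E z"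
        using AE_vnorm_pos[OF n] AE_space
      proof eventually_elim
        case (elim z)
        show ?case
        proof (cases "z \<in> B")
          case True
          then have "l \<le> rho n \<sigma> z" using iff[OF elim(1)] by (intro mono') (auto simp: B_def)
          then show ?thesis using True by (auto simp: indicator_def ennreal_leI)
        next
          case False
          then have "rho n \<sigma> z \<le> l" using iff[OF elim(1)] elim(2) by (intro mono) (auto simp: B_def)
          then show ?thesis using False by (auto simp: indicator_def ennreal_leI)
        qed
      qed
    qed
    also have "\<dots> = emeasure (noise n \<sigma>) B + ennreal l * emeasure (vol n) E"
      using E B by (subst nn_integral_add) (auto simp: en nn_integral_cmult_indicator)
    finally show "emeasure (noise n \<sigma>) E + ennreal (l * exp t) \<le> emeasure (noise n \<sigma>) {z \<in> space (vol n). lnvol n z \<le> t} + ennreal l * emeasure (vol n) E"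
      unfolding B_def .
  qed
qed

text \<open>Cells at the rim may be unbounded, so each is cut off at distance \<open>d\<close>, at
  the price of the probability of longer noise. The cut cells of \<open>C\<close> then lie in one
  box and are almost disjoint; moved to the origin they become \<open>E y\<close>. Summing the
  multiplier inequality over them bounds the total success probability, because their volumes sum to
  at most that of the box.\<close>

lemma finite_packing_bound:
  assumes n: "1 \<le> n" and \<sigma>: "0 < \<sigma>" and T: "countable T" "T \<subseteq> Rn n"
    and C: "finite C" "C \<subseteq> T" and d: "0 \<le> d"
    and b: "\<And>i. i < n \<Longrightarrow> 0 \<le> b i" "\<And>y i. y \<in> C \<Longrightarrow> i < n \<Longrightarrow> \<bar>y i\<bar> \<le> b i"
    and l: "0 \<le> l" "\<And>E. E \<in> sets (vol n) \<Longrightarrow>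
      emeasure (noise n \<sigma>) E + ennreal (l * exp t) \<le> emeasure (noise n \<sigma>) {z \<in> space (vol n). lnvol n z \<le> t} + ennreal l * emeasure (vol n) E"
  shows "real (card C) * (measure (noise n \<sigma>) {z \<in> space (noise n \<sigma>). t < lnvol n z} - measure (noise n \<sigma>) {z \<in> space (noise n \<sigma>). d < vnorm n z} + l * exp t)
    - l * (\<Prod>i<n. 2 * (b i + d)) \<le> (\<Sum>y\<in>C. err_cond n \<sigma> T y)"
proof -
  interpret N: prob_space "noise n \<sigma>" using \<sigma> by (rule prob_space_noise)
  define W where "W y = {x \<in> space (vol n). x \<in> voronoi n T y}" for y
  have W: "W y \<in> sets (vol n)" for y
  proof -
    have "W y = space (vol n) - (\<Union>y'\<in>T. {x \<in> space (vol n). sqdist n x y' < sqdist n x y})"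
      by (auto simp: W_def voronoi_def not_less)
    moreover have "{x \<in> space (vol n). sqdist n x y' < sqdist n x y} \<in> sets (vol n)" for y'
      by (intro borel_measurable_less sqdist_meas)
    ultimately show ?thesis using T by (auto intro!: sets.countable_UN')
  qed
  define F where "F y = {x \<in> W y. sqdist n x y \<le> d^2}" for y
  have F: "F y \<in> sets (vol n)" for y
  proof -
    have "F y = W y \<inter> {x \<in> space (vol n). sqdist n x y \<le> d^2}" by (auto simp: F_def W_def)
    moreover have "{x \<in> space (vol n). sqdist n x y \<le> d^2} \<in> sets (vol n)"
      by (intro borel_measurable_le sqdist_meas) auto
    ultimately show ?thesis using W by auto
  qed
  define E where "E y = vshift n y -` F y \<inter> space (vol n)" for y
  have E: "E y \<in> sets (vol n)" for y unfolding E_def using F by (intro measurable_sets[OF shift_measurable])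
  have vE: "emeasure (vol n) (E y) = emeasure (vol n) (F y)" for y unfolding E_def using F by (rule emeasure_shift)
  define box where "box = Pi\<^sub>E {..<n} (\<lambda>i. {- (b i + d)..b i + d})"
  have Fbox: "F y \<subseteq> box" if y: "y \<in> C" for y
  proof
    fix x assume x: "x \<in> F y"
    have "\<bar>x i\<bar> \<le> b i + d" if i: "i < n" for i
    proof -
      have "(x i - y i)^2 \<le> sqdist n x y" unfolding sqdist_def using i by (intro member_le_sum) auto
      also have "\<dots> \<le> d^2" using x by (simp add: F_def)
      finally have "\<bar>x i - y i\<bar> \<le> d" using d abs_le_square_iff[of "x i - y i" d] by simp
      then show ?thesis using b(2)[OF y i] by linarith
    qed
    then show "x \<in> box" using x by (auto simp: box_def F_def W_def space_vol PiE_iff abs_le_iff) (smt (verit))+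
  qed
  \<comment> \<open>A point in two cells is equidistant from their centres, hence on one of finitely
    many null bisectors.\<close>
  have AEd: "AE x in vol n. \<forall>y\<in>C. \<forall>y'\<in>C. y \<noteq> y' \<longrightarrow> \<not> (x \<in> F y \<and> x \<in> F y')"
  proof (intro AE_finite_allI C)
    fix y y' assume y: "y \<in> C" "y' \<in> C"
    show "AE x in vol n. y \<noteq> y' \<longrightarrow> \<not> (x \<in> F y \<and> x \<in> F y')"
    proof (cases "y = y'")
      case False
      have "emeasure (vol n) {x \<in> space (vol n). sqdist n x y = sqdist n x y'} = 0"
        using y C T False by (intro bisector_null) auto
      moreover have "{x \<in> space (vol n). sqdist n x y = sqdist n x y'} \<in> sets (vol n)"
        by (intro measurable_equality_set sqdist_meas)
      moreover have "{x \<in> space (vol n). \<not> (y \<noteq> y' \<longrightarrow> \<not> (x \<in> F y \<and> x \<in> F y'))} \<subseteq> {x \<in> space (vol n). sqdist n x y = sqdist n x y'}"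
        using y C by (auto simp: F_def W_def voronoi_def intro: antisym)
      ultimately show ?thesis by (intro AE_I) auto
    qed simp
  qed
  have "(\<Sum>y\<in>C. emeasure (vol n) (F y)) = (\<Sum>y\<in>C. (\<integral>\<^sup>+x. indicator (F y) x \<partial>vol n))" using F by simp
  also have "\<dots> = (\<integral>\<^sup>+x. (\<Sum>y\<in>C. indicator (F y) x) \<partial>vol n)" using F by (intro nn_integral_sum[symmetric]) auto
  also have "\<dots> \<le> (\<integral>\<^sup>+x. indicator box x \<partial>vol n)"
  proof (rule nn_integral_mono_AE)
    show "AE x in vol n. (\<Sum>y\<in>C. indicator (F y) x) \<le> (indicator box x :: ennreal)"
      using AEd
    proof eventually_elim
      case (elim x)
      show ?case
      proof (cases "\<exists>y\<in>C. x \<in> F y")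
        case True
        then obtain y where y: "y \<in> C" "x \<in> F y" by auto
        have "(\<Sum>y'\<in>C. indicator (F y') x) = (\<Sum>y'\<in>C. if y' = y then 1 else 0 :: ennreal)"
          using elim y by (intro sum.cong) (auto simp: indicator_def)
        then show ?thesis using y Fbox C by (auto simp: indicator_def)
      next
        case False
        then have "(\<Sum>y'\<in>C. indicator (F y') x) = (0 :: ennreal)" by (intro sum.neutral) auto
        then show ?thesis by simp
      qed
    qed
  qed
  also have "\<dots> = emeasure (vol n) box"
    unfolding box_def vol_def by (intro nn_integral_indicator sets_PiM_I_finite) auto
  also have "\<dots> = ennreal (\<Prod>i<n. 2 * (b i + d))" unfolding box_def using b d by (intro emeasure_box) auto
  finally have vol_sum: "(\<Sum>y\<in>C. emeasure (vol n) (E y)) \<le> ennreal (\<Prod>i<n. 2 * (b i + d))" unfolding vE .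
  define P where "P = (\<Prod>i<n. 2 * (b i + d))"
  have P0: "0 \<le> P" unfolding P_def using b d by (intro prod_nonneg) auto
  define B where "B = {z \<in> space (vol n). lnvol n z \<le> t}"
  have Bs: "B \<in> sets (noise n \<sigma>)" unfolding B_def sets_noise by measurable
  have "(\<Sum>y\<in>C. emeasure (noise n \<sigma>) (E y) + ennreal (l * exp t)) \<le> (\<Sum>y\<in>C. emeasure (noise n \<sigma>) B + ennreal l * emeasure (vol n) (E y))"
    unfolding B_def using l(2)[OF E] by (intro sum_mono)
  also have "\<dots> = of_nat (card C) * emeasure (noise n \<sigma>) B + ennreal l * (\<Sum>y\<in>C. emeasure (vol n) (E y))"
    by (simp add: sum.distrib sum_distrib_left)
  also have "\<dots> \<le> of_nat (card C) * emeasure (noise n \<sigma>) B + ennreal l * ennreal P"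
    using vol_sum unfolding P_def[symmetric] by (intro add_left_mono mult_left_mono) auto
  finally have "ennreal ((\<Sum>y\<in>C. N.prob (E y) + l * exp t)) \<le> ennreal (real (card C) * N.prob B + l * P)"
    using l(1) P0 by (simp add: N.emeasure_eq_measure sum_nonneg ennreal_plus[symmetric] ennreal_mult[symmetric] ennreal_of_nat_eq_real_of_nat del: ennreal_plus)
  then have main: "(\<Sum>y\<in>C. N.prob (E y)) + card C * (l * exp t) \<le> real (card C) * N.prob B + l * P"
    using l(1) P0 by (subst (asm) ennreal_le_iff) (auto simp: sum.distrib)
  have tail: "N.prob B = 1 - N.prob {z \<in> space (noise n \<sigma>). t < lnvol n z}"
  proof -
    have "{z \<in> space (noise n \<sigma>). t < lnvol n z} = space (noise n \<sigma>) - B" by (auto simp: B_def space_noise)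
    then show ?thesis using N.prob_compl[OF Bs] by simp
  qed
  have err: "1 - N.prob {z \<in> space (noise n \<sigma>). d < vnorm n z} - N.prob (E y) \<le> err_cond n \<sigma> T y" if y: "y \<in> C" for y
  proof -
    let ?A = "{z \<in> space (noise n \<sigma>). (\<lambda>i. y i + z i) \<notin> voronoi n T y}"
    let ?D = "{z \<in> space (noise n \<sigma>). d < vnorm n z}"
    have vor: "(\<lambda>i. y i + z i) \<in> voronoi n T y \<longleftrightarrow> vshift n y z \<in> W y" if "z \<in> space (vol n)" for z
      using measurable_space[OF shift_measurable that, of y] by (simp add: W_def voronoi_def sqdist_shift)
    have A: "?A \<in> sets (noise n \<sigma>)"
    proof -
      have "?A = space (vol n) - (vshift n y -` W y \<inter> space (vol n))" by (auto simp: space_noise vor)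
      then show ?thesis unfolding sets_noise using W measurable_sets[OF shift_measurable W] by auto
    qed
    have D: "?D \<in> sets (noise n \<sigma>)" unfolding sets_noise space_noise by measurable
    have Es: "E y \<in> sets (noise n \<sigma>)" using E by (simp add: sets_noise)
    have sub: "space (noise n \<sigma>) \<subseteq> (?A \<union> ?D) \<union> E y"
    proof
      fix z assume z: "z \<in> space (noise n \<sigma>)"
      have sq: "sqdist n (vshift n y z) y = (vnorm n z)^2"
        unfolding sqdist_shift unfolding sqdist_def vnorm_def by (simp add: sum_nonneg)
      show "z \<in> (?A \<union> ?D) \<union> E y"
      proof (cases "(\<lambda>i. y i + z i) \<in> voronoi n T y \<and> vnorm n z \<le> d")
        case True
        then have "(vnorm n z)^2 \<le> d^2" by (intro power_mono vnorm_nonneg) auto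
        then show ?thesis using True z vor[of z] by (auto simp: E_def F_def sq space_noise)
      qed (use z in auto)
    qed
    have "1 = N.prob (space (noise n \<sigma>))" by (simp add: N.prob_space)
    also have "\<dots> \<le> N.prob ((?A \<union> ?D) \<union> E y)" using sub A D Es by (intro N.finite_measure_mono) auto
    also have "\<dots> \<le> N.prob (?A \<union> ?D) + N.prob (E y)" using A D Es by (intro measure_Un_le) auto
    also have "N.prob (?A \<union> ?D) \<le> N.prob ?A + N.prob ?D" using A D by (intro measure_Un_le) auto
    finally show ?thesis by (simp add: err_cond_def)
  qed
  have "(\<Sum>y\<in>C. 1 - N.prob {z \<in> space (noise n \<sigma>). d < vnorm n z} - N.prob (E y)) \<le> (\<Sum>y\<in>C. err_cond n \<sigma> T y)"
    using err by (intro sum_mono)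
  then show ?thesis using main unfolding tail P_def[symmetric] by (simp add: sum_subtractf sum.distrib algebra_simps)
qed

section \<open>From finite packings to the converse for infinite constellations\<close>

definition "tailprob n \<sigma> t = measure (noise n \<sigma>) {z \<in> space (noise n \<sigma>). t < lnvol n z}"

lemma tailprob_bounds: assumes "0 < \<sigma>" shows "0 \<le> tailprob n \<sigma> t" "tailprob n \<sigma> t \<le> 1"
proof -
  interpret prob_space "noise n \<sigma>" using assms by (rule prob_space_noise)
  show "0 \<le> tailprob n \<sigma> t" "tailprob n \<sigma> t \<le> 1" by (auto simp: tailprob_def)
qed

lemma IC_density_nonneg: "0 \<le> IC_density n S"
  unfolding IC_density_def
proof (rule le_Limsup)
  show "\<forall>\<^sub>F a in at_top. 0 \<le> ecount (S \<inter> Cb n a) / ereal (a ^ n)"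
    using eventually_gt_at_top[of 0]
    by eventually_elim (auto simp: ecount_def)
qed simp

lemma less_NLD_imp:
  assumes n: "1 \<le> n" and d: "ereal d < NLD n S"
  shows "ereal (exp (n * d)) < IC_density n S"
proof -
  consider "IC_density n S = 0" | "IC_density n S = \<infinity>" | g where "IC_density n S = ereal g" "0 < g"
    using IC_density_nonneg[of n S] by (cases "IC_density n S") (auto simp: order_less_le)
  then show ?thesis
  proof cases
    case 3
    then have "d < ln g / n" using d by (simp add: NLD_def)
    then have "n * d < ln g" using n by (simp add: field_simps)
    then have "exp (n * d) < g" using 3(2) by (metis exp_less_cancel_iff exp_ln)
    then show ?thesis using 3 by simp
  qed (use d in \<open>auto simp: NLD_def\<close>)
qed

lemma le_NLD:
  assumes n: "1 \<le> n" and d: "ereal (exp (n * d)) \<le> IC_density n S"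
  shows "ereal d \<le> NLD n S"
proof (cases "IC_density n S")
  case (real g)
  then have g: "exp (n * d) \<le> g" using d by simp
  then have g0: "0 < g" using exp_gt_zero[of "n * d"] by linarith
  then have "n * d \<le> ln g" using g by (metis exp_le_cancel_iff exp_ln)
  then have "d \<le> ln g / n" using n by (simp add: field_simps)
  then show ?thesis using real g0 by (simp add: NLD_def)
qed (use d in \<open>auto simp: NLD_def\<close>)

lemma chmap_inj:
  assumes "\<And>i. i < n \<Longrightarrow> 0 < h i" shows "inj_on (chmap h) (Rn n)"
proof (rule inj_onI, rule ext)
  fix x y i assume x: "x \<in> Rn n" "y \<in> Rn n" "chmap h x = chmap h y"
  have "h i * x i = h i * y i" using fun_cong[OF x(3), of i] by (simp add: chmap_def)
  then show "x i = y i" using assms[of i] x by (cases "i < n") (auto simp: Rn_def)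
qed

lemma chmap_Cb:
  assumes "\<And>i. i < n \<Longrightarrow> 0 < h i" "S \<subseteq> Rn n"
  shows "chmap h ` S \<inter> chmap h ` Cb n a = chmap h ` (S \<inter> Cb n a)" "card (chmap h ` (S \<inter> Cb n a)) = card (S \<inter> Cb n a)"
proof -
  have C: "Cb n a \<subseteq> Rn n" by (auto simp: Cb_def)
  have inj: "inj_on (chmap h) (Rn n)" using assms(1) by (rule chmap_inj)
  show "chmap h ` S \<inter> chmap h ` Cb n a = chmap h ` (S \<inter> Cb n a)"
    using inj_on_image_Int[OF inj assms(2) C] by simp
  show "card (chmap h ` (S \<inter> Cb n a)) = card (S \<inter> Cb n a)"
    by (rule card_image) (rule inj_on_subset[OF inj], use assms(2) in auto)
qed

lemma err_cond_bounds: assumes "0 < \<sigma>" shows "0 \<le> err_cond n \<sigma> T y" "err_cond n \<sigma> T y \<le> 1"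
proof -
  interpret prob_space "noise n \<sigma>" using assms by (rule prob_space_noise)
  show "0 \<le> err_cond n \<sigma> T y" "err_cond n \<sigma> T y \<le> 1" by (auto simp: err_cond_def)
qed

lemma vnorm_tail_small:
  assumes \<sigma>: "0 < \<sigma>" and e: "0 < e"
  obtains d where "0 \<le> d" "measure (noise n \<sigma>) {z \<in> space (noise n \<sigma>). d < vnorm n z} \<le> e"
proof -
  interpret prob_space "noise n \<sigma>" using \<sigma> by (rule prob_space_noise)
  define A where "A k = {z \<in> space (noise n \<sigma>). real k < vnorm n z}" for k :: nat
  have A: "A k \<in> sets (noise n \<sigma>)" for k unfolding A_def sets_noise space_noise by measurable
  have "(\<lambda>k. prob (A k)) \<longlonglongrightarrow> prob (\<Inter>k. A k)"
    by (rule finite_Lim_measure_decseq) (use A in \<open>auto simp: A_def decseq_def\<close>)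
  moreover have "(\<Inter>k. A k) = {}"
  proof -
    have "\<exists>k. z \<notin> A k" for z using reals_Archimedean2[of "vnorm n z"] less_asym by (auto simp: A_def)
    then show ?thesis by blast
  qed
  ultimately have "(\<lambda>k. prob (A k)) \<longlonglongrightarrow> 0" by simp
  then have "\<forall>\<^sub>F k in sequentially. prob (A k) < e" using e by (auto dest: order_tendstoD)
  then obtain k where "prob (A k) < e" by (auto simp: eventually_sequentially)
  then show ?thesis using that[of "real k"] by (auto simp: A_def)
qed

text \<open>Density and error are upper limits, perhaps attained along different cubes. So a smaller
  error is assumed for all large cubes: any cube with more than exp (n d) a^n points would violate
  it, because the box volume per point is then nearly at most exp t and the two multiplier terms
  cancel. Hence no large cube is that full, against the assumed density.\<close>

lemma converse_given:
  assumes n: "1 \<le> n" and \<sigma>: "0 < \<sigma>" and S: "is_IC n S" "\<And>a. finite (S \<inter> Cb n a)"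
    and d: "ereal d < NLD n S" and h: "\<And>i. i < n \<Longrightarrow> 0 < h i"
  shows "tailprob n \<sigma> ((\<Sum>i<n. ln (h i)) - n * d) \<le> avg_err_given n \<sigma> S h"
proof -
  define t where "t = (\<Sum>i<n. ln (h i)) - n * d"
  define T where "T = chmap h ` S"
  have SR: "S \<subseteq> Rn n" "countable S" using S(1) by (auto simp: is_IC_def)
  have T: "countable T" "T \<subseteq> Rn n" using SR by (auto simp: T_def chmap_def Rn_def)
  define C where "C a = chmap h ` (S \<inter> Cb n a)" for a
  define m where "m a = real (card (S \<inter> Cb n a))" for a
  define f where "f a = (\<Sum>y\<in>C a. err_cond n \<sigma> T y) / m a" for a
  have Cb_eq: "chmap h ` S \<inter> chmap h ` Cb n a = chmap h ` (S \<inter> Cb n a)" "card (chmap h ` (S \<inter> Cb n a)) = card (S \<inter> Cb n a)" for a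
    using chmap_Cb[of n h S] h SR(1) by auto
  have avg: "avg_err_given n \<sigma> S h = real_of_ereal (Limsup at_top (\<lambda>a. ereal (f a)))"
    unfolding avg_err_given_def Let_def f_def T_def C_def m_def Cb_eq by simp
  have cardC: "real (card (C a)) = m a" for a unfolding C_def m_def Cb_eq(2) by simp
  \<comment> \<open>The bounds also hold for an empty cube, where the quotient is 0 / 0 = 0. So the
    \<open>Limsup\<close> is finite and \<open>real_of_ereal\<close> loses nothing.\<close>
  have f01: "0 \<le> f a" "f a \<le> 1" for a
  proof -
    show "0 \<le> f a" unfolding f_def m_def using err_cond_bounds[OF \<sigma>] by (intro divide_nonneg_nonneg sum_nonneg) auto
    have "(\<Sum>y\<in>C a. err_cond n \<sigma> T y) \<le> (\<Sum>y\<in>C a. 1)" using err_cond_bounds[OF \<sigma>] by (intro sum_mono) auto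
    also have "\<dots> = m a" using cardC[of a] by simp
    finally show "f a \<le> 1" unfolding f_def m_def by (auto simp: divide_le_eq_1)
  qed
  have L: "0 \<le> Limsup at_top (\<lambda>a. ereal (f a))" "Limsup at_top (\<lambda>a. ereal (f a)) \<le> 1"
    using f01 by (auto intro!: le_Limsup Limsup_bounded)
  obtain l where l: "0 \<le> l" "\<And>E. E \<in> sets (vol n) \<Longrightarrow>
    emeasure (noise n \<sigma>) E + ennreal (l * exp t) \<le> emeasure (noise n \<sigma>) {z \<in> space (vol n). lnvol n z \<le> t} + ennreal l * emeasure (vol n) E"
    using sphere_packing_multiplier[OF n \<sigma>, of t] by blast
  have "ereal (tailprob n \<sigma> t - 2 * \<eta>) \<le> Limsup at_top (\<lambda>a. ereal (f a))" if \<eta>: "0 < \<eta>" for \<eta>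
  proof (rule ccontr)
    assume "\<not> ereal (tailprob n \<sigma> t - 2 * \<eta>) \<le> Limsup at_top (\<lambda>a. ereal (f a))"
    then have "Limsup at_top (\<lambda>a. ereal (f a)) < ereal (tailprob n \<sigma> t - 2 * \<eta>)" by simp
    then have ev1: "\<forall>\<^sub>F a in at_top. f a < tailprob n \<sigma> t - 2 * \<eta>"
      by (drule_tac Limsup_lessD) auto
    obtain r where r: "0 \<le> r" "measure (noise n \<sigma>) {z \<in> space (noise n \<sigma>). r < vnorm n z} \<le> \<eta>"
      by (rule vnorm_tail_small[OF \<sigma> \<eta>])
    \<comment> \<open>Relative to the side a, enlarging the received box by \<open>r\<close> on each
      side adds 2 r / a per coordinate, an edge effect that vanishes.\<close>
    have "((\<lambda>a. l * ((\<Prod>i<n. h i + 2 * r / a) * exp (- (n * d)))) \<longlongrightarrow> l * ((\<Prod>i<n. h i + 0) * exp (- (n * d)))) at_top"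
      by (intro tendsto_intros tendsto_divide_0[OF tendsto_const] filterlim_at_top_imp_at_infinity filterlim_ident)
    moreover have "l * ((\<Prod>i<n. h i + 0) * exp (- (n * d))) = l * exp t"
    proof -
      have "(\<Prod>i<n. h i) = exp (\<Sum>i<n. ln (h i))" using h by (simp add: exp_sum)
      then show ?thesis unfolding t_def by (simp add: exp_diff exp_minus field_simps)
    qed
    ultimately have ev2: "\<forall>\<^sub>F a in at_top. l * ((\<Prod>i<n. h i + 2 * r / a) * exp (- (n * d))) < l * exp t + \<eta>"
      using \<eta> by (auto dest!: order_tendstoD(2)[where a = "l * exp t + \<eta>"])
    have "\<forall>\<^sub>F a in at_top. ecount (S \<inter> Cb n a) / ereal (a ^ n) \<le> ereal (exp (n * d))"
      using ev1 ev2 eventually_gt_at_top[of 0]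
    proof eventually_elim
      case (elim a)
      show ?case
      proof (rule ccontr)
        assume "\<not> ecount (S \<inter> Cb n a) / ereal (a ^ n) \<le> ereal (exp (n * d))"
        then have "exp (n * d) < m a / a ^ n" using S(2)[of a] elim by (simp add: ecount_def m_def)
        then have me: "exp (n * d) * a ^ n < m a" using elim by (simp add: field_simps)
        then have m0: "0 < m a" using elim by (smt (verit) exp_gt_zero mult_pos_pos zero_less_power)
        have "real (card (C a)) * (measure (noise n \<sigma>) {z \<in> space (noise n \<sigma>). t < lnvol n z} - measure (noise n \<sigma>) {z \<in> space (noise n \<sigma>). r < vnorm n z} + l * exp t)
          - l * (\<Prod>i<n. 2 * (h i * a / 2 + r)) \<le> (\<Sum>y\<in>C a. err_cond n \<sigma> T y)"
        proof (rule finite_packing_bound[OF n \<sigma> T _ _ r(1) _ _ l])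
          show "finite (C a)" "C a \<subseteq> T" using S(2) by (auto simp: C_def T_def)
          show "0 \<le> h i * a / 2" if "i < n" for i using h[OF that] elim by simp
          show "\<bar>y i\<bar> \<le> h i * a / 2" if y: "y \<in> C a" "i < n" for y i
          proof -
            obtain x where x: "x \<in> Cb n a" "y = chmap h x" using y by (auto simp: C_def)
            then have "\<bar>x i\<bar> \<le> a / 2" using y(2) by (auto simp: Cb_def less_imp_le)
            then have "h i * \<bar>x i\<bar> \<le> h i * (a / 2)" using h[OF y(2)] by (intro mult_left_mono) auto
            then show ?thesis using h[OF y(2)] by (simp add: x(2) chmap_def abs_mult)
          qed
        qed
        also have "(\<Sum>y\<in>C a. err_cond n \<sigma> T y) = m a * f a" using m0 by (simp add: f_def)
        finally have 1: "m a * (tailprob n \<sigma> t - \<eta> + l * exp t) - l * (\<Prod>i<n. 2 * (h i * a / 2 + r)) \<le> m a * f a"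
          using r(2) m0 unfolding cardC tailprob_def
          by (smt (verit, best) mult_left_mono)
        have "(\<Prod>i<n. 2 * (h i * a / 2 + r)) = (\<Prod>i<n. a * (h i + 2 * r / a))"
          using elim by (intro prod.cong) (auto simp: field_simps)
        also have "\<dots> = a ^ n * (\<Prod>i<n. h i + 2 * r / a)" by (simp add: prod.distrib)
        \<comment> \<open>Here the excess of points enters: it bounds a^n by exp (- n d) per point
          of the cube.\<close>
        also have "\<dots> \<le> m a * exp (- (n * d)) * (\<Prod>i<n. h i + 2 * r / a)"
        proof (rule mult_right_mono)
          show "a ^ n \<le> m a * exp (- (n * d))" using me by (simp add: exp_minus field_simps)
          show "0 \<le> (\<Prod>i<n. h i + 2 * r / a)" using h r elim by (intro prod_nonneg add_nonneg_nonneg) (auto simp: less_imp_le)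
        qed
        finally have "l * (\<Prod>i<n. 2 * (h i * a / 2 + r)) \<le> l * (m a * exp (- (n * d)) * (\<Prod>i<n. h i + 2 * r / a))"
          using l(1) by (rule mult_left_mono)
        also have "\<dots> = m a * (l * ((\<Prod>i<n. h i + 2 * r / a) * exp (- (n * d))))" by (simp add: mult_ac)
        also have "\<dots> < m a * (l * exp t + \<eta>)" using elim(2) m0 by (intro mult_strict_left_mono)
        finally have "m a * (tailprob n \<sigma> t - 2 * \<eta>) < m a * f a" using 1 by (simp add: algebra_simps)
        then show False using elim(1) m0 by simp
      qed
    qed
    then have "IC_density n S \<le> ereal (exp (n * d))" unfolding IC_density_def by (rule Limsup_bounded)
    then show False using less_NLD_imp[OF n d] by simp
  qed
  then have "tailprob n \<sigma> t - 2 * \<eta> \<le> avg_err_given n \<sigma> S h" if "0 < \<eta>" for \<eta>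
    using that L unfolding avg by (cases "Limsup at_top (\<lambda>a. ereal (f a))") auto
  from this[of "\<eta> / 2" for \<eta>] have "tailprob n \<sigma> t \<le> avg_err_given n \<sigma> S h + \<eta>" if "0 < \<eta>" for \<eta>
    using that by (simp add: algebra_simps)
  then show ?thesis unfolding t_def[symmetric] by (rule field_le_epsilon)
qed

lemma converse_bound:
  assumes n: "1 \<le> n" and \<sigma>: "0 < \<sigma>" and S: "is_IC n S" "\<And>a. finite (S \<inter> Cb n a)"
    and d: "ereal d < NLD n S" and pos: "AE \<omega> in M. \<forall>i<n. 0 < H i \<omega>"
  shows "(\<integral>\<^sup>+\<omega>. ennreal (tailprob n \<sigma> ((\<Sum>i<n. lnH H i \<omega>) - n * d)) \<partial>M) \<le> avg_err M H n \<sigma> S"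
  unfolding avg_err_def
proof (rule nn_integral_mono_AE, use pos in eventually_elim)
  case (elim \<omega>)
  have "(\<Sum>i<n. lnH H i \<omega>) = (\<Sum>i<n. ln (H i \<omega>))"
    using elim by (intro sum.cong) (auto simp: lnH_def ln_realpow)
  then show ?case using converse_given[OF n \<sigma> S d, of "\<lambda>i. H i \<omega>"] elim by (auto intro!: ennreal_leI)
qed

section \<open>Random lattices and achievability\<close>

text \<open>For prime \<open>q\<close> this is the Construction A lattice of the one-dimensional
  linear code over the field with q elements generated by (1, g 1, ..., g (n - 1)).\<close>

definition lat :: "nat \<Rightarrow> int \<Rightarrow> (nat \<Rightarrow> int) \<Rightarrow> (nat \<Rightarrow> int) set" where
  "lat n q g = {x. (\<forall>i\<ge>n. x i = 0) \<and> (\<forall>i\<in>{1..<n}. q dvd x i - g i * x 0)}"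

definition scaled :: "real \<Rightarrow> (nat \<Rightarrow> int) \<Rightarrow> nat \<Rightarrow> real" where
  "scaled c x = (\<lambda>i. c * real_of_int (x i))"

lemma lat_zero: "(\<lambda>_. 0) \<in> lat n q g" by (simp add: lat_def)

lemma lat_add:
  assumes "x \<in> lat n q g" "y \<in> lat n q g" shows "(\<lambda>i. x i + y i) \<in> lat n q g"
proof -
  have "q dvd (x i + y i) - g i * (x 0 + y 0)" if "i \<in> {1..<n}" for i
  proof -
    have "q dvd (x i - g i * x 0) + (y i - g i * y 0)" using assms that by (auto simp: lat_def intro!: dvd_add)
    then show ?thesis by (simp add: algebra_simps)
  qed
  then show ?thesis using assms by (auto simp: lat_def)
qed

lemma lat_diff:
  assumes "x \<in> lat n q g" "y \<in> lat n q g" shows "(\<lambda>i. x i - y i) \<in> lat n q g"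
proof -
  have "q dvd (x i - y i) - g i * (x 0 - y 0)" if "i \<in> {1..<n}" for i
  proof -
    have "q dvd (x i - g i * x 0) - (y i - g i * y 0)" using assms that by (auto simp: lat_def intro!: dvd_diff)
    then show ?thesis by (simp add: algebra_simps)
  qed
  then show ?thesis using assms by (auto simp: lat_def)
qed

lemma countable_lat: "countable (lat n q g)"
proof (rule countable_subset)
  show "lat n q g \<subseteq> range (\<lambda>(l::int list) i. if i < n then l ! i else 0)"
  proof
    fix x assume "x \<in> lat n q g"
    then have "x = (\<lambda>i. if i < n then map x [0..<n] ! i else 0)" by (auto simp: lat_def)
    then show "x \<in> range (\<lambda>(l::int list) i. if i < n then l ! i else 0)" by (rule image_eqI) simp
  qed
qed simp

lemma scaled_Rn: "x \<in> lat n q g \<Longrightarrow> scaled c x \<in> Rn n" by (auto simp: lat_def scaled_def Rn_def)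

lemma is_IC_lat: "is_IC n (scaled c ` lat n q g)"
  using countable_lat scaled_Rn by (auto simp: is_IC_def)

lemma finite_lat_Cb:
  assumes c: "0 < c" shows "finite (scaled c ` lat n q g \<inter> Cb n a)"
proof (rule finite_subset)
  define K where "K = \<lceil>a / (2 * c)\<rceil>"
  show "finite (scaled c ` {x. \<forall>i. (i \<in> {..<n} \<longrightarrow> x i \<in> {- K..K}) \<and> (i \<notin> {..<n} \<longrightarrow> x i = 0)})"
    by (intro finite_imageI finite_set_of_finite_funs) auto
  show "scaled c ` lat n q g \<inter> Cb n a \<subseteq> scaled c ` {x. \<forall>i. (i \<in> {..<n} \<longrightarrow> x i \<in> {- K..K}) \<and> (i \<notin> {..<n} \<longrightarrow> x i = 0)}"
  proof
    fix y assume "y \<in> scaled c ` lat n q g \<inter> Cb n a"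
    then obtain x where x: "x \<in> lat n q g" "y = scaled c x" "scaled c x \<in> Cb n a" by auto
    have "x i \<in> {- K..K}" if "i < n" for i
    proof -
      have "\<bar>c * real_of_int (x i)\<bar> < a / 2" using x(3) that by (auto simp: Cb_def scaled_def)
      then have "\<bar>real_of_int (x i)\<bar> < a / (2 * c)" using c by (simp add: abs_mult field_simps)
      then have "real_of_int \<bar>x i\<bar> \<le> real_of_int K" unfolding K_def by linarith
      then have "\<bar>x i\<bar> \<le> K" by linarith
      then show ?thesis by (auto simp: abs_le_iff)
    qed
    then show "y \<in> scaled c ` {x. \<forall>i. (i \<in> {..<n} \<longrightarrow> x i \<in> {- K..K}) \<and> (i \<notin> {..<n} \<longrightarrow> x i = 0)}"
      using x by (auto simp: lat_def)
  qed
qed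

text \<open>Coordinate 0 may have any residue modulo q, which then forces all other residues, so
  only the multiples of q remain to be chosen. These run from - (k - 1) to k - 1, since - k could
  put a point on the boundary of the open cube.\<close>

lemma lat_count:
  assumes n: "1 \<le> n" and c: "0 < c" and q: "0 < q" and k: "1 \<le> k"
  shows "real_of_int q * (2 * real k - 1) ^ n \<le> real (card (scaled c ` lat n q g \<inter> Cb n (2 * c * q * k)))"
proof -
  define J where "J = {- int k + 1..int k - 1}"
  define D where "D = {0..<q} \<times> Pi\<^sub>E {..<n} (\<lambda>_. J)"
  define f where "f = (\<lambda>(r, j) i. if i = 0 then r + q * j 0 else if i < n then (g i * (r + q * j 0)) mod q + q * j i else (0::int))"
  have fin: "finite D" unfolding D_def J_def by (intro finite_cartesian_product finite_PiE) auto
  have cardJ: "card J = 2 * k - 1" unfolding J_def using k by simp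
  have cardD: "real (card D) = real_of_int q * (2 * real k - 1) ^ n"
    unfolding D_def using k q by (simp add: card_cartesian_product card_PiE cardJ of_nat_diff)
  have inj: "inj_on (scaled c \<circ> f) D"
  proof (rule inj_onI)
    fix p p' assume p: "p \<in> D" "p' \<in> D" and e: "(scaled c \<circ> f) p = (scaled c \<circ> f) p'"
    obtain r j r' j' where pp: "p = (r, j)" "p' = (r', j')" by (cases p, cases p')
    have r: "0 \<le> r" "r < q" "0 \<le> r'" "r' < q" and j: "j \<in> extensional {..<n}" "j' \<in> extensional {..<n}"
      using p by (auto simp: pp D_def PiE_iff)
    have fe: "f p i = f p' i" for i using fun_cong[OF e, of i] c by (simp add: scaled_def)
    have e0: "r + q * j 0 = r' + q * j' 0" using fe[of 0] by (simp add: f_def pp)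
    have "r = (r + q * j 0) mod q" using r by simp
    also have "\<dots> = r'" unfolding e0 using r by simp
    finally have rr: "r = r'" .
    have "j i = j' i" if i: "i < n" for i
    proof (cases "i = 0")
      case True then show ?thesis using e0 rr q by simp
    next
      case False
      then show ?thesis using fe[of i] i e0 q by (simp add: f_def pp)
    qed
    then have "j = j'" using j by (intro extensionalityI[of j "{..<n}" j']) auto
    then show "p = p'" using rr pp by simp
  qed
  have bnd: "\<bar>s + q * m\<bar> < q * int k" if "0 \<le> s" "s < q" "m \<in> J" for s m
  proof -
    have m: "- int k + 1 \<le> m" "m \<le> int k - 1" using that by (auto simp: J_def)
    have "q * m \<le> q * (int k - 1)" "q * (- int k + 1) \<le> q * m" using q m by (auto intro!: mult_left_mono)
    then show ?thesis using that q by (simp add: algebra_simps abs_less_iff)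
  qed
  have "(scaled c \<circ> f) ` D \<subseteq> scaled c ` lat n q g \<inter> Cb n (2 * c * q * k)"
  proof
    fix y assume "y \<in> (scaled c \<circ> f) ` D"
    then obtain r j where rj: "(r, j) \<in> D" "y = scaled c (f (r, j))" by auto
    have r: "0 \<le> r" "r < q" and j: "\<And>i. i < n \<Longrightarrow> j i \<in> J" using rj by (auto simp: D_def PiE_iff)
    have lat: "f (r, j) \<in> lat n q g"
    proof -
      have "q dvd (s mod q + q * m) - s" for s m :: int
        by (simp add: mod_eq_dvd_iff[symmetric])
      then show ?thesis using n by (auto simp: lat_def f_def)
    qed
    have fb: "\<bar>f (r, j) i\<bar> < q * int k" if i: "i < n" for i
      using bnd[of r "j 0"] bnd[of "(g i * (r + q * j 0)) mod q" "j i"] r j i n q by (auto simp: f_def)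
    have "\<bar>scaled c (f (r, j)) i\<bar> < 2 * c * q * k / 2" if i: "i < n" for i
    proof -
      have "real_of_int \<bar>f (r, j) i\<bar> < real_of_int (q * int k)" using fb[OF i] by (simp only: of_int_less_iff)
      then have "c * \<bar>real_of_int (f (r, j) i)\<bar> < c * (q * k)" using c by simp
      then show ?thesis using c by (simp add: scaled_def abs_mult)
    qed
    then have "y \<in> Cb n (2 * c * q * k)" using scaled_Rn[OF lat] rj(2) by (simp add: Cb_def)
    then show "y \<in> scaled c ` lat n q g \<inter> Cb n (2 * c * q * k)" using lat rj(2) by auto
  qed
  then have "card ((scaled c \<circ> f) ` D) \<le> card (scaled c ` lat n q g \<inter> Cb n (2 * c * q * k))"
    by (intro card_mono finite_lat_Cb c)
  then show ?thesis unfolding cardD[symmetric] card_image[OF inj] by simp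
qed

text \<open>A lower bound for an upper limit may be read off along one sequence of cubes, here those
  of side 2 c q k, where the proportion (1 - 1 / (2 k))^n tends to 1.\<close>

lemma lat_density:
  assumes n: "1 \<le> n" and c: "0 < c" and q: "0 < q"
  shows "ereal (1 / (c ^ n * real_of_int q ^ (n - 1))) \<le> IC_density n (scaled c ` lat n q g)"
proof (rule ccontr)
  let ?S = "scaled c ` lat n q g"
  define \<gamma> where "\<gamma> = 1 / (c ^ n * real_of_int q ^ (n - 1))"
  assume "\<not> ereal (1 / (c ^ n * real_of_int q ^ (n - 1))) \<le> IC_density n ?S"
  then have "IC_density n ?S < ereal \<gamma>" by (simp add: \<gamma>_def)
  then obtain b where b: "IC_density n ?S < ereal b" "b < \<gamma>" by (metis ereal_dense2 less_ereal.simps(1))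
  have "\<forall>\<^sub>F a in at_top. ecount (?S \<inter> Cb n a) / ereal (a ^ n) < ereal b"
    using b(1) unfolding IC_density_def by (rule Limsup_lessD)
  moreover have "filterlim (\<lambda>k::nat. 2 * c * real_of_int q * real k) at_top sequentially"
    by (rule filterlim_tendsto_pos_mult_at_top[OF tendsto_const _ filterlim_real_sequentially]) (use c q in auto)
  ultimately have "\<forall>\<^sub>F k::nat in sequentially. ecount (?S \<inter> Cb n (2 * c * q * k)) / ereal ((2 * c * q * k) ^ n) < ereal b"
    by (rule eventually_compose_filterlim)
  then have ev: "\<forall>\<^sub>F k::nat in sequentially. \<gamma> * ((2 * real k - 1) / (2 * real k)) ^ n \<le> b"
    using eventually_ge_at_top[of 1]
  proof eventually_elim
    case (elim k)
    have "real (card (?S \<inter> Cb n (2 * c * q * k))) / (2 * c * q * k) ^ n < b"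
    proof -
      have nz: "(2 * c * q * k) ^ n \<noteq> 0" using elim c q by (intro power_not_zero) auto
      define A where "A = (2 * c * q * k) ^ n"
      show ?thesis using elim(1) finite_lat_Cb[OF c] nz unfolding A_def[symmetric] by (simp add: ecount_def)
    qed
    moreover have "real_of_int q * (2 * real k - 1) ^ n / (2 * c * q * k) ^ n \<le> real (card (?S \<inter> Cb n (2 * c * q * k))) / (2 * c * q * k) ^ n"
      using lat_count[OF n c q, of k g] elim c q by (intro divide_right_mono) auto
    moreover have "real_of_int q * (2 * real k - 1) ^ n / (2 * c * q * k) ^ n = \<gamma> * ((2 * real k - 1) / (2 * real k)) ^ n"
    proof -
      have qn: "real_of_int q ^ n = real_of_int q * real_of_int q ^ (n - 1)" using n by (cases n) auto
      have "(2 * c * q * k) ^ n = (c * q * (2 * real k)) ^ n" by (simp add: mult_ac)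
      also have "\<dots> = c ^ n * (q * real_of_int q ^ (n - 1)) * (2 * real k) ^ n" unfolding power_mult_distrib[of _ "2 * real k"] power_mult_distrib[of c] qn ..
      finally have e: "(2 * c * q * k) ^ n = c ^ n * (q * real_of_int q ^ (n - 1)) * (2 * real k) ^ n" .
      define u w where "u = (2 * real k - 1) ^ n" and "w = (2 * real k) ^ n"
      show ?thesis unfolding \<gamma>_def e power_divide u_def[symmetric] w_def[symmetric] using q by simp
    qed
    ultimately show ?case by simp
  qed
  have "(\<lambda>k. 1 - (1 / 2) / real k) \<longlonglongrightarrow> 1 - 0" by (intro tendsto_intros lim_const_over_n)
  then have "(\<lambda>k. \<gamma> * (1 - (1 / 2) / real k) ^ n) \<longlonglongrightarrow> \<gamma> * 1 ^ n" by (intro tendsto_intros) simp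
  moreover have "\<forall>\<^sub>F k::nat in sequentially. \<gamma> * (1 - (1 / 2) / real k) ^ n \<le> b"
    using ev eventually_ge_at_top[of 1]
  proof eventually_elim
    case (elim k)
    have "(2 * real k - 1) / (2 * real k) = 1 - (1 / 2) / real k" using elim(2) by (simp add: field_simps)
    then show ?case using elim(1) by simp
  qed
  ultimately have "\<gamma> * 1 ^ n \<le> b" by (intro tendsto_upperbound) auto
  then show False using b by simp
qed

text \<open>The strict inequality excludes x = 0 and counts ties as correct decoding, in agreement
  with \<open>voronoi\<close>.\<close>

definition "closer n c h x z \<longleftrightarrow> (\<Sum>i<n. (z i - h i * (c * real_of_int (x i)))^2) < (\<Sum>i<n. (z i)^2)"
  for c :: real and h z :: "nat \<Rightarrow> real" and x :: "nat \<Rightarrow> int"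

definition "lat_err n \<sigma> c \<Lambda> h = measure (noise n \<sigma>) {z \<in> space (noise n \<sigma>). \<exists>x\<in>\<Lambda>. closer n c h x z}"

text \<open>Translation by a lattice vector maps the received constellation to itself, so all points
  have the same error probability and the averages over cubes are constant.\<close>

lemma avg_err_given_lat:
  assumes n: "1 \<le> n" and c: "0 < c" and h: "\<And>i. i < n \<Longrightarrow> 0 < h i"
  shows "avg_err_given n \<sigma> (scaled c ` lat n q g) h = lat_err n \<sigma> c (lat n q g) h"
proof -
  let ?\<Lambda> = "lat n q g" and ?S = "scaled c ` lat n q g"
  have SR: "?S \<subseteq> Rn n" using scaled_Rn by auto
  have Cb_eq: "chmap h ` ?S \<inter> chmap h ` Cb n a = chmap h ` (?S \<inter> Cb n a)" "card (chmap h ` (?S \<inter> Cb n a)) = card (?S \<inter> Cb n a)" for a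
    using chmap_Cb[of n h ?S] h SR by auto
  have err: "err_cond n \<sigma> (chmap h ` ?S) y = lat_err n \<sigma> c ?\<Lambda> h" if y: "y \<in> chmap h ` ?S" for y
  proof -
    obtain x0 where x0: "x0 \<in> ?\<Lambda>" "y = chmap h (scaled c x0)" using y by auto
    have sq0: "sqdist n (\<lambda>i. y i + z i) y = (\<Sum>i<n. (z i)^2)" for z by (simp add: sqdist_def)
    have sq: "sqdist n (\<lambda>i. y i + z i) (chmap h (scaled c x)) = (\<Sum>i<n. (z i - h i * (c * real_of_int (x i - x0 i)))^2)" for z x
      unfolding sqdist_def x0(2) chmap_def scaled_def by (intro sum.cong) (auto simp: algebra_simps)
    have "(\<lambda>i. y i + z i) \<notin> voronoi n (chmap h ` ?S) y \<longleftrightarrow> (\<exists>x\<in>?\<Lambda>. closer n c h x z)" for z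
    proof -
      have "(\<lambda>i. y i + z i) \<notin> voronoi n (chmap h ` ?S) y \<longleftrightarrow> (\<exists>x\<in>?\<Lambda>. closer n c h (\<lambda>i. x i - x0 i) z)"
      proof -
        have "closer n c h (\<lambda>i. x i - x0 i) z \<longleftrightarrow> sqdist n (\<lambda>i. y i + z i) (chmap h (scaled c x)) < sqdist n (\<lambda>i. y i + z i) y" for x
          unfolding closer_def sq0 sq ..
        then show ?thesis unfolding voronoi_def by (simp add: not_le)
      qed
      also have "\<dots> \<longleftrightarrow> (\<exists>x\<in>?\<Lambda>. closer n c h x z)"
      proof
        assume "\<exists>x\<in>?\<Lambda>. closer n c h (\<lambda>i. x i - x0 i) z"
        then show "\<exists>x\<in>?\<Lambda>. closer n c h x z" using lat_diff[OF _ x0(1)] by blast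
      next
        assume "\<exists>x\<in>?\<Lambda>. closer n c h x z"
        then obtain x where x: "x \<in> ?\<Lambda>" "closer n c h x z" by auto
        then have "closer n c h (\<lambda>i. (x i + x0 i) - x0 i) z" by simp
        then show "\<exists>x\<in>?\<Lambda>. closer n c h (\<lambda>i. x i - x0 i) z" using lat_add[OF x(1) x0(1)]
          by (intro bexI[of _ "\<lambda>i. x i + x0 i"]) auto
      qed
      finally show ?thesis .
    qed
    then show ?thesis unfolding err_cond_def lat_err_def by simp
  qed
  have "avg_err_given n \<sigma> ?S h = real_of_ereal (Limsup at_top (\<lambda>a. ereal ((\<Sum>y\<in>chmap h ` (?S \<inter> Cb n a). err_cond n \<sigma> (chmap h ` ?S) y) / real (card (?S \<inter> Cb n a)))))"
    unfolding avg_err_given_def Let_def Cb_eq by simp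
  also have "Limsup at_top (\<lambda>a. ereal ((\<Sum>y\<in>chmap h ` (?S \<inter> Cb n a). err_cond n \<sigma> (chmap h ` ?S) y) / real (card (?S \<inter> Cb n a)))) =
    Limsup at_top (\<lambda>a::real. ereal (lat_err n \<sigma> c ?\<Lambda> h))"
  proof (rule Limsup_eq, use eventually_gt_at_top[of 0] in eventually_elim)
    case (elim a)
    \<comment> \<open>The origin lies in every cube of positive side, so the average is never 0 /
      0.\<close>
    have "(\<lambda>_. 0) \<in> ?S \<inter> Cb n a" using lat_zero[of n q g] elim by (auto simp: Cb_def Rn_def scaled_def intro!: image_eqI[of _ _ "\<lambda>_. 0"])
    then have c0: "0 < card (?S \<inter> Cb n a)" using finite_lat_Cb[OF c, of n q g a] by (auto simp: card_gt_0_iff)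
    have "(\<Sum>y\<in>chmap h ` (?S \<inter> Cb n a). err_cond n \<sigma> (chmap h ` ?S) y) = (\<Sum>y\<in>chmap h ` (?S \<inter> Cb n a). lat_err n \<sigma> c ?\<Lambda> h)"
      using err by (intro sum.cong) auto
    also have "\<dots> = real (card (?S \<inter> Cb n a)) * lat_err n \<sigma> c ?\<Lambda> h" using Cb_eq(2) by simp
    finally show ?case using c0 by simp
  qed
  also have "\<dots> = ereal (lat_err n \<sigma> c ?\<Lambda> h)" by (rule Limsup_const) simp
  finally show ?thesis by simp
qed

section \<open>Counting competing points and averaging over the generators\<close>

lemma vnorm_L2: "vnorm n z = L2_set z {..<n}" by (simp add: vnorm_def L2_set_def)

lemma emeasure_ball_shift:
  assumes "0 < r"
  shows "emeasure (vol n) {w \<in> space (vol n). vnorm n (\<lambda>i. w i - z i) \<le> r} = ennreal (unit_ball_vol n * r ^ n)"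
proof -
  define B where "B = {w \<in> space (vol n). vnorm n (\<lambda>i. w i - z i) \<le> r}"
  have "(\<lambda>w. vnorm n (\<lambda>i. w i - z i)) \<in> borel_measurable (vol n)"
  proof -
    have "(\<lambda>w. \<Sum>i<n. (w i - z i)^2) \<in> borel_measurable (vol n)"
      by (intro borel_measurable_sum borel_measurable_power borel_measurable_diff measurable_vol_component) auto
    then show ?thesis unfolding vnorm_def by measurable
  qed
  then have B: "B \<in> sets (vol n)" unfolding B_def by (intro borel_measurable_le) auto
  have "vshift n z -` B \<inter> space (vol n) = {w \<in> space (vol n). vnorm n w \<le> r}"
    using measurable_space[OF shift_measurable] by (auto simp: B_def vnorm_def vshift_def)
  then show ?thesis using emeasure_shift[OF B, of z] emeasure_vol_ball[OF assms, of n] by (simp add: B_def)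
qed

text \<open>Half-open boxes with sides c h_i, anchored at the received grid points, are disjoint;
  those of the closer points lie in the ball around \<open>z\<close> of radius |z| + c |h| <= |z| (1
  + 1/n). Its volume exceeds exp (lnvol n z) at most by (1 + 1/n)^n <= e <= 3.\<close>

lemma card_closer:
  assumes n: "1 \<le> n" and c: "0 < c" and h: "\<And>i. i < n \<Longrightarrow> 0 < h i" and z: "0 < vnorm n z" "n * (c * vnorm n h) \<le> vnorm n z"
  defines "X \<equiv> {x. (\<forall>i\<ge>n. x i = 0) \<and> closer n c h x z}"
  shows "finite X" "real (card X) * (c ^ n * (\<Prod>i<n. h i)) \<le> 3 * exp (lnvol n z)"
proof -
  interpret L: product_sigma_finite "\<lambda>_::nat. lborel :: real measure" by standard
  define P where "P = c ^ n * (\<Prod>i<n. h i)"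
  have P0: "0 < P" unfolding P_def using c h by (auto intro!: mult_pos_pos prod_pos)
  define r where "r = vnorm n z + c * vnorm n h"
  have r0: "0 < r" unfolding r_def using z c vnorm_nonneg[of n h] by (intro add_pos_nonneg) auto
  define Bx where "Bx = {w \<in> space (vol n). vnorm n (\<lambda>i. w i - z i) \<le> r}"
  define Q where "Q x = Pi\<^sub>E {..<n} (\<lambda>i. {h i * (c * real_of_int (x i))..<h i * (c * (real_of_int (x i) + 1))})" for x :: "nat \<Rightarrow> int"
  have Qs: "Q x \<in> sets (vol n)" for x unfolding Q_def vol_def by (intro sets_PiM_I_finite) auto
  have volQ: "emeasure (vol n) (Q x) = ennreal P" for x
  proof -
    have "emeasure (vol n) (Q x) = (\<Prod>i<n. emeasure lborel {h i * (c * real_of_int (x i))..<h i * (c * (real_of_int (x i) + 1))})"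
      unfolding vol_def Q_def by (rule L.emeasure_PiM) auto
    also have "\<dots> = (\<Prod>i<n. ennreal (c * h i))"
    proof (rule prod.cong)
      fix i assume "i \<in> {..<n}"
      then have "h i * (c * real_of_int (x i)) \<le> h i * (c * (real_of_int (x i) + 1))" using c h by (intro mult_left_mono) (auto simp: less_imp_le)
      then show "emeasure lborel {h i * (c * real_of_int (x i))..<h i * (c * (real_of_int (x i) + 1))} = ennreal (c * h i)"
        by (simp add: algebra_simps)
    qed simp
    also have "\<dots> = ennreal (\<Prod>i<n. c * h i)" using c h by (intro prod_ennreal) (auto simp: less_imp_le)
    also have "(\<Prod>i<n. c * h i) = P" by (simp add: P_def prod.distrib)
    finally show ?thesis .
  qed
  have disj: "Q x \<inter> Q x' = {}" if "x \<in> X" "x' \<in> X" "x \<noteq> x'" for x x'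
  proof (rule ccontr)
    assume "Q x \<inter> Q x' \<noteq> {}"
    then obtain w where w: "w \<in> Q x" "w \<in> Q x'" by auto
    have "x i = x' i" for i
    proof (cases "i < n")
      case True
      have fl: "\<lfloor>w i / (h i * c)\<rfloor> = y i" if "w \<in> Q y" for y
      proof (rule floor_unique)
        have "h i * (c * real_of_int (y i)) \<le> w i" "w i < h i * (c * (real_of_int (y i) + 1))"
          using that True by (auto simp: Q_def PiE_iff)
        then show "real_of_int (y i) \<le> w i / (h i * c)" "w i / (h i * c) < real_of_int (y i) + 1"
          using c h[OF True] by (auto simp: field_simps)
      qed
      show ?thesis using fl[OF w(1)] fl[OF w(2)] by simp
    next
      case False then show ?thesis using that by (auto simp: X_def)
    qed
    then show False using that by auto
  qed
  have sub: "Q x \<subseteq> Bx" if x: "x \<in> X" for x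
  proof
    fix w assume w: "w \<in> Q x"
    have "vnorm n (\<lambda>i. w i - z i) = L2_set (\<lambda>i. (h i * (c * real_of_int (x i)) - z i) + (w i - h i * (c * real_of_int (x i)))) {..<n}"
      by (simp add: vnorm_L2)
    also have "\<dots> \<le> L2_set (\<lambda>i. h i * (c * real_of_int (x i)) - z i) {..<n} + L2_set (\<lambda>i. w i - h i * (c * real_of_int (x i))) {..<n}"
      by (rule L2_set_triangle_ineq)
    also have "L2_set (\<lambda>i. h i * (c * real_of_int (x i)) - z i) {..<n} \<le> vnorm n z"
      using x unfolding X_def closer_def L2_set_def vnorm_def by (auto simp: power2_commute less_imp_le)
    also have "L2_set (\<lambda>i. w i - h i * (c * real_of_int (x i))) {..<n} \<le> L2_set (\<lambda>i. c * h i) {..<n}"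
      using w by (intro L2_set_mono) (auto simp: Q_def PiE_iff algebra_simps less_imp_le)
    also have "L2_set (\<lambda>i. c * h i) {..<n} = c * vnorm n h"
      using c by (simp add: vnorm_L2 L2_set_right_distrib)
    finally show "w \<in> Bx" using w by (auto simp: Bx_def r_def Q_def space_vol PiE_iff)
  qed
  have vB: "emeasure (vol n) Bx = ennreal (unit_ball_vol n * r ^ n)" unfolding Bx_def by (rule emeasure_ball_shift[OF r0])
  \<comment> \<open>A set outside the sigma-algebra has measure 0 by convention, so the positive
    value \<open>vB\<close> already proves measurability.\<close>
  have Bs: "Bx \<in> sets (vol n)"
  proof (rule ccontr)
    assume "Bx \<notin> sets (vol n)"
    then have "emeasure (vol n) Bx = 0" by (rule emeasure_notin_sets)
    moreover have "0 < unit_ball_vol n * r ^ n" using r0 unit_ball_vol_pos[of "real n"] by (intro mult_pos_pos) auto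
    ultimately show False unfolding vB by (simp add: ennreal_eq_0_iff del: mult_le_0_iff)
  qed
  have fin: "real (card F) * P \<le> unit_ball_vol n * r ^ n" if F: "finite F" "F \<subseteq> X" for F
  proof -
    have "ennreal (real (card F) * P) = (\<Sum>x\<in>F. emeasure (vol n) (Q x))"
      unfolding volQ using P0 by (simp add: ennreal_mult ennreal_of_nat_eq_real_of_nat)
    also have "\<dots> = emeasure (vol n) (\<Union>x\<in>F. Q x)"
    proof (rule sum_emeasure)
      show "disjoint_family_on Q F" unfolding disjoint_family_on_def using disj F(2) by blast
    qed (use F Qs in auto)
    also have "\<dots> \<le> emeasure (vol n) Bx" using sub F Bs by (intro emeasure_mono) auto
    finally show ?thesis unfolding vB using r0 by (subst (asm) ennreal_le_iff) auto
  qed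
  define N where "N = nat \<lceil>unit_ball_vol n * r ^ n / P\<rceil>"
  have "card F \<le> N" if F: "F \<subseteq> X" "finite F" for F
  proof -
    have "real (card F) \<le> unit_ball_vol n * r ^ n / P" using fin[OF F(2,1)] P0 by (simp add: field_simps)
    then show ?thesis unfolding N_def by linarith
  qed
  then have "finite X \<and> card X \<le> N" by (intro finite_if_finite_subsets_card_bdd) auto
  then show f: "finite X" ..
  have "r ^ n \<le> 3 * vnorm n z ^ n"
  proof -
    have "r \<le> vnorm n z * (1 + 1 / n)" using z n unfolding r_def by (simp add: field_simps)
    then have "r ^ n \<le> (vnorm n z * (1 + 1 / n)) ^ n" using r0 by (intro power_mono) auto
    also have "\<dots> = vnorm n z ^ n * (1 + 1 / n) ^ n" by (simp add: power_mult_distrib)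
    also have "(1 + 1 / n) ^ n \<le> exp (1 / n) ^ n" using exp_ge_add_one_self[of "1 / real n"] by (intro power_mono) auto
    also have "\<dots> = exp 1" using n by (simp add: exp_of_nat_mult[symmetric])
    also have "\<dots> \<le> 3" by (rule exp_le)
    finally show ?thesis using z by (simp add: mult.commute)
  qed
  moreover have "exp (lnvol n z) = unit_ball_vol n * vnorm n z ^ n"
  proof -
    have "lnvol n z = ln (unit_ball_vol n * vnorm n z ^ n)"
      using n z unit_ball_vol_pos[of "real n"] by (simp add: lnvol_def ln_mult ln_realpow)
    then show ?thesis using z unit_ball_vol_pos[of "real n"] by simp
  qed
  ultimately have "unit_ball_vol n * r ^ n \<le> 3 * exp (lnvol n z)"
    by (simp add: mult_left_mono)
  then show "real (card X) * (c ^ n * (\<Prod>i<n. h i)) \<le> 3 * exp (lnvol n z)" using fin[OF f order_refl] unfolding P_def by linarith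
qed

text \<open>As \<open>x 0\<close> is invertible modulo the prime, each \<open>g i\<close> is
  determined by \<open>x i\<close>. So an integer point with first coordinate prime to q blames at
  most one generator.\<close>

lemma lat_unique:
  fixes q :: int
  assumes q: "prime q" "\<not> q dvd x 0" and g: "g \<in> Pi\<^sub>E {1..<n} (\<lambda>_. {0..<q})" "g' \<in> Pi\<^sub>E {1..<n} (\<lambda>_. {0..<q})"
    and x: "x \<in> lat n q g" "x \<in> lat n q g'"
  shows "g = g'"
proof (rule PiE_ext[OF g])
  fix i assume i: "i \<in> {1..<n}"
  have a: "q dvd x i - g' i * x 0" "q dvd x i - g i * x 0" using x i by (auto simp: lat_def)
  from dvd_diff[OF a] have "q dvd (g i - g' i) * x 0" by (simp add: algebra_simps)
  then have "q dvd g i - g' i" using q by (simp add: prime_dvd_mult_iff)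
  moreover have "0 \<le> g i" "g i < q" "0 \<le> g' i" "g' i < q" using PiE_mem[OF g(1) i] PiE_mem[OF g(2) i] by auto
  ultimately show "g i = g' i" by (simp add: mod_eq_dvd_iff[symmetric])
qed

lemma closer_set_measurable:
  assumes "countable \<Lambda>" shows "{z \<in> space (vol n). \<exists>x\<in>\<Lambda>. closer n c h x z} \<in> sets (vol n)"
proof -
  have "{z \<in> space (vol n). \<exists>x\<in>\<Lambda>. closer n c h x z} = (\<Union>x\<in>\<Lambda>. {z \<in> space (vol n). closer n c h x z})" by auto
  moreover have "{z \<in> space (vol n). closer n c h x z} \<in> sets (vol n)" for x
    unfolding closer_def
    by (intro borel_measurable_less borel_measurable_sum borel_measurable_power borel_measurable_diff measurable_vol_component) auto
  ultimately show ?thesis using assms by (auto intro!: sets.countable_UN')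
qed

lemma vnorm_component: "i < n \<Longrightarrow> \<bar>z i\<bar> \<le> vnorm n z"
  unfolding vnorm_L2 using member_le_L2_set[of "{..<n}" i "\<lambda>i. \<bar>z i\<bar>"] by (simp add: L2_set_def)

text \<open>Points of q Z^n lie in every lattice and escape the averaging. If q divides
  \<open>x 0\<close>, the congruences make \<open>x\<close> such a point; being non-zero, it is
  received at distance at least c q h_i > 2 |z| for some i, too far to beat the origin.\<close>

lemma closer_not_dvd:
  fixes q :: int and c :: real and h z :: "nat \<Rightarrow> real"
  assumes c: "0 < c" and h: "\<And>i. i < n \<Longrightarrow> 0 < h i" and q: "0 < q" "\<And>i. i < n \<Longrightarrow> 2 * vnorm n z < c * q * h i"
    and x: "x \<in> lat n q g" "closer n c h x z"
  shows "\<not> q dvd x 0"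
proof
  assume d0: "q dvd x 0"
  have dv: "q dvd x i" if "i < n" for i
  proof (cases "i = 0")
    case False
    then have "q dvd (x i - g i * x 0) + g i * x 0" using x that d0 by (intro dvd_add) (auto simp: lat_def)
    then show ?thesis by simp
  qed (use d0 in simp)
  have "\<exists>i<n. x i \<noteq> 0"
  proof (rule ccontr)
    assume "\<not> (\<exists>i<n. x i \<noteq> 0)"
    then have "(\<Sum>i<n. (z i - h i * (c * real_of_int (x i)))^2) = (\<Sum>i<n. (z i)^2)" by (intro sum.cong) auto
    then show False using x(2) by (simp add: closer_def)
  qed
  then obtain i where i: "i < n" "x i \<noteq> 0" by auto
  have "q \<le> \<bar>x i\<bar>" using dv[OF i(1)] i(2) dvd_imp_le_int[of "x i" q] q by simp
  then have "real_of_int q \<le> \<bar>real_of_int (x i)\<bar>" by linarith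
  then have "c * h i * q \<le> c * h i * \<bar>real_of_int (x i)\<bar>" using c h[OF i(1)] by (intro mult_left_mono) auto
  also have "\<dots> = \<bar>h i * (c * real_of_int (x i))\<bar>" using c h[OF i(1)] by (simp add: abs_mult)
  also have "\<dots> \<le> vnorm n (\<lambda>i. h i * (c * real_of_int (x i)))" using vnorm_component[OF i(1), of "\<lambda>i. h i * (c * real_of_int (x i))"] by simp
  also have "\<dots> = L2_set (\<lambda>i. (h i * (c * real_of_int (x i)) - z i) + z i) {..<n}" by (simp add: vnorm_L2)
  also have "\<dots> \<le> L2_set (\<lambda>i. h i * (c * real_of_int (x i)) - z i) {..<n} + vnorm n z" unfolding vnorm_L2 by (rule L2_set_triangle_ineq)
  also have "L2_set (\<lambda>i. h i * (c * real_of_int (x i)) - z i) {..<n} \<le> vnorm n z"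
    using x(2) unfolding closer_def L2_set_def vnorm_def by (auto simp: power2_commute less_imp_le)
  finally show False using q(2)[OF i(1)] by (simp add: mult_ac)
qed

text \<open>For fixed noise of ordinary length, sending each bad \<open>g\<close> to a closer point
  of its lattice is injective, so the bad \<open>g\<close> are no more numerous than the closer
  integer points. The loss \<open>ln (3 * real n)\<close> in the threshold pays for the factor 3 of
  \<open>card_closer\<close> and leaves a fraction 1 / n; \<open>cq\<close> fixes the density exp (n
  d).\<close>

lemma lat_avg:
  fixes q :: int and c d r1 r2 :: real and h :: "nat \<Rightarrow> real"
  assumes n: "1 \<le> n" and c: "0 < c" and q: "prime q" and \<sigma>: "0 < \<sigma>" and h: "\<And>i. i < n \<Longrightarrow> 0 < h i"
    and r: "0 < r1" "n * (c * vnorm n h) \<le> r1" "\<And>i. i < n \<Longrightarrow> 2 * r2 < c * q * h i"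
    and cq: "c ^ n * real_of_int q ^ (n - 1) = exp (- (n * d))"
  defines "G \<equiv> Pi\<^sub>E {1..<n} (\<lambda>_. {0..<q})"
  shows "(\<Sum>g\<in>G. lat_err n \<sigma> c (lat n q g) h) \<le> real (card G) *
    (measure (noise n \<sigma>) {z \<in> space (noise n \<sigma>). vnorm n z < r1 \<or> r2 < vnorm n z} + 1 / n + tailprob n \<sigma> ((\<Sum>i<n. ln (h i)) - n * d - ln (3 * real n)))"
proof -
  interpret N: prob_space "noise n \<sigma>" using \<sigma> by (rule prob_space_noise)
  have q0: "0 < q" using q by (rule prime_gt_0_int)
  have finG: "finite G" unfolding G_def by (intro finite_PiE) auto
  have cardG: "real (card G) = real_of_int q ^ (n - 1)" unfolding G_def using q0 by (simp add: card_PiE)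
  define t where "t = (\<Sum>i<n. ln (h i)) - n * d - ln (3 * real n)"
  define A where "A g = {z \<in> space (noise n \<sigma>). \<exists>x\<in>lat n q g. closer n c h x z}" for g
  define B where "B = {z \<in> space (noise n \<sigma>). vnorm n z < r1 \<or> r2 < vnorm n z}"
  define W where "W = {z \<in> space (noise n \<sigma>). t < lnvol n z}"
  have A: "A g \<in> sets (noise n \<sigma>)" for g unfolding A_def sets_noise space_noise by (intro closer_set_measurable countable_lat)
  have B: "B \<in> sets (noise n \<sigma>)" unfolding B_def sets_noise space_noise by measurable
  have W: "W \<in> sets (noise n \<sigma>)" unfolding W_def sets_noise space_noise by measurable
  have pt: "(\<Sum>g\<in>G. indicator (A g) z) \<le> real (card G) * (indicator B z + 1 / n + indicator W z)" if z: "z \<in> space (noise n \<sigma>)" for z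
  proof (cases "z \<in> B \<or> z \<in> W")
    case True
    have "(\<Sum>g\<in>G. indicator (A g) z) \<le> (\<Sum>g\<in>G. 1 :: real)" by (intro sum_mono) (auto simp: indicator_def)
    also have "\<dots> = real (card G) * 1" by simp
    also have "\<dots> \<le> real (card G) * (indicator B z + 1 / n + indicator W z)"
      using True by (intro mult_left_mono) (auto simp: indicator_def)
    finally show ?thesis .
  next
    case False
    then have z': "r1 \<le> vnorm n z" "vnorm n z \<le> r2" "lnvol n z \<le> t" using z by (auto simp: B_def W_def not_less)
    define X where "X = {x. (\<forall>i\<ge>n. x i = 0) \<and> closer n c h x z}"
    have nz: "0 < vnorm n z" "n * (c * vnorm n h) \<le> vnorm n z" using r z' by auto
    have "finite X" "real (card X) * (c ^ n * (\<Prod>i<n. h i)) \<le> 3 * exp (lnvol n z)"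
      unfolding X_def using card_closer[of n c h z] n c h nz by auto
    note X = this
    define p where "p g = (SOME x. x \<in> lat n q g \<and> closer n c h x z)" for g
    define G' where "G' = {g \<in> G. z \<in> A g}"
    have p: "p g \<in> lat n q g \<and> closer n c h (p g) z" if "g \<in> G'" for g
    proof -
      have "\<exists>x. x \<in> lat n q g \<and> closer n c h x z" using that by (auto simp: G'_def A_def)
      then show ?thesis unfolding p_def by (rule someI_ex)
    qed
    have nd: "\<not> q dvd p g 0" if "g \<in> G'" for g
    proof -
      have "2 * vnorm n z < c * q * h i" if "i < n" for i using r(3)[OF that] z'(2) by linarith
      then show ?thesis using closer_not_dvd[of c n h q z "p g" g] c h q0 p[OF that] by blast
    qed
    have "inj_on p G'"
    proof (rule inj_onI)
      fix g g' assume g: "g \<in> G'" "g' \<in> G'" "p g = p g'"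
      show "g = g'"
        using lat_unique[of q "p g" g n g'] q nd[OF g(1)] g p[OF g(1)] p[OF g(2)] unfolding G'_def G_def by simp
    qed
    moreover have "p ` G' \<subseteq> X" using p by (auto simp: X_def lat_def)
    ultimately have "card G' \<le> card X" using X(1) by (intro card_inj_on_le) auto
    moreover have "real (card X) \<le> real (card G) / n"
    proof -
      have Ph: "0 < (\<Prod>i<n. h i)" using h by (intro prod_pos) auto
      have "exp (lnvol n z) \<le> exp t" using z' by simp
      also have "exp t = (\<Prod>i<n. h i) * exp (- (n * d)) / (3 * n)"
        unfolding t_def exp_diff using n h by (simp add: exp_sum exp_minus field_simps)
      finally have "3 * exp (lnvol n z) \<le> (\<Prod>i<n. h i) * exp (- (n * d)) / n" using n by (simp add: field_simps)
      then have "real (card X) * (c ^ n * (\<Prod>i<n. h i)) \<le> (\<Prod>i<n. h i) * (c ^ n * real_of_int q ^ (n - 1)) / n"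
        using X(2) unfolding cq by linarith
      also have "\<dots> = (real (card G) / n) * (c ^ n * (\<Prod>i<n. h i))" unfolding cardG by (simp add: mult_ac)
      finally show ?thesis using c Ph by (simp only: mult_le_cancel_right_pos mult_pos_pos zero_less_power)
    qed
    moreover have "(\<Sum>g\<in>G. indicator (A g) z) = real (card G')"
      using finG unfolding G'_def by (simp add: indicator_def sum.If_cases Int_def)
    moreover have "indicator B z = (0::real)" "indicator W z = (0::real)" using False by auto
    ultimately show ?thesis by (simp only: add_0_left add_0_right of_nat_le_iff) simp
  qed
  have ii: "integrable (noise n \<sigma>) (\<lambda>z. indicator E z :: real)" if "E \<in> sets (noise n \<sigma>)" for E
    using that by (intro integrable_real_indicator) (auto simp: N.emeasure_eq_measure)
  have "(\<Sum>g\<in>G. lat_err n \<sigma> c (lat n q g) h) = (\<Sum>g\<in>G. (\<integral>z. indicator (A g) z \<partial>noise n \<sigma>))"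
    using A by (simp add: lat_err_def A_def)
  also have "\<dots> = (\<integral>z. (\<Sum>g\<in>G. indicator (A g) z) \<partial>noise n \<sigma>)"
    by (intro Bochner_Integration.integral_sum[symmetric] ii A)
  also have "\<dots> \<le> (\<integral>z. real (card G) * (indicator B z + 1 / n + indicator W z) \<partial>noise n \<sigma>)"
    by (intro integral_mono Bochner_Integration.integrable_sum integrable_mult_right Bochner_Integration.integrable_add ii A B W pt) auto
  also have "\<dots> = real (card G) * (\<integral>z. indicator B z + 1 / n + indicator W z \<partial>noise n \<sigma>)" by simp
  also have "(\<integral>z. indicator B z + 1 / n + indicator W z \<partial>noise n \<sigma>) = N.prob B + 1 / n + N.prob W"
    using ii[OF B] ii[OF W] B W by (simp add: N.prob_space)
  finally show ?thesis unfolding B_def W_def tailprob_def t_def .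
qed

text \<open>The error event is a countable union of sets measurable jointly in fading and noise, so
  its sections have measurable probability. This justifies exchanging the sum over the generators
  with the fading expectation.\<close>

lemma lat_err_measurable:
  assumes \<Lambda>: "countable \<Lambda>" and \<sigma>: "0 < \<sigma>" and H: "\<And>i. H i \<in> borel_measurable M"
  shows "(\<lambda>\<omega>. lat_err n \<sigma> c \<Lambda> (\<lambda>i. H i \<omega>)) \<in> borel_measurable M"
proof -
  interpret N: prob_space "noise n \<sigma>" using \<sigma> by (rule prob_space_noise)
  define Q where "Q = {p \<in> space (M \<Otimes>\<^sub>M noise n \<sigma>). \<exists>x\<in>\<Lambda>. closer n c (\<lambda>i. H i (fst p)) x (snd p)}"
  have H1: "(\<lambda>p. H i (fst p)) \<in> borel_measurable (M \<Otimes>\<^sub>M noise n \<sigma>)" for i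
    by (rule measurable_compose[OF measurable_fst H])
  have z1: "(\<lambda>p. snd p i) \<in> borel_measurable (M \<Otimes>\<^sub>M noise n \<sigma>)" if "i < n" for i
  proof -
    have "(\<lambda>z. z i) \<in> borel_measurable (noise n \<sigma>)"
      using measurable_vol_component[OF that] measurable_cong_sets[OF sets_noise refl] by blast
    then show ?thesis by (rule measurable_compose[OF measurable_snd])
  qed
  have "Q = (\<Union>x\<in>\<Lambda>. {p \<in> space (M \<Otimes>\<^sub>M noise n \<sigma>). closer n c (\<lambda>i. H i (fst p)) x (snd p)})" by (auto simp: Q_def)
  moreover have "{p \<in> space (M \<Otimes>\<^sub>M noise n \<sigma>). closer n c (\<lambda>i. H i (fst p)) x (snd p)} \<in> sets (M \<Otimes>\<^sub>M noise n \<sigma>)" for x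
    unfolding closer_def
    by (intro borel_measurable_less borel_measurable_sum borel_measurable_power borel_measurable_diff borel_measurable_times H1 z1) auto
  ultimately have "Q \<in> sets (M \<Otimes>\<^sub>M noise n \<sigma>)" using \<Lambda> by (auto intro!: sets.countable_UN')
  then have "(\<lambda>\<omega>. emeasure (noise n \<sigma>) (Pair \<omega> -` Q)) \<in> borel_measurable M"
    by (rule N.measurable_emeasure_Pair)
  then have "(\<lambda>\<omega>. enn2real (emeasure (noise n \<sigma>) (Pair \<omega> -` Q))) \<in> borel_measurable M" by measurable
  moreover have "enn2real (emeasure (noise n \<sigma>) (Pair \<omega> -` Q)) = lat_err n \<sigma> c \<Lambda> (\<lambda>i. H i \<omega>)" if "\<omega> \<in> space M" for \<omega>
    using that by (auto simp: lat_err_def measure_def Q_def space_pair_measure intro!: arg_cong[where f = "\<lambda>E. enn2real (emeasure _ E)"])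
  ultimately show ?thesis by (subst measurable_cong[symmetric]) auto
qed

lemma tailprob_measurable[measurable]:
  assumes \<sigma>: "0 < \<sigma>" shows "tailprob n \<sigma> \<in> borel_measurable borel"
proof -
  interpret N: prob_space "noise n \<sigma>" using \<sigma> by (rule prob_space_noise)
  have "mono (\<lambda>t. - tailprob n \<sigma> t)"
  proof (rule monoI)
    fix s t :: real assume "s \<le> t"
    moreover have "{z \<in> space (noise n \<sigma>). s < lnvol n z} \<in> sets (noise n \<sigma>)" unfolding sets_noise space_noise by measurable
    ultimately have "tailprob n \<sigma> t \<le> tailprob n \<sigma> s" unfolding tailprob_def by (intro N.finite_measure_mono) auto
    then show "- tailprob n \<sigma> s \<le> - tailprob n \<sigma> t" by simp
  qed
  then have "(\<lambda>t. - (- tailprob n \<sigma> t)) \<in> borel_measurable borel" by (intro borel_measurable_uminus borel_measurable_mono)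
  then show ?thesis by simp
qed

section \<open>Typical noise and fading, and the choice of the modulus\<close>

lemma (in finite_measure) decseq_measure_small:
  assumes "\<And>k. A k \<in> sets M" "decseq A" "measure M (\<Inter>k. A k) = 0" "0 < e"
  shows "\<exists>k::nat. measure M (A k) \<le> e"
proof -
  have "(\<lambda>k. measure M (A k)) \<longlonglongrightarrow> 0"
    using finite_Lim_measure_decseq[of A] assms by auto
  then have "\<forall>\<^sub>F k in sequentially. measure M (A k) < e" using assms(4) by (auto dest: order_tendstoD)
  then show ?thesis by (auto simp: eventually_sequentially intro: less_imp_le)
qed

lemma inverse_Suc_antimono: "k \<le> k' \<Longrightarrow> 1 / (real k' + 1) \<le> 1 / (real k + 1)"
  by (intro divide_left_mono) auto

lemma all_less_inverse: assumes "\<And>k::nat. x < 1 / (real k + 1)" shows "x \<le> 0"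
proof (rule ccontr)
  assume "\<not> x \<le> 0"
  then obtain k where "1 / (real k + 1) < x" using reals_Archimedean[of x] by (auto simp: inverse_eq_divide add.commute)
  then show False using assms[of k] by simp
qed

text \<open>The lower bound on the noise makes a lattice spacing small in comparison possible; the
  upper bound keeps the points of q Z^n out of reach.\<close>

lemma noise_typical:
  assumes n: "1 \<le> n" and \<sigma>: "0 < \<sigma>" and e: "0 < e"
  shows "\<exists>r1 r2. 0 < r1 \<and> measure (noise n \<sigma>) {z \<in> space (noise n \<sigma>). vnorm n z < r1 \<or> r2 < vnorm n z} \<le> e"
proof -
  interpret N: prob_space "noise n \<sigma>" using \<sigma> by (rule prob_space_noise)
  define A where "A k = {z \<in> space (noise n \<sigma>). vnorm n z < 1 / (real k + 1) \<or> real k < vnorm n z}" for k :: nat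
  have "\<exists>k. N.prob (A k) \<le> e"
  proof (rule N.decseq_measure_small[OF _ _ _ e])
    show "A k \<in> sets (noise n \<sigma>)" for k unfolding A_def sets_noise space_noise by measurable
    show "decseq A"
    proof (rule decseq_SucI, rule subsetI)
      fix k z assume "z \<in> A (Suc k)"
      then show "z \<in> A k" using inverse_Suc_antimono[of k "Suc k"] by (auto simp: A_def)
    qed
    have sub: "(\<Inter>k. A k) \<subseteq> {z \<in> space (vol n). \<not> 0 < vnorm n z}"
    proof
      fix z assume z: "z \<in> (\<Inter>k. A k)"
      obtain k where k: "vnorm n z < real k" using reals_Archimedean2 by blast
      have "vnorm n z < 1 / (real j + 1)" for j
      proof -
        have "z \<in> A (max j k)" using z by blast
        then have "vnorm n z < 1 / (real (max j k) + 1)" using k by (auto simp: A_def)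
        then show ?thesis using inverse_Suc_antimono[of j "max j k"] by simp
      qed
      then show "z \<in> {z \<in> space (vol n). \<not> 0 < vnorm n z}" using all_less_inverse[of "vnorm n z"] z by (auto simp: A_def space_noise)
    qed
    have "AE z in noise n \<sigma>. 0 < vnorm n z"
      unfolding noise_eq_density[OF \<sigma>] using AE_vnorm_pos[OF n] by (subst AE_density) auto
    moreover have ps: "{z \<in> space (noise n \<sigma>). 0 < vnorm n z} \<in> sets (noise n \<sigma>)" unfolding sets_noise space_noise by measurable
    ultimately have "N.prob {z \<in> space (noise n \<sigma>). 0 < vnorm n z} = 1" by (subst N.prob_Collect_eq_1) auto
    then have z0: "N.prob (space (noise n \<sigma>) - {z \<in> space (noise n \<sigma>). 0 < vnorm n z}) = 0"
      using N.prob_compl[of "{z \<in> space (noise n \<sigma>). 0 < vnorm n z}"] ps by simp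
    have "N.prob (\<Inter>k. A k) \<le> N.prob (space (noise n \<sigma>) - {z \<in> space (noise n \<sigma>). 0 < vnorm n z})"
      by (intro N.finite_measure_mono sets.compl_sets ps) (use sub in \<open>auto simp: space_noise\<close>)
    then show "N.prob (\<Inter>k. A k) = 0" using z0 measure_nonneg[of "noise n \<sigma>"] by (simp add: order_antisym)
  qed
  then obtain k where "N.prob (A k) \<le> e" ..
  then show ?thesis unfolding A_def by (intro exI[of _ "1 / (real k + 1)"] exI[of _ "real k"]) auto
qed

text \<open>Spacing and modulus may not depend on the fading state, so the fading is confined to a
  bounded region away from 0, up to a small probability.\<close>

lemma fading_typical:
  assumes M: "prob_space M" and H: "\<And>i. H i \<in> borel_measurable M" and pos: "AE \<omega> in M. \<forall>i<n. 0 < H i \<omega>" and e: "0 < e"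
  shows "\<exists>h1 h2. 0 < h1 \<and> {\<omega> \<in> space M. (\<exists>i<n. H i \<omega> < h1) \<or> h2 < vnorm n (\<lambda>i. H i \<omega>)} \<in> sets M \<and>
    measure M {\<omega> \<in> space M. (\<exists>i<n. H i \<omega> < h1) \<or> h2 < vnorm n (\<lambda>i. H i \<omega>)} \<le> e"
proof -
  interpret prob_space M by fact
  define A where "A k = {\<omega> \<in> space M. (\<exists>i<n. H i \<omega> < 1 / (real k + 1)) \<or> real k < vnorm n (\<lambda>i. H i \<omega>)}" for k :: nat
  have [measurable]: "(\<lambda>\<omega>. vnorm n (\<lambda>i. H i \<omega>)) \<in> borel_measurable M" unfolding vnorm_def using H by measurable
  note [measurable] = H
  have A: "A k \<in> sets M" for k
  proof -
    have "A k = (\<Union>i\<in>{..<n}. {\<omega> \<in> space M. H i \<omega> < 1 / (real k + 1)}) \<union> {\<omega> \<in> space M. real k < vnorm n (\<lambda>i. H i \<omega>)}"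
      by (auto simp: A_def)
    also have "\<dots> \<in> sets M" by (intro sets.Un sets.finite_UN) measurable
    finally show ?thesis .
  qed
  have "\<exists>k. prob (A k) \<le> e"
  proof (rule decseq_measure_small[OF A _ _ e])
    show "decseq A"
    proof (rule decseq_SucI, rule subsetI)
      fix k z assume "z \<in> A (Suc k)"
      then show "z \<in> A k" using inverse_Suc_antimono[of k "Suc k"] by (auto simp: A_def)
    qed
    have "AE \<omega> in M. \<omega> \<notin> (\<Inter>k. A k)"
      using pos
    proof eventually_elim
      case (elim \<omega>)
      define m where "m = Min (insert 1 ((\<lambda>i. H i \<omega>) ` {..<n}))"
      have m: "0 < m" "\<And>i. i < n \<Longrightarrow> m \<le> H i \<omega>" using elim by (auto simp: m_def)
      obtain k where k: "1 / (real k + 1) < m" using reals_Archimedean[OF m(1)] by (auto simp: inverse_eq_divide add.commute)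
      obtain j where j: "vnorm n (\<lambda>i. H i \<omega>) < real j" using reals_Archimedean2 by blast
      have "\<omega> \<notin> A (max j k)"
      proof
        assume "\<omega> \<in> A (max j k)"
        moreover have "\<not> real (max j k) < vnorm n (\<lambda>i. H i \<omega>)" using j by simp
        ultimately obtain i where "i < n" "H i \<omega> < 1 / (real (max j k) + 1)" by (auto simp: A_def)
        moreover have "1 / (real (max j k) + 1) \<le> 1 / (real k + 1)" by (rule inverse_Suc_antimono) simp
        ultimately show False using m(2)[of i] k by linarith
      qed
      then show ?case by blast
    qed
    then show "prob (\<Inter>k. A k) = 0" using A by (intro measure_eq_0_null_sets) (auto simp: AE_iff_null_sets)
  qed
  then obtain k where "prob (A k) \<le> e" ..
  then show ?thesis using A[of k] unfolding A_def by (intro exI[of _ "1 / (real k + 1)"] exI[of _ "real k"]) auto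
qed

text \<open>The density exp (n d) forces c = exp (- d) q^(- (n - 1) / n). Along large primes the
  spacing c tends to 0 while c q = exp (- d) q^(1/n) tends to infinity; the first needs n >=
  2.\<close>

lemma exists_prime_scale:
  fixes d a b :: real
  assumes n: "2 \<le> n" and a: "0 < a"
  shows "\<exists>q::int. prime q \<and> exp (- d) * real_of_int q powr (- ((real n - 1) / n)) \<le> a \<and> b < exp (- d) * real_of_int q powr (1 / n)"
proof -
  have "((\<lambda>x::real. exp (- d) * x powr (- ((real n - 1) / n))) \<longlongrightarrow> exp (- d) * 0) at_top"
    by (intro tendsto_mult tendsto_const tendsto_neg_powr filterlim_ident) (use n in auto)
  then have 1: "\<forall>\<^sub>F x in at_top. exp (- d) * x powr (- ((real n - 1) / n)) < a" using a by (auto dest: order_tendstoD)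
  define B where "B = max 1 (exp d * b)"
  have 2: "\<forall>\<^sub>F x in at_top. b < exp (- d) * x powr (1 / n)"
    using eventually_gt_at_top[of "B ^ n"]
  proof eventually_elim
    case (elim x)
    have B: "0 < B" by (simp add: B_def)
    have "B = (B ^ n) powr (1 / n)" using B n by (simp add: powr_realpow[symmetric] powr_powr)
    also have "\<dots> < x powr (1 / n)" using elim B n by (intro powr_less_mono2) auto
    finally have "exp d * b < x powr (1 / n)" by (simp add: B_def)
    then have "exp (- d) * (exp d * b) < exp (- d) * x powr (1 / n)" by simp
    then show ?case by (simp add: mult.assoc[symmetric] exp_minus)
  qed
  obtain Q where Q: "\<And>x. Q \<le> x \<Longrightarrow> exp (- d) * x powr (- ((real n - 1) / n)) < a \<and> b < exp (- d) * x powr (1 / n)"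
    using eventually_conj[OF 1 2] by (auto simp: eventually_at_top_linorder)
  obtain p where p: "prime (p::nat)" "nat \<lceil>Q\<rceil> < p" using bigger_prime by blast
  have "Q \<le> real p" using p(2) by linarith
  then have Qp: "exp (- d) * real p powr (- ((real n - 1) / n)) < a" "b < exp (- d) * real p powr (1 / n)" using Q by auto
  show ?thesis
  proof (intro exI conjI)
    show "prime (int p)" using p(1) by (simp only: prime_nat_int_transfer)
    show "exp (- d) * real_of_int (int p) powr (- ((real n - 1) / n)) \<le> a" "b < exp (- d) * real_of_int (int p) powr (1 / n)"
      using Qp by (simp_all only: of_int_of_nat_eq less_imp_le)
  qed
qed

text \<open>The error is averaged over the generators for each fading state first and over the
  fading afterwards, so the best generator is a single choice made without knowledge of the
  fading.\<close>

lemma achievability: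
  assumes M: "prob_space M" and H: "\<And>i. H i \<in> borel_measurable M" and pos: "AE \<omega> in M. \<forall>i<n. 0 < H i \<omega>"
    and n: "2 \<le> n" and \<sigma>: "0 < \<sigma>"
  shows "\<exists>S. is_IC n S \<and> (\<forall>a. finite (S \<inter> Cb n a)) \<and> ereal d \<le> NLD n S \<and>
    avg_err M H n \<sigma> S \<le> ennreal (2 / n) + (\<integral>\<^sup>+\<omega>. ennreal (tailprob n \<sigma> ((\<Sum>i<n. lnH H i \<omega>) - n * d - ln (3 * real n))) \<partial>M)"
proof -
  interpret prob_space M by fact
  interpret N: prob_space "noise n \<sigma>" using \<sigma> by (rule prob_space_noise)
  have n1: "1 \<le> n" using n by simp
  \<comment> \<open>Atypical noise and atypical fading may each cost 1 / (2 n); with the 1 / n of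
    \<open>lat_avg\<close> this makes 2 / n.\<close>
  define e where "e = 1 / (2 * real n)"
  have e: "0 < e" using n by (simp add: e_def)
  obtain r1 r2 where r: "0 < r1" "measure (noise n \<sigma>) {z \<in> space (noise n \<sigma>). vnorm n z < r1 \<or> r2 < vnorm n z} \<le> e"
    using noise_typical[OF n1 \<sigma> e] by blast
  define Bad where "Bad h1 h2 = {\<omega> \<in> space M. (\<exists>i<n. H i \<omega> < h1) \<or> h2 < vnorm n (\<lambda>i. H i \<omega>)}" for h1 h2
  obtain h1 h2 where h: "0 < h1" "Bad h1 h2 \<in> sets M" "prob (Bad h1 h2) \<le> e"
    using fading_typical[OF M H pos e] unfolding Bad_def by blast
  \<comment> \<open>The maximum with 1 makes the bound positive, so that it may divide.\<close>
  define h2' where "h2' = max 1 h2"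
  obtain q :: int where q: "prime q" "exp (- d) * real_of_int q powr (- ((real n - 1) / n)) \<le> r1 / (n * h2')"
    "2 * r2 / h1 < exp (- d) * real_of_int q powr (1 / n)"
    using exists_prime_scale[OF n, of "r1 / (n * h2')" d "2 * r2 / h1"] r(1) n by (auto simp: h2'_def)
  have q0: "0 < q" using q(1) by (rule prime_gt_0_int)
  define c where "c = exp (- d) * real_of_int q powr (- ((real n - 1) / n))"
  have c: "0 < c" unfolding c_def using q0 by simp
  have cr: "n * (c * h2') \<le> r1"
    using q(2) n unfolding c_def[symmetric] by (simp add: h2'_def field_simps)
  have cq1: "2 * r2 < c * q * h1"
  proof -
    have "c * q = exp (- d) * (real_of_int q powr (- ((real n - 1) / n)) * real_of_int q powr 1)" using q0 by (simp add: c_def)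
    also have "real_of_int q powr (- ((real n - 1) / n)) * real_of_int q powr 1 = real_of_int q powr (1 / n)"
      unfolding powr_add[symmetric] using n by (simp add: field_simps)
    finally show ?thesis using q(3) h(1) by (simp add: field_simps)
  qed
  have cq: "c ^ n * real_of_int q ^ (n - 1) = exp (- (n * d))"
  proof -
    have "c ^ n = exp (- d) ^ n * (real_of_int q powr (- ((real n - 1) / n))) ^ n" by (simp add: c_def power_mult_distrib)
    also have "exp (- d) ^ n = exp (- (n * d))" by (simp add: exp_of_nat_mult[symmetric])
    also have "(real_of_int q powr (- ((real n - 1) / n))) ^ n = real_of_int q powr (- (real n - 1))"
      using q0 n by (simp add: powr_realpow[symmetric] powr_powr)
    also have "real_of_int q powr (- (real n - 1)) = 1 / real_of_int q ^ (n - 1)"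
    proof -
      have "real_of_int q powr (- (real n - 1)) = inverse (real_of_int q powr (real n - 1))" by (rule powr_minus)
      also have "real_of_int q powr (real n - 1) = real_of_int q powr (real (n - 1))" using n by (simp add: of_nat_diff)
      also have "\<dots> = real_of_int q ^ (n - 1)" using q0 by (intro powr_realpow) simp
      finally show ?thesis by (simp add: inverse_eq_divide)
    qed
    finally have e: "c ^ n = exp (- (n * d)) * (1 / real_of_int q ^ (n - 1))" .
    show ?thesis unfolding e using q0 by simp
  qed
  define G where "G = Pi\<^sub>E {1..<n} (\<lambda>_. {0..<q})"
  have finG: "finite G" unfolding G_def by (intro finite_PiE) auto
  have "(\<lambda>i\<in>{1..<n}. 0) \<in> G" using q0 by (auto simp: G_def)
  then have G0: "0 < card G" "G \<noteq> {}" using finG by (auto simp: card_gt_0_iff)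
  define S where "S g = scaled c ` lat n q g" for g
  define t where "t \<omega> = (\<Sum>i<n. lnH H i \<omega>) - n * d - ln (3 * real n)" for \<omega>
  define E where "E g \<omega> = lat_err n \<sigma> c (lat n q g) (\<lambda>i. H i \<omega>)" for g \<omega>
  note [measurable] = H tailprob_measurable[OF \<sigma>]
  have t_meas[measurable]: "t \<in> borel_measurable M" unfolding t_def lnH_def by measurable
  have E_meas: "E g \<in> borel_measurable M" for g
    unfolding E_def by (rule lat_err_measurable[OF countable_lat \<sigma> H])
  have E1: "0 \<le> E g \<omega>" "E g \<omega> \<le> 1" for g \<omega> by (auto simp: E_def lat_err_def)
  have avgE: "avg_err M H n \<sigma> (S g) = (\<integral>\<^sup>+\<omega>. ennreal (E g \<omega>) \<partial>M)" for g
    unfolding avg_err_def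
  proof (rule nn_integral_cong_AE, use pos in eventually_elim)
    case (elim \<omega>)
    then show ?case unfolding S_def E_def by (subst avg_err_given_lat[OF n1 c]) auto
  qed
  have pt: "(\<Sum>g\<in>G. E g \<omega>) \<le> real (card G) * (indicator (Bad h1 h2) \<omega> + (e + 1 / n) + tailprob n \<sigma> (t \<omega>))" if \<omega>: "\<omega> \<in> space M" for \<omega>
  proof (cases "\<omega> \<in> Bad h1 h2")
    case True
    have "(\<Sum>g\<in>G. E g \<omega>) \<le> (\<Sum>g\<in>G. 1)" using E1 by (intro sum_mono)
    also have "\<dots> = real (card G) * 1" by simp
    also have "\<dots> \<le> real (card G) * (indicator (Bad h1 h2) \<omega> + (e + 1 / n) + tailprob n \<sigma> (t \<omega>))"
      using True e tailprob_bounds[OF \<sigma>] by (intro mult_left_mono) auto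
    finally show ?thesis .
  next
    case False
    then have nb: "\<not> ((\<exists>i<n. H i \<omega> < h1) \<or> h2 < vnorm n (\<lambda>i. H i \<omega>))" using \<omega> unfolding Bad_def by blast
    then have hh: "\<And>i. i < n \<Longrightarrow> h1 \<le> H i \<omega>" "vnorm n (\<lambda>i. H i \<omega>) \<le> h2'"
      using not_less by (blast, auto simp: h2'_def)
    then have hp: "\<And>i. i < n \<Longrightarrow> 0 < H i \<omega>" using h(1) by force
    have te: "t \<omega> = (\<Sum>i<n. ln (H i \<omega>)) - n * d - ln (3 * real n)"
      unfolding t_def using hp by (auto simp: lnH_def ln_realpow intro!: sum.cong)
    have "real n * (c * vnorm n (\<lambda>i. H i \<omega>)) \<le> n * (c * h2')" using hh c by (intro mult_left_mono) auto
    then have a1: "real n * (c * vnorm n (\<lambda>i. H i \<omega>)) \<le> r1" using cr by linarith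
    have a2: "2 * r2 < c * q * H i \<omega>" if "i < n" for i
    proof -
      have "c * q * h1 \<le> c * q * H i \<omega>" using hh(1)[OF that] c q0 by (intro mult_left_mono) auto
      then show ?thesis using cq1 by linarith
    qed
    have "(\<Sum>g\<in>G. E g \<omega>) \<le> real (card G) * (measure (noise n \<sigma>) {z \<in> space (noise n \<sigma>). vnorm n z < r1 \<or> r2 < vnorm n z} + 1 / n + tailprob n \<sigma> (t \<omega>))"
      unfolding E_def G_def te by (rule lat_avg[OF n1 c q(1) \<sigma> hp r(1) a1 a2 cq])
    also have "\<dots> \<le> real (card G) * (indicator (Bad h1 h2) \<omega> + (e + 1 / n) + tailprob n \<sigma> (t \<omega>))"
      using r(2) by (intro mult_left_mono add_mono add_increasing) auto
    finally show ?thesis .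
  qed
  define I where "I = (\<integral>\<^sup>+\<omega>. ennreal (tailprob n \<sigma> (t \<omega>)) \<partial>M)"
  have en0: "0 \<le> e + 1 / n" using e by simp
  have "(\<Sum>g\<in>G. avg_err M H n \<sigma> (S g)) = (\<integral>\<^sup>+\<omega>. (\<Sum>g\<in>G. ennreal (E g \<omega>)) \<partial>M)"
    unfolding avgE using E_meas by (intro nn_integral_sum[symmetric]) auto
  also have "\<dots> \<le> (\<integral>\<^sup>+\<omega>. of_nat (card G) * (indicator (Bad h1 h2) \<omega> + ennreal (e + 1 / n) + ennreal (tailprob n \<sigma> (t \<omega>))) \<partial>M)"
  proof (rule nn_integral_mono)
    fix \<omega> assume \<omega>: "\<omega> \<in> space M"
    have "(\<Sum>g\<in>G. ennreal (E g \<omega>)) = ennreal (\<Sum>g\<in>G. E g \<omega>)" using E1 by (intro sum_ennreal)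
    also have "\<dots> \<le> ennreal (real (card G) * (indicator (Bad h1 h2) \<omega> + (e + 1 / n) + tailprob n \<sigma> (t \<omega>)))"
      by (intro ennreal_leI pt[OF \<omega>])
    also have "\<dots> = of_nat (card G) * (indicator (Bad h1 h2) \<omega> + ennreal (e + 1 / n) + ennreal (tailprob n \<sigma> (t \<omega>)))"
      using tailprob_bounds[OF \<sigma>] en0
      by (subst ennreal_mult) (auto simp: ennreal_plus ennreal_indicator ennreal_of_nat_eq_real_of_nat intro!: add_nonneg_nonneg)
    finally show "(\<Sum>g\<in>G. ennreal (E g \<omega>)) \<le> of_nat (card G) * (indicator (Bad h1 h2) \<omega> + ennreal (e + 1 / n) + ennreal (tailprob n \<sigma> (t \<omega>)))" .
  qed
  also have "\<dots> = of_nat (card G) * (emeasure M (Bad h1 h2) + ennreal (e + 1 / n) + I)"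
    using h(2) by (simp add: nn_integral_cmult nn_integral_add I_def emeasure_space_1)
  also have "\<dots> \<le> of_nat (card G) * (ennreal (2 / n) + I)"
  proof (intro mult_left_mono add_right_mono)
    have "emeasure M (Bad h1 h2) + ennreal (e + 1 / n) = ennreal (prob (Bad h1 h2) + (e + 1 / n))"
      using en0 by (simp add: emeasure_eq_measure ennreal_plus[symmetric] del: ennreal_plus)
    also have "\<dots> \<le> ennreal (2 / n)" using h(3) n by (intro ennreal_leI) (simp add: e_def field_simps)
    finally show "emeasure M (Bad h1 h2) + ennreal (e + 1 / n) \<le> ennreal (2 / n)" .
  qed simp
  finally have tot: "(\<Sum>g\<in>G. avg_err M H n \<sigma> (S g)) \<le> of_nat (card G) * (ennreal (2 / n) + I)" .
  \<comment> \<open>The smallest of finitely many error probabilities is at most their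
    average.\<close>
  define a where "a = Min ((\<lambda>g. avg_err M H n \<sigma> (S g)) ` G)"
  have "a \<in> (\<lambda>g. avg_err M H n \<sigma> (S g)) ` G" unfolding a_def using finG G0 by (intro Min_in) auto
  then obtain g where g: "g \<in> G" "avg_err M H n \<sigma> (S g) = a" by auto
  have "of_nat (card G) * a = (\<Sum>g\<in>G. a)" by simp
  also have "\<dots> \<le> (\<Sum>g\<in>G. avg_err M H n \<sigma> (S g))" unfolding a_def using finG by (intro sum_mono Min_le) auto
  finally have "of_nat (card G) * a \<le> of_nat (card G) * (ennreal (2 / n) + I)" using tot by simp
  then have "a \<le> ennreal (2 / n) + I" using G0 by (subst (asm) ennreal_mult_le_mult_iff) auto
  moreover have "ereal d \<le> NLD n (S g)"
  proof (rule le_NLD[OF n1])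
    have "1 / (c ^ n * real_of_int q ^ (n - 1)) = exp (n * d)" unfolding cq by (simp add: exp_minus inverse_eq_divide)
    then show "ereal (exp (n * d)) \<le> IC_density n (S g)" using lat_density[OF n1 c q0, of g] by (simp add: S_def)
  qed
  ultimately show ?thesis
    using is_IC_lat[of n c q g] finite_lat_Cb[OF c, of n q g] g(2) unfolding I_def t_def
    by (intro exI[of _ "S g"]) (auto simp: S_def)
qed

section \<open>The Gaussian tail function and its inverse\<close>

lemma Qfun_eq: "Qfun x = 1 - cdf (density lborel phi) x"
proof -
  interpret prob_space "density lborel phi" by (rule prob_space_normal_density) simp
  have "{x<..} = space (density lborel phi) - {..x}" by auto
  then show ?thesis unfolding Qfun_def cdf_def using prob_compl[of "{..x}"] by simp
qed

lemma Qfun_strict_antimono: assumes "x < y" shows "Qfun y < Qfun x"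
  by (rule DERIV_neg_imp_decreasing[OF assms]) (use Qfun_deriv normal_density_pos[of 1 0] in fastforce)

text \<open>\<open>Qinv\<close> is a definite description: existence comes from the limits at both
  ends and the intermediate value theorem, uniqueness from strict monotonicity.\<close>

lemma Qfun_Qinv: assumes "0 < \<epsilon>" "\<epsilon> < 1" shows "Qfun (Qinv \<epsilon>) = \<epsilon>"
proof -
  interpret real_distribution "density lborel phi"
    by (intro real_distribution.intro real_distribution_axioms.intro prob_space_normal_density) auto
  have top: "(Qfun \<longlongrightarrow> 1 - 1) at_top" unfolding Qfun_eq[abs_def] by (intro tendsto_diff tendsto_const cdf_lim_at_top_prob)
  have bot: "(Qfun \<longlongrightarrow> 1 - 0) at_bot" unfolding Qfun_eq[abs_def] by (intro tendsto_diff tendsto_const cdf_lim_at_bot)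
  obtain b where b: "Qfun b < \<epsilon>"
    using order_tendstoD(2)[OF top, of \<epsilon>] assms by (auto simp: eventually_at_top_linorder)
  obtain a where a: "\<epsilon> < Qfun a"
    using order_tendstoD(1)[OF bot, of \<epsilon>] assms by (auto simp: eventually_at_bot_linorder)
  have "a < b" using Qfun_strict_antimono[of b a] a b by (cases a b rule: linorder_cases) auto
  then have "\<exists>x. a \<le> x \<and> x \<le> b \<and> Qfun x = \<epsilon>"
    using a b DERIV_isCont[OF Qfun_deriv] by (intro IVT2) auto
  then obtain x where x: "Qfun x = \<epsilon>" by auto
  have u: "y = x" if "Qfun y = \<epsilon>" for y
    using that x Qfun_strict_antimono[of x y] Qfun_strict_antimono[of y x] by (cases x y rule: linorder_cases) auto
  have "Qinv \<epsilon> = x" unfolding Qinv_def by (rule the_equality) (fact x, rule u)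
  then show ?thesis using x by simp
qed

text \<open>Within distance 1 of \<open>x\<close> the slope is at least phi (|x| + 1) in modulus.
  This linear lower bound is what converts errors in probability into shifts of the
  argument.\<close>

lemma Qfun_slope:
  fixes x u :: real
  assumes u: "0 \<le> u" "u \<le> 1"
  defines "k \<equiv> phi (\<bar>x\<bar> + 1)"
  shows "Qfun x + k * u \<le> Qfun (x - u)" "Qfun (x + u) \<le> Qfun x - k * u"
proof -
  have k: "k \<le> phi y" if "\<bar>y\<bar> \<le> \<bar>x\<bar> + 1" for y
  proof -
    have "y^2 \<le> (\<bar>x\<bar> + 1)^2" using power_mono[OF that, of 2] by simp
    then show ?thesis unfolding k_def std_normal_density_def by (intro mult_left_mono) auto
  qed
  have *: "Qfun b + k * (b - a) \<le> Qfun a" if ab: "a \<le> b" "\<And>y. a \<le> y \<Longrightarrow> y \<le> b \<Longrightarrow> \<bar>y\<bar> \<le> \<bar>x\<bar> + 1" for a b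
  proof (cases "a = b")
    case False
    then have "\<exists>z. a < z \<and> z < b \<and> Qfun b - Qfun a = (b - a) * - phi z"
      using ab by (intro MVT2) (auto intro: Qfun_deriv)
    then obtain z where z: "a < z" "z < b" "Qfun b - Qfun a = (b - a) * - phi z" by auto
    have "(b - a) * k \<le> (b - a) * phi z" using k[of z] ab z by (intro mult_left_mono) auto
    then show ?thesis using z(3) by (simp add: algebra_simps)
  qed simp
  have b: "\<bar>y\<bar> \<le> \<bar>x\<bar> + 1" if "x - u \<le> y" "y \<le> x + u" for y using that u by linarith
  have "Qfun x + k * (x - (x - u)) \<le> Qfun (x - u)" by (rule *) (use u b in auto)
  then show "Qfun x + k * u \<le> Qfun (x - u)" by simp
  have "Qfun (x + u) + k * ((x + u) - x) \<le> Qfun x" by (rule *) (use u b in auto)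
  then show "Qfun (x + u) \<le> Qfun x - k * u" by simp
qed

section \<open>The fading process\<close>

text \<open>A real supremum bounds its elements only if the set is bounded above; here 1 is a
  bound.\<close>

lemma strong_mixing_le:
  assumes M: "prob_space M" and A: "A \<in> sigma_sets (space M) (past_gen M H k)" and B: "B \<in> sigma_sets (space M) (future_gen M H (k + n))"
  shows "\<bar>measure M (A \<inter> B) - measure M A * measure M B\<bar> \<le> strong_mixing_coeff M H n"
  unfolding strong_mixing_coeff_def
proof (rule cSup_upper)
  interpret prob_space M by fact
  show "bdd_above {\<bar>measure M (A \<inter> B) - measure M A * measure M B\<bar> | k A B.
      A \<in> sigma_sets (space M) (past_gen M H k) \<and> B \<in> sigma_sets (space M) (future_gen M H (k + n))}"
  proof (rule bdd_aboveI[of _ 1])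
    fix y assume "y \<in> {\<bar>measure M (A \<inter> B) - measure M A * measure M B\<bar> | k A B.
      A \<in> sigma_sets (space M) (past_gen M H k) \<and> B \<in> sigma_sets (space M) (future_gen M H (k + n))}"
    then obtain A B where y: "y = \<bar>prob (A \<inter> B) - prob A * prob B\<bar>" by auto
    have "0 \<le> prob A * prob B" "prob A * prob B \<le> 1" by (auto intro: mult_le_one)
    then show "y \<le> 1" unfolding y using measure_nonneg[of M "A \<inter> B"] prob_le_1[of "A \<inter> B"] unfolding abs_le_iff by linarith
  qed
qed (use A B in blast)

text \<open>Cauchy-Schwarz through the weighted arithmetic-geometric inequality. It makes the
  supremum that defines \<open>complete_regularity_coeff\<close> meaningful.\<close>

lemma corr_le_1:
  assumes M: "prob_space M" and f: "f \<in> borel_measurable M" "integrable M (\<lambda>x. (f x)^2)" "var M f > 0"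
    and g: "g \<in> borel_measurable M" "integrable M (\<lambda>x. (g x)^2)" "var M g > 0"
  shows "\<bar>correlation M f g\<bar> \<le> 1"
proof -
  interpret prob_space M by fact
  have fi: "integrable M f" "integrable M g"
    using f g by (auto intro: square_integrable_imp_integrable)
  define u where "u x = f x - expectation f" for x
  define w where "w x = g x - expectation g" for x
  have u2: "integrable M (\<lambda>x. (u x)^2)" and w2: "integrable M (\<lambda>x. (w x)^2)"
    unfolding u_def w_def power2_diff using f g fi by auto
  have um: "u \<in> borel_measurable M" "w \<in> borel_measurable M" unfolding u_def w_def using f g by auto
  define a where "a = sqrt (var M f)"
  define b where "b = sqrt (var M g)"
  have ab: "0 < a" "0 < b" "a^2 = var M f" "b^2 = var M g" using f g by (auto simp: a_def b_def)
  have v: "(\<integral>x. (u x)^2 \<partial>M) = a^2" "(\<integral>x. (w x)^2 \<partial>M) = b^2" unfolding ab by (auto simp: var_def u_def w_def)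
  have le: "\<bar>u x * w x\<bar> \<le> (b / a * (u x)^2 + a / b * (w x)^2) / 2" for x
  proof -
    have "0 \<le> (b * \<bar>u x\<bar> - a * \<bar>w x\<bar>)^2" by simp
    then have "2 * (a * b) * \<bar>u x * w x\<bar> \<le> b^2 * (u x)^2 + a^2 * (w x)^2"
      by (simp add: power2_diff power_mult_distrib abs_mult algebra_simps)
    then show ?thesis using ab(1,2) by (simp add: field_simps power2_eq_square)
  qed
  have i: "integrable M (\<lambda>x. (b / a * (u x)^2 + a / b * (w x)^2) / 2)" using u2 w2 by auto
  have uwm: "(\<lambda>x. u x * w x) \<in> borel_measurable M" using um by auto
  note uw = integral_dominated[OF i uwm le]
  have "(\<integral>x. (b / a * (u x)^2 + a / b * (w x)^2) / 2 \<partial>M) = a * b"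
  proof -
    have "(\<integral>x. (b / a * (u x)^2 + a / b * (w x)^2) / 2 \<partial>M) = (b / a * a^2 + a / b * b^2) / 2"
      using u2 w2 by (simp add: v)
    also have "\<dots> = a * b" using ab(1,2) by (simp add: field_simps power2_eq_square)
    finally show ?thesis .
  qed
  with uw(2) have 1: "\<bar>\<integral>x. u x * w x \<partial>M\<bar> \<le> a * b" by simp
  have "integrable M (\<lambda>x. u x * w x + expectation f * g x + expectation g * f x - expectation f * expectation g)"
    using uw(1) fi by auto
  then have fg: "integrable M (\<lambda>x. f x * g x)" by (simp add: u_def w_def algebra_simps)
  have "(\<integral>x. u x * w x \<partial>M) = (\<integral>x. f x * g x - expectation g * f x - expectation f * g x + expectation f * expectation g \<partial>M)"
    by (simp add: u_def w_def algebra_simps)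
  also have "\<dots> = expectation (\<lambda>x. f x * g x) - expectation f * expectation g"
    using fg fi by (simp add: prob_space)
  finally have "correlation M f g = (\<integral>x. u x * w x \<partial>M) / (a * b)"
    by (simp add: correlation_def a_def b_def real_sqrt_mult)
  then show ?thesis using 1 ab by (simp add: abs_divide abs_mult)
qed

lemma gen_sigma_subset:
  assumes "\<And>i. H i \<in> borel_measurable M"
  shows "sigma_sets (space M) (past_gen M H k) \<subseteq> sets M" "sigma_sets (space M) (future_gen M H k) \<subseteq> sets M"
proof -
  have "past_gen M H k \<subseteq> sets M" "future_gen M H k \<subseteq> sets M"
    using assms by (auto simp: past_gen_def future_gen_def intro: measurable_sets)
  then show "sigma_sets (space M) (past_gen M H k) \<subseteq> sets M" "sigma_sets (space M) (future_gen M H k) \<subseteq> sets M"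
    by (auto intro!: sets.sigma_sets_subset del: subsetI)
qed

text \<open>For indicators the covariance is the correlation times the standard deviations, whose
  product is at most 1. Events of probability 0 or 1 have no variance and are absent from the
  coefficient, but they are independent of everything.\<close>

lemma regularity_mixing_le:
  assumes M: "prob_space M" and H: "\<And>i. H i \<in> borel_measurable M"
    and A: "A \<in> sigma_sets (space M) (past_gen M H k)" and B: "B \<in> sigma_sets (space M) (future_gen M H (k + n))"
    and c: "complete_regularity_coeff M H n \<le> c" "0 \<le> c"
  shows "\<bar>measure M (A \<inter> B) - measure M A * measure M B\<bar> \<le> c"
proof -
  interpret prob_space M by fact
  have AM: "A \<in> sets M" "B \<in> sets M" using gen_sigma_subset[of H M, OF H] A B by auto
  have gp: "past_gen M H k \<subseteq> Pow (space M)" "future_gen M H k \<subseteq> Pow (space M)" for k by (auto simp: past_gen_def future_gen_def)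
  have vi: "var M (indicator E) = prob E * (1 - prob E)" if E: "E \<in> sets M" for E
  proof -
    have ii: "integrable M (indicator E :: _ \<Rightarrow> real)" using E by (intro integrable_real_indicator) (auto simp: emeasure_eq_measure)
    have "var M (indicator E) = (\<integral>x. (indicator E x - prob E)^2 \<partial>M)" using E by (simp add: var_def)
    also have "\<dots> = (\<integral>x. (1 - 2 * prob E) * indicator E x + (prob E)^2 \<partial>M)"
      by (intro Bochner_Integration.integral_cong) (auto simp: indicator_def power2_eq_square algebra_simps)
    also have "\<dots> = prob E * (1 - prob E)" using ii E by (simp add: prob_space power2_eq_square algebra_simps)
    finally show ?thesis .
  qed
  show ?thesis
  proof (cases "0 < var M (indicator A) \<and> 0 < var M (indicator B)")
    case True
    let ?f = "indicator A :: _ \<Rightarrow> real" and ?g = "indicator B :: _ \<Rightarrow> real"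
    have "\<bar>correlation M ?f ?g\<bar> \<le> complete_regularity_coeff M H n"
      unfolding complete_regularity_coeff_def
    proof (rule cSup_upper)
      have "?f \<in> borel_measurable (sigma (space M) (past_gen M H k))" "?g \<in> borel_measurable (sigma (space M) (future_gen M H (k + n)))"
        using A B gp by (auto intro!: borel_measurable_indicator)
      moreover have "integrable M (\<lambda>x. (?f x)^2)" "integrable M (\<lambda>x. (?g x)^2)"
        by (rule integrable_const_bound[of _ 1]; use AM in \<open>auto simp: indicator_def\<close>)+
      ultimately show "\<bar>correlation M ?f ?g\<bar> \<in> {\<bar>correlation M f g\<bar> | k f g.
        f \<in> borel_measurable (sigma (space M) (past_gen M H k)) \<and>
        g \<in> borel_measurable (sigma (space M) (future_gen M H (k + n))) \<and>
        integrable M (\<lambda>x. (f x)^2) \<and> integrable M (\<lambda>x. (g x)^2) \<and> var M f > 0 \<and> var M g > 0}"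
        using True by blast
      show "bdd_above {\<bar>correlation M f g\<bar> | k f g.
        f \<in> borel_measurable (sigma (space M) (past_gen M H k)) \<and>
        g \<in> borel_measurable (sigma (space M) (future_gen M H (k + n))) \<and>
        integrable M (\<lambda>x. (f x)^2) \<and> integrable M (\<lambda>x. (g x)^2) \<and> var M f > 0 \<and> var M g > 0}"
      proof (rule bdd_aboveI[of _ 1])
        fix y assume "y \<in> {\<bar>correlation M f g\<bar> | k f g.
          f \<in> borel_measurable (sigma (space M) (past_gen M H k)) \<and>
          g \<in> borel_measurable (sigma (space M) (future_gen M H (k + n))) \<and>
          integrable M (\<lambda>x. (f x)^2) \<and> integrable M (\<lambda>x. (g x)^2) \<and> var M f > 0 \<and> var M g > 0}"
        then obtain k f g where fg: "y = \<bar>correlation M f g\<bar>"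
          "f \<in> borel_measurable (sigma (space M) (past_gen M H k))"
          "g \<in> borel_measurable (sigma (space M) (future_gen M H (k + n)))"
          "integrable M (\<lambda>x. (f x)^2)" "integrable M (\<lambda>x. (g x)^2)" "var M f > 0" "var M g > 0" by blast
        have "subalgebra M (sigma (space M) (past_gen M H k))" "subalgebra M (sigma (space M) (future_gen M H (k + n)))"
          using gen_sigma_subset[of H M, OF H] gp by (auto simp: subalgebra_def)
        then have "f \<in> borel_measurable M" "g \<in> borel_measurable M"
          using fg(2,3) by (blast intro: measurable_from_subalg)+
        then show "y \<le> 1" unfolding fg(1) using fg by (intro corr_le_1[OF M]) auto
      qed
    qed
    then have cc: "\<bar>correlation M ?f ?g\<bar> \<le> c" using c by simp
    define s where "s = sqrt (var M ?f * var M ?g)"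
    have s0: "0 < s" using True by (simp add: s_def)
    have v1: "var M (indicator E) \<le> 1" "0 \<le> var M (indicator E)" if "E \<in> sets M" for E
      unfolding vi[OF that] by (auto intro: mult_le_one)
    have s1: "s \<le> 1" unfolding s_def using v1[OF AM(1)] v1[OF AM(2)] by (intro real_le_lsqrt) (auto intro: mult_le_one)
    have "prob (A \<inter> B) - prob A * prob B = correlation M ?f ?g * s"
      using s0 AM by (simp add: correlation_def s_def[symmetric] indicator_inter_arith[symmetric])
    then have "\<bar>prob (A \<inter> B) - prob A * prob B\<bar> = \<bar>correlation M ?f ?g\<bar> * s" using s0 by (simp add: abs_mult)
    also have "\<dots> \<le> c * 1" using cc s1 s0 c by (intro mult_mono) auto
    finally show ?thesis by simp
  next
    case False
    have "prob (A \<inter> B) = prob A * prob B"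
    proof -
      have sub: "prob (A \<inter> B) \<le> prob A" "prob (A \<inter> B) \<le> prob B" using AM by (auto intro!: finite_measure_mono)
      have un: "prob A + prob B - 1 \<le> prob (A \<inter> B)"
      proof -
        have "prob (A \<union> B) = prob A + prob B - prob (A \<inter> B)" using AM by (intro measure_Un3) (auto simp: fmeasurable_eq_sets)
        then show ?thesis using prob_le_1[of "A \<union> B"] by linarith
      qed
      have z: "prob E = 0 \<or> prob E = 1" if "E \<in> sets M" "\<not> 0 < var M (indicator E)" for E
      proof -
        have "prob E * (1 - prob E) \<le> 0" using that by (simp add: vi)
        moreover have "0 \<le> prob E * (1 - prob E)" by simp
        ultimately have "prob E * (1 - prob E) = 0" by linarith
        then show ?thesis by auto
      qed
      consider "prob A = 0 \<or> prob A = 1" | "prob B = 0 \<or> prob B = 1" using False z AM by blast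
      then show ?thesis using sub un measure_nonneg[of M "A \<inter> B"] by cases (auto simp: order_antisym)
    qed
    then show ?thesis using c by simp
  qed
qed

lemma stationary_transfer:
  assumes st: "stationary_proc M H" and H: "\<And>i. H i \<in> borel_measurable M"
    and F: "F \<in> borel_measurable (PiM UNIV (\<lambda>_::nat. borel))"
  shows "(\<integral>\<omega>. F (\<lambda>i. H (i + k) \<omega>) \<partial>M) = (\<integral>\<omega>. F (\<lambda>i. H i \<omega>) \<partial>M :: real)"
    and "integrable M (\<lambda>\<omega>. F (\<lambda>i. H (i + k) \<omega>)) \<longleftrightarrow> integrable M (\<lambda>\<omega>. F (\<lambda>i. H i \<omega>))"
proof -
  have m: "(\<lambda>\<omega> i. H (i + j) \<omega>) \<in> measurable M (PiM UNIV (\<lambda>_::nat. borel))" for j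
    by (rule measurable_abs_UNIV) (rule H)
  have m0: "(\<lambda>\<omega> i. H i \<omega>) \<in> measurable M (PiM UNIV (\<lambda>_::nat. borel))" by (rule measurable_abs_UNIV) (rule H)
  have e: "distr M (PiM UNIV (\<lambda>_::nat. borel)) (\<lambda>\<omega> i. H (i + k) \<omega>) = distr M (PiM UNIV (\<lambda>_::nat. borel)) (\<lambda>\<omega> i. H i \<omega>)"
    using st by (simp add: stationary_proc_def)
  show "(\<integral>\<omega>. F (\<lambda>i. H (i + k) \<omega>) \<partial>M) = (\<integral>\<omega>. F (\<lambda>i. H i \<omega>) \<partial>M)"
    using integral_distr[OF m F, of k] integral_distr[OF m0 F] unfolding e by simp
  show "integrable M (\<lambda>\<omega>. F (\<lambda>i. H (i + k) \<omega>)) \<longleftrightarrow> integrable M (\<lambda>\<omega>. F (\<lambda>i. H i \<omega>))"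
    using integrable_distr_eq[OF m F, of k] integrable_distr_eq[OF m0 F] unfolding e by simp
qed

text \<open>A density leaves no atom at 0, and stationarity carries this from \<open>H 0\<close> to
  every \<open>H i\<close>.\<close>

lemma AE_pos_transfer:
  assumes M: "prob_space M" and st: "stationary_proc M H" and H: "\<And>i. H i \<in> borel_measurable M"
    and nn: "\<And>i \<omega>. \<omega> \<in> space M \<Longrightarrow> 0 \<le> H i \<omega>"
    and f: "distributed M lborel (H 0) (\<lambda>x. ennreal (f x))"
  shows "AE \<omega> in M. \<forall>i. 0 < H i \<omega>"
proof (subst AE_all_countable, intro allI)
  fix i
  interpret prob_space M by fact
  have "{\<omega> \<in> space M. H 0 \<omega> = 0} = H 0 -` {0} \<inter> space M" by auto
  then have "emeasure M {\<omega> \<in> space M. H 0 \<omega> = 0} = (\<integral>\<^sup>+x. ennreal (f x) * indicator {0} x \<partial>lborel)"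
    using distributed_emeasure[OF f, of "{0}"] by simp
  also have "\<dots> = 0"
    using AE_lborel_singleton[of "0::real"] distributed_borel_measurable[OF f] by (subst nn_integral_0_iff_AE) (auto simp: indicator_def)
  finally have z: "prob {\<omega> \<in> space M. H 0 \<omega> = 0} = 0" by (simp add: measure_def)
  define F where "F p = (indicator {0} (p 0) :: real)" for p :: "nat \<Rightarrow> real"
  have F: "F \<in> borel_measurable (PiM UNIV (\<lambda>_::nat. borel))" unfolding F_def by measurable
  have ind: "(\<integral>\<omega>. indicator {0} (H j \<omega>) \<partial>M) = prob {\<omega> \<in> space M. H j \<omega> = 0}" for j
  proof -
    have "(\<integral>\<omega>. indicator {0} (H j \<omega>) \<partial>M) = (\<integral>\<omega>. indicator {\<omega> \<in> space M. H j \<omega> = 0} \<omega> \<partial>M)"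
      by (intro Bochner_Integration.integral_cong) (auto simp: indicator_def)
    also have "\<dots> = prob {\<omega> \<in> space M. H j \<omega> = 0}" using H[of j] by simp
    finally show ?thesis .
  qed
  have "prob {\<omega> \<in> space M. H i \<omega> = 0} = 0"
    using stationary_transfer(1)[OF st H F, of i] z ind[of i] ind[of 0] by (simp add: F_def)
  moreover have "{\<omega> \<in> space M. H i \<omega> = 0} \<in> sets M" using H[of i] by measurable
  ultimately have "AE \<omega> in M. H i \<omega> \<noteq> 0" by (intro AE_I[of _ _ "{\<omega> \<in> space M. H i \<omega> = 0}"]) (auto simp: emeasure_eq_measure)
  then show "AE \<omega> in M. 0 < H i \<omega>" using AE_space by eventually_elim (use nn[of _ i] in \<open>auto simp: order_less_le\<close>)
qed

text \<open>Expectations of functions of finitely many coordinates do not change under a shift,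
  which yields the moments and the dependence of covariances on the lag alone.\<close>

lemma lnH_mixing_seq:
  assumes M: "prob_space M" and H: "\<And>i. H i \<in> borel_measurable M" and st: "stationary_proc M H"
    and mixing: "K > 0" "\<beta> > 0" "(\<forall>n\<ge>1. strong_mixing_coeff M H n \<le> K * exp (- \<beta> * real n)) \<or>
            (\<forall>n\<ge>1. complete_regularity_coeff M H n \<le> K * exp (- \<beta> * real n))"
    and i1: "integrable M (lnH H 0)" and i3: "integrable M (\<lambda>\<omega>. \<bar>lnH H 0 \<omega> - (\<integral>\<omega>'. lnH H 0 \<omega>' \<partial>M)\<bar> ^ 3)"
  defines "\<mu> \<equiv> (\<integral>\<omega>. lnH H 0 \<omega> \<partial>M)"
  shows "mixing_seq M (\<lambda>i \<omega>. lnH H i \<omega> - \<mu>) K \<beta> (\<integral>\<omega>. \<bar>lnH H 0 \<omega> - \<mu>\<bar> ^ 3 \<partial>M) (autocov M H)"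
    and "\<And>i. integrable M (lnH H i)" "\<And>i. (\<integral>\<omega>. lnH H i \<omega> \<partial>M) = \<mu>"
proof -
  interpret prob_space M by fact
  have meas: "lnH H i \<in> borel_measurable M" for i unfolding lnH_def[abs_def] using H[of i] by measurable
  have Fm: "(\<lambda>p. ln ((p 0)^2) / 2) \<in> borel_measurable (PiM UNIV (\<lambda>_::nat. borel :: real measure))" by measurable
  have sh: "lnH H i = (\<lambda>\<omega>. ln ((H (0 + i) \<omega>)^2) / 2)" for i by (simp add: lnH_def[abs_def])
  show int: "integrable M (lnH H i)" for i
    using stationary_transfer(2)[OF st H Fm, of i] i1 unfolding sh[of i] sh[of 0] by simp
  show mean: "(\<integral>\<omega>. lnH H i \<omega> \<partial>M) = \<mu>" for i
    using stationary_transfer(1)[OF st H Fm, of i] unfolding \<mu>_def by (simp add: lnH_def)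
  have F3: "(\<lambda>p. \<bar>ln ((p 0)^2) / 2 - \<mu>\<bar>^3) \<in> borel_measurable (PiM UNIV (\<lambda>_::nat. borel :: real measure))" by measurable
  show "mixing_seq M (\<lambda>i \<omega>. lnH H i \<omega> - \<mu>) K \<beta> (\<integral>\<omega>. \<bar>lnH H 0 \<omega> - \<mu>\<bar> ^ 3 \<partial>M) (autocov M H)"
  proof
    show "(\<lambda>\<omega>. lnH H i \<omega> - \<mu>) \<in> borel_measurable M" for i using meas by measurable
    show "integrable M (\<lambda>\<omega>. \<bar>lnH H i \<omega> - \<mu>\<bar>^3)" for i
      using stationary_transfer(2)[OF st H F3, of i] i3 by (simp add: lnH_def \<mu>_def)
    show "(\<integral>\<omega>. \<bar>lnH H i \<omega> - \<mu>\<bar>^3 \<partial>M) \<le> (\<integral>\<omega>. \<bar>lnH H 0 \<omega> - \<mu>\<bar>^3 \<partial>M)" for i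
      using stationary_transfer(1)[OF st H F3, of i] by (simp add: lnH_def)
    show "(\<integral>\<omega>. lnH H i \<omega> - \<mu> \<partial>M) = 0" for i using int[of i] mean[of i] by (simp add: prob_space)
    show "(\<integral>\<omega>. (lnH H i \<omega> - \<mu>) * (lnH H (i + d) \<omega> - \<mu>) \<partial>M) = autocov M H d" for i d
    proof -
      have F2: "(\<lambda>p. (ln ((p 0)^2) / 2 - \<mu>) * (ln ((p d)^2) / 2 - \<mu>)) \<in> borel_measurable (PiM UNIV (\<lambda>_::nat. borel :: real measure))" by measurable
      show ?thesis using stationary_transfer(1)[OF st H F2, of i] unfolding autocov_def mean by (simp add: lnH_def add.commute mult.commute)
    qed
    show "0 \<le> K" "0 < \<beta>" using mixing by auto
    fix n k A B assume n: "1 \<le> (n::nat)" and A: "A \<in> sigma_sets (space M) (past_gen M (\<lambda>i \<omega>. lnH H i \<omega> - \<mu>) k)"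
      and B: "B \<in> sigma_sets (space M) (future_gen M (\<lambda>i \<omega>. lnH H i \<omega> - \<mu>) (k + n))"
    \<comment> \<open>Each variable is a Borel function of \<open>H i\<close>, so the generated
      sigma-algebras can only shrink and the mixing bounds of \<open>H\<close> carry over.\<close>
    have pre: "\<exists>A'\<in>sets borel. (\<lambda>\<omega>. lnH H i \<omega> - \<mu>) -` A \<inter> space M = H i -` A' \<inter> space M" if "A \<in> sets borel" for i A
    proof (rule bexI)
      show "(\<lambda>x::real. ln (x^2) / 2 - \<mu>) -` A \<in> sets borel"
        using measurable_sets[of "\<lambda>x::real. ln (x^2) / 2 - \<mu>" borel borel A] that by simp
      show "(\<lambda>\<omega>. lnH H i \<omega> - \<mu>) -` A \<inter> space M = H i -` ((\<lambda>x::real. ln (x^2) / 2 - \<mu>) -` A) \<inter> space M"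
        by (auto simp: lnH_def)
    qed
    have "past_gen M (\<lambda>i \<omega>. lnH H i \<omega> - \<mu>) k \<subseteq> past_gen M H k"
    proof
      fix C assume "C \<in> past_gen M (\<lambda>i \<omega>. lnH H i \<omega> - \<mu>) k"
      then obtain i A where C: "i \<le> k" "A \<in> sets borel" "C = (\<lambda>\<omega>. lnH H i \<omega> - \<mu>) -` A \<inter> space M"
        unfolding past_gen_def by blast
      obtain A' where "A' \<in> sets borel" "C = H i -` A' \<inter> space M" using pre[OF C(2), of i] C(3) by metis
      then show "C \<in> past_gen M H k" unfolding past_gen_def using C(1) by blast
    qed
    moreover have "future_gen M (\<lambda>i \<omega>. lnH H i \<omega> - \<mu>) (k + n) \<subseteq> future_gen M H (k + n)"
    proof
      fix C assume "C \<in> future_gen M (\<lambda>i \<omega>. lnH H i \<omega> - \<mu>) (k + n)"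
      then obtain i A where C: "k + n \<le> i" "A \<in> sets borel" "C = (\<lambda>\<omega>. lnH H i \<omega> - \<mu>) -` A \<inter> space M"
        unfolding future_gen_def by blast
      obtain A' where "A' \<in> sets borel" "C = H i -` A' \<inter> space M" using pre[OF C(2), of i] C(3) by metis
      then show "C \<in> future_gen M H (k + n)" unfolding future_gen_def using C(1) by blast
    qed
    ultimately have A': "A \<in> sigma_sets (space M) (past_gen M H k)" and B': "B \<in> sigma_sets (space M) (future_gen M H (k + n))"
      using A B sigma_sets_mono' by blast+
    show "\<bar>prob (A \<inter> B) - prob A * prob B\<bar> \<le> K * exp (- \<beta> * real n)"
      using mixing(3)
    proof
      assume "\<forall>n\<ge>1. strong_mixing_coeff M H n \<le> K * exp (- \<beta> * real n)"
      then show ?thesis using strong_mixing_le[OF M A' B'] n by (meson order_trans)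
    next
      assume "\<forall>n\<ge>1. complete_regularity_coeff M H n \<le> K * exp (- \<beta> * real n)"
      then show ?thesis using n mixing(1) by (intro regularity_mixing_le[OF M H A' B']) auto
    qed
  qed
qed

section \<open>From the limit theorem to the expansion\<close>

lemma (in mixing_seq) tailprob_clt:
  assumes \<sigma>: "0 < \<sigma>"
  shows "\<exists>C\<ge>0. \<forall>n\<ge>3. \<forall>s. \<bar>(\<integral>x. tailprob n \<sigma> (S n x + s) \<partial>M) - Qfun ((s - lnvol_center n \<sigma>) / sqrt (real n * (1 / 2 + v)))\<bar>
    \<le> C * (ln (real n))^2 / sqrt (real n)"
proof -
  obtain C where C: "0 \<le> C" "\<And>n y. 3 \<le> n \<Longrightarrow> \<bar>(\<integral>x. heat0 (real n / 2) (y + S n x) \<partial>M) - heat0 (real n / 2 + real n * v) y\<bar> \<le> C * (ln (real n))^2 / sqrt (real n)"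
    using smooth_clt by blast
  show ?thesis
  proof (intro exI[of _ "C + radial_error"] conjI allI impI)
    show "0 \<le> C + radial_error" using C radial_error_nonneg by simp
    fix n :: nat and s :: real assume n: "3 \<le> n"
    then have n1: "1 \<le> n" and n0: "0 < real n / 2" by auto
    have "ln (exp 1) \<le> ln (real n)" using n exp_le by (subst ln_le_cancel_iff) auto
    then have l1: "1 \<le> (ln (real n))^2" by (intro one_le_power) simp
    define y where "y = s - lnvol_center n \<sigma>"
    have hm: "heat0 (real n / 2) \<in> borel_measurable borel"
      using DERIV_isCont[OF heat_deriv_x(1)[OF n0]]
      by (auto intro!: borel_measurable_continuous_onI continuous_at_imp_continuous_on)
    have i1: "integrable M (\<lambda>x. tailprob n \<sigma> (S n x + s))"
      by (rule integrable_const_bound[of _ 1])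
        (use tailprob_bounds[OF \<sigma>] in \<open>auto intro!: measurable_compose[OF _ tailprob_measurable[OF \<sigma>]]\<close>)
    have i2: "integrable M (\<lambda>x. heat0 (real n / 2) (y + S n x))"
      by (rule integrable_const_bound[of _ 1])
        (use heat_bounds(1)[OF n0] in \<open>auto intro!: measurable_compose[OF _ hm]\<close>)
    \<comment> \<open>The normal approximation of the noise is uniform in the threshold, so it may
      be applied for each fading state separately and then integrated.\<close>
    have b: "\<bar>tailprob n \<sigma> (S n x + s) - heat0 (real n / 2) (y + S n x)\<bar> \<le> radial_error / sqrt n" for x
      using noise_tail[OF n1 \<sigma>, of "S n x + s"] unfolding tailprob_def y_def by (simp add: algebra_simps)
    have "\<bar>\<integral>x. tailprob n \<sigma> (S n x + s) - heat0 (real n / 2) (y + S n x) \<partial>M\<bar> \<le> (\<integral>x. radial_error / sqrt n \<partial>M)"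
      by (rule integral_dominated(2)[OF _ _ b]) (use i1 i2 in auto)
    then have "\<bar>(\<integral>x. tailprob n \<sigma> (S n x + s) \<partial>M) - (\<integral>x. heat0 (real n / 2) (y + S n x) \<partial>M)\<bar> \<le> radial_error / sqrt n"
      using i1 i2 by (simp add: prob_space)
    also have "radial_error / sqrt n \<le> radial_error * (ln (real n))^2 / sqrt n"
      using l1 radial_error_nonneg mult_left_mono[OF l1 radial_error_nonneg] by (intro divide_right_mono) auto
    finally have 1: "\<bar>(\<integral>x. tailprob n \<sigma> (S n x + s) \<partial>M) - (\<integral>x. heat0 (real n / 2) (y + S n x) \<partial>M)\<bar> \<le> radial_error * (ln (real n))^2 / sqrt n" .
    have "heat0 (real n / 2 + real n * v) y = Qfun ((s - lnvol_center n \<sigma>) / sqrt (real n * (1 / 2 + v)))"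
      by (simp add: heat0_def y_def algebra_simps)
    then show "\<bar>(\<integral>x. tailprob n \<sigma> (S n x + s) \<partial>M) - Qfun ((s - lnvol_center n \<sigma>) / sqrt (real n * (1 / 2 + v)))\<bar>
      \<le> (C + radial_error) * (ln (real n))^2 / sqrt (real n)"
      using 1 C(2)[OF n, of y] by (simp add: ring_distribs add_divide_distrib)
  qed
qed

lemma Qfun_antimono: "x \<le> y \<Longrightarrow> Qfun y \<le> Qfun x"
  using Qfun_strict_antimono[of x y] by (cases "x = y") auto

text \<open>Moving the threshold by D ln^2 n moves the argument of Q by order ln^2 n / sqrt n. By
  \<open>Qfun_slope\<close> the value then changes by more than the error of the limit theorem, the
  2 / n of the lattice bound and the offsets \<open>a n\<close> and \<open>ln (3 * real n)\<close>
  together.\<close>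

lemma Qfun_inversion:
  fixes x V C :: real and a :: "nat \<Rightarrow> real"
  assumes V: "0 < V" and C: "0 \<le> C" and a: "\<And>n. N \<le> n \<Longrightarrow> \<bar>a n\<bar> \<le> ln n + 3"
  shows "\<exists>D\<ge>0. \<forall>\<^sub>F n in sequentially.
    Qfun x < Qfun ((sqrt (n * V) * x - D * (ln n)^2 - a n) / sqrt (n * V)) - C * (ln n)^2 / sqrt n \<and>
    2 / n + (Qfun ((sqrt (n * V) * x + D * (ln n)^2 - a n - ln (3 * real n)) / sqrt (n * V)) + C * (ln n)^2 / sqrt n) \<le> Qfun x"
proof -
  define k where "k = phi (\<bar>x\<bar> + 1)"
  have k: "0 < k" unfolding k_def by (rule normal_density_pos) simp
  \<comment> \<open>Of C + 3, the part C beats the error term and 3 leaves room for 2 / n and for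
    strictness. The 7 covers |a n| + ln (3 n) <= 2 ln n + 5 <= 7 ln^2 n. The remaining D - 7 shifts
    the argument of Q by exactly \<open>u n\<close>, which must drop below 1 for
    \<open>Qfun_slope\<close>.\<close>
  define D where "D = (C + 3) * sqrt V / k + 7"
  have D0: "0 \<le> D" unfolding D_def using C V k by (intro add_nonneg_nonneg divide_nonneg_nonneg mult_nonneg_nonneg) auto
  define u where "u n = (C + 3) * (ln (real n))^2 / (k * sqrt (real n))" for n :: nat
  have "(\<lambda>n. (C + 3) / k * ((ln (real n))^2 / sqrt (real n))) \<longlonglongrightarrow> (C + 3) / k * 0"
  proof (intro tendsto_mult tendsto_const)
    have "((\<lambda>x::real. ln x ^ 2 / x powr (1 / 2)) \<longlongrightarrow> 0) at_top" by real_asymp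
    then have "(\<lambda>n. ln (real n) ^ 2 / real n powr (1 / 2)) \<longlonglongrightarrow> 0"
      by (rule filterlim_compose[OF _ filterlim_real_sequentially])
    then show "(\<lambda>n. (ln (real n))^2 / sqrt (real n)) \<longlonglongrightarrow> 0" by (simp add: powr_half_sqrt)
  qed
  then have "u \<longlonglongrightarrow> 0" unfolding u_def[abs_def] by simp
  then have "\<forall>\<^sub>F n in sequentially. u n < 1" by (rule order_tendstoD(2)) simp
  then have "\<forall>\<^sub>F n in sequentially.
    Qfun x < Qfun ((sqrt (n * V) * x - D * (ln n)^2 - a n) / sqrt (n * V)) - C * (ln n)^2 / sqrt n \<and>
    2 / n + (Qfun ((sqrt (n * V) * x + D * (ln n)^2 - a n - ln (3 * real n)) / sqrt (n * V)) + C * (ln n)^2 / sqrt n) \<le> Qfun x"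
    using eventually_ge_at_top[of "max 3 N"]
  proof eventually_elim
    case (elim n)
    define l where "l = ln (real n)"
    have "ln (exp 1) \<le> ln (real n)" using elim exp_le by (subst ln_le_cancel_iff) auto
    then have l1: "1 \<le> l" by (simp add: l_def)
    have l2: "1 \<le> l^2" by (rule one_le_power[OF l1])
    have l3: "l \<le> l^2" using l1 by (simp add: power2_eq_square)
    have an: "\<bar>a n\<bar> \<le> l + 3" using a[of n] elim by (simp add: l_def)
    have n0: "0 < real n" using elim by simp
    have sn: "0 < sqrt (real n)" "0 < sqrt (real n * V)" "sqrt (real n * V) = sqrt (real n) * sqrt V" "0 < sqrt V"
      using n0 V by (auto simp: real_sqrt_mult)
    have u0: "0 \<le> u n" "u n \<le> 1" using elim C k by (auto simp: u_def intro!: divide_nonneg_nonneg mult_nonneg_nonneg)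
    have ku: "k * u n = (C + 3) * l^2 / sqrt (real n)" using k sn by (simp add: u_def l_def field_simps)
    have us: "u n * sqrt (real n * V) = (D - 7) * l^2" using k sn(1) unfolding u_def l_def D_def sn(3) by (simp add: field_simps)
    have D7: "(D - 7) * l^2 + 7 * l^2 = D * l^2" by (simp add: algebra_simps)
    have p: "0 < l^2 / sqrt (real n)" using l2 sn by (intro divide_pos_pos) auto
    have "sqrt (real n * V) * x - D * l^2 - a n \<le> (x - u n) * sqrt (real n * V)"
      using us D7 an l2 l3 l1 unfolding left_diff_distrib by (simp add: mult.commute abs_le_iff)
    then have "(sqrt (real n * V) * x - D * l^2 - a n) / sqrt (real n * V) \<le> x - u n" using sn(2) by (simp add: divide_le_eq)
    then have "Qfun (x - u n) \<le> Qfun ((sqrt (real n * V) * x - D * l^2 - a n) / sqrt (real n * V))" by (rule Qfun_antimono)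
    moreover have "Qfun x + k * u n \<le> Qfun (x - u n)" unfolding k_def by (rule Qfun_slope(1)[OF u0])
    moreover have "k * u n = C * l^2 / sqrt (real n) + 3 * (l^2 / sqrt (real n))" unfolding ku by (simp add: ring_distribs add_divide_distrib)
    ultimately have 1: "Qfun x < Qfun ((sqrt (real n * V) * x - D * l^2 - a n) / sqrt (real n * V)) - C * l^2 / sqrt (real n)"
      using p by linarith
    have "ln (3 * real n) = ln 3 + l" using n0 by (simp add: l_def ln_mult)
    moreover have "ln (3::real) \<le> 2" using ln_le_minus_one[of "3::real"] by simp
    ultimately have l4: "ln (3 * real n) \<le> 2 + l" by simp
    have "(x + u n) * sqrt (real n * V) \<le> sqrt (real n * V) * x + D * l^2 - a n - ln (3 * real n)"
      using us D7 an l2 l3 l1 l4 unfolding distrib_right by (simp add: mult.commute abs_le_iff)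
    then have "x + u n \<le> (sqrt (real n * V) * x + D * l^2 - a n - ln (3 * real n)) / sqrt (real n * V)" using sn(2) by (simp add: le_divide_eq)
    then have "Qfun ((sqrt (real n * V) * x + D * l^2 - a n - ln (3 * real n)) / sqrt (real n * V)) \<le> Qfun (x + u n)" by (rule Qfun_antimono)
    moreover have "Qfun (x + u n) \<le> Qfun x - k * u n" unfolding k_def by (rule Qfun_slope(2)[OF u0])
    moreover have "2 / real n \<le> 2 * (l^2 / sqrt (real n))"
    proof -
      have "sqrt (real n) \<le> real n" using elim by (intro real_le_lsqrt) (auto simp: power2_eq_square)
      then have "1 / real n \<le> l^2 / sqrt (real n)" using sn l2 by (intro frac_le) auto
      then show ?thesis by simp
    qed
    ultimately have 2: "2 / real n + (Qfun ((sqrt (real n * V) * x + D * l^2 - a n - ln (3 * real n)) / sqrt (real n * V)) + C * l^2 / sqrt (real n)) \<le> Qfun x"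
      using p \<open>k * u n = _ + _\<close> by linarith
    show ?case using 1 2 unfolding l_def by simp
  qed
  then show ?thesis using D0 by blast
qed

text \<open>Integrability is assumed explicitly because the integral of a non-integrable function is
  0 by convention; likewise finiteness of \<open>opt_NLD\<close> for large n is part of the
  conclusion, so that \<open>real_of_ereal\<close> in the expansion is faithful.\<close>

theorem theorem4p8:
  fixes M :: "'a measure" and H :: "nat \<Rightarrow> 'a \<Rightarrow> real" and \<sigma> \<epsilon> :: real
  assumes "prob_space M"
    and "\<And>i. H i \<in> borel_measurable M"
    and "\<And>i \<omega>. \<omega> \<in> space M \<Longrightarrow> 0 \<le> H i \<omega>"
    and "stationary_proc M H"
    and "integrable M (\<lambda>\<omega>. (H 0 \<omega>)^2)" and "(\<integral>\<omega>. (H 0 \<omega>)^2 \<partial>M) = 1"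
    and "\<exists>f. distributed M lborel (H 0) (\<lambda>x. ennreal (f x)) \<and> (\<forall>x. 0 \<le> f x) \<and> regular_fading_pdf f"
    and "\<exists>K \<beta>. K > 0 \<and> \<beta> > 0 \<and>
           ((\<forall>n\<ge>1. strong_mixing_coeff M H n \<le> K * exp (- \<beta> * real n)) \<or>
            (\<forall>n\<ge>1. complete_regularity_coeff M H n \<le> K * exp (- \<beta> * real n)))"
    and "integrable M (lnH H 0)"
    and "integrable M (\<lambda>\<omega>. \<bar>lnH H 0 \<omega> - (\<integral>\<omega>'. lnH H 0 \<omega>' \<partial>M)\<bar> ^ 3)"
    and "\<sigma> > 0" and "\<epsilon> > 0" and "\<epsilon> < 1"
  shows "summable (\<lambda>k. autocov M H (Suc k))
    \<and> (\<lambda>n. var M (\<lambda>\<omega>. \<Sum>i<n. lnH H i \<omega>) / real n)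
         \<longlonglongrightarrow> var M (lnH H 0) + 2 * (\<Sum>k. autocov M H (Suc k))
    \<and> eventually (\<lambda>n. \<bar>opt_NLD M H \<sigma> n \<epsilon>\<bar> \<noteq> \<infinity>) sequentially
    \<and> (\<lambda>n. real_of_ereal (opt_NLD M H \<sigma> n \<epsilon>)
            - (cap_star M H \<sigma> - sqrt (dispersion M H / real n) * Qinv \<epsilon>))
        \<in> O(\<lambda>n. (ln (real n))^2 / real n)"
proof -
  note M = assms(1) and H = assms(2) and st = assms(4) and \<sigma> = assms(11)
  interpret prob_space M by fact
  obtain f where f: "distributed M lborel (H 0) (\<lambda>x. ennreal (f x))" using assms(7) by blast
  obtain K \<beta> where mixing: "K > 0" "\<beta> > 0" "(\<forall>n\<ge>1. strong_mixing_coeff M H n \<le> K * exp (- \<beta> * real n)) \<or>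
            (\<forall>n\<ge>1. complete_regularity_coeff M H n \<le> K * exp (- \<beta> * real n))" using assms(8) by blast
  have pos: "AE \<omega> in M. \<forall>i. 0 < H i \<omega>" by (rule AE_pos_transfer[OF M st H assms(3) f])
  then have posn: "AE \<omega> in M. \<forall>i<n. 0 < H i \<omega>" for n by eventually_elim auto
  define \<mu> where "\<mu> = (\<integral>\<omega>. lnH H 0 \<omega> \<partial>M)"
  define m3 where "m3 = (\<integral>\<omega>. \<bar>lnH H 0 \<omega> - \<mu>\<bar> ^ 3 \<partial>M)"
  note ms = lnH_mixing_seq[OF M H st mixing assms(9,10), folded \<mu>_def, folded m3_def]
  interpret L: mixing_seq M "\<lambda>i \<omega>. lnH H i \<omega> - \<mu>" K \<beta> m3 "autocov M H" by (rule ms(1))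
  have Ssum: "(\<Sum>i<n. lnH H i \<omega>) = L.S n \<omega> + n * \<mu>" for n \<omega> by (simp add: L.S_def sum_subtractf)
  have v0: "var M (lnH H 0) = autocov M H 0" by (simp add: var_def autocov_def power2_eq_square)
  have v: "var M (lnH H 0) + 2 * (\<Sum>k. autocov M H (Suc k)) = L.v" by (simp add: L.v_def v0)
  define V where "V = dispersion M H"
  \<comment> \<open>The 1/2 contributed by the noise keeps V positive even if the long-run variance
    of the fading vanishes.\<close>
  have V: "V = 1 / 2 + L.v" "0 < V" using L.v_nonneg by (auto simp: V_def dispersion_def v[symmetric])
  have var: "var M (\<lambda>\<omega>. \<Sum>i<n. lnH H i \<omega>) = (\<integral>\<omega>. (L.S n \<omega>)^2 \<partial>M)" for n
  proof -
    have "(\<integral>\<omega>. (\<Sum>i<n. lnH H i \<omega>) \<partial>M) = n * \<mu>"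
      by (subst Bochner_Integration.integral_sum) (use ms(2,3) in auto)
    then show ?thesis unfolding var_def by (simp add: Ssum)
  qed
  have cap: "cap_star M H \<sigma> = \<mu> - ln (2 * pi * exp 1 * \<sigma>^2) / 2"
  proof -
    have k: "0 < 2 * pi * exp 1 * \<sigma>^2" using \<sigma> by simp
    have e: "ln (x / y) / 2 = ln x / 2 - ln y / 2" if "0 < x" "0 < y" for x y :: real
      using that by (simp add: ln_div diff_divide_distrib)
    have "cap_star M H \<sigma> = (\<integral>\<omega>. lnH H 0 \<omega> - ln (2 * pi * exp 1 * \<sigma>^2) / 2 \<partial>M)"
      unfolding cap_star_def
    proof (rule integral_cong_AE)
      show "AE \<omega> in M. ln ((H 0 \<omega>)^2 / (2 * pi * exp 1 * \<sigma>^2)) / 2 = lnH H 0 \<omega> - ln (2 * pi * exp 1 * \<sigma>^2) / 2"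
        using pos
      proof eventually_elim
        case (elim \<omega>)
        then have "0 < H 0 \<omega>" by blast
        then have "0 < (H 0 \<omega>)^2" by simp
        then show ?case using k unfolding lnH_def by (intro e)
      qed
      show "(\<lambda>\<omega>. ln ((H 0 \<omega>)^2 / (2 * pi * exp 1 * \<sigma>^2)) / 2) \<in> borel_measurable M" using H[of 0] by measurable
      show "(\<lambda>\<omega>. lnH H 0 \<omega> - ln (2 * pi * exp 1 * \<sigma>^2) / 2) \<in> borel_measurable M" using assms(9) by auto
    qed
    then show ?thesis using assms(9) by (simp add: prob_space \<mu>_def)
  qed
  obtain C where C: "0 \<le> C" "\<And>n s. 3 \<le> n \<Longrightarrow> \<bar>(\<integral>x. tailprob n \<sigma> (L.S n x + s) \<partial>M) - Qfun ((s - lnvol_center n \<sigma>) / sqrt (real n * V))\<bar>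
    \<le> C * (ln (real n))^2 / sqrt (real n)"
    using L.tailprob_clt[OF \<sigma>] unfolding V(1) by blast
  define a where "a n = lnvol_center n \<sigma> - n / 2 * ln (2 * pi * exp 1 * \<sigma>^2)" for n :: nat
  obtain N where N: "\<And>n. N \<le> n \<Longrightarrow> \<bar>a n\<bar> \<le> ln n + 3" using lnvol_center_asymp[OF \<sigma>] unfolding a_def by blast
  define x where "x = Qinv \<epsilon>"
  have Qx: "Qfun x = \<epsilon>" unfolding x_def by (rule Qfun_Qinv) fact+
  obtain D where D: "0 \<le> D" "\<forall>\<^sub>F n in sequentially.
    Qfun x < Qfun ((sqrt (n * V) * x - D * (ln n)^2 - a n) / sqrt (n * V)) - C * (ln n)^2 / sqrt n \<and>
    2 / n + (Qfun ((sqrt (n * V) * x + D * (ln n)^2 - a n - ln (3 * real n)) / sqrt (n * V)) + C * (ln n)^2 / sqrt n) \<le> Qfun x"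
    using Qfun_inversion[OF V(2) C(1) N, where x = x] by blast
  define c where "c n = cap_star M H \<sigma> - sqrt (V / real n) * x" for n :: nat
  define r where "r n = D * (ln (real n))^2 / real n" for n :: nat
  have nt: "(\<integral>\<^sup>+\<omega>. ennreal (tailprob n \<sigma> (L.S n \<omega> + s)) \<partial>M) = ennreal (\<integral>\<omega>. tailprob n \<sigma> (L.S n \<omega> + s) \<partial>M)"
    "0 \<le> (\<integral>\<omega>. tailprob n \<sigma> (L.S n \<omega> + s) \<partial>M)" for n s
  proof -
    have "integrable M (\<lambda>x. tailprob n \<sigma> (L.S n x + s))"
      by (rule integrable_const_bound[of _ 1])
        (use tailprob_bounds[OF \<sigma>] in \<open>auto intro!: measurable_compose[OF _ tailprob_measurable[OF \<sigma>]]\<close>)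
    then show "(\<integral>\<^sup>+\<omega>. ennreal (tailprob n \<sigma> (L.S n \<omega> + s)) \<partial>M) = ennreal (\<integral>\<omega>. tailprob n \<sigma> (L.S n \<omega> + s) \<partial>M)"
      using tailprob_bounds[OF \<sigma>] by (intro nn_integral_eq_integral) auto
    show "0 \<le> (\<integral>\<omega>. tailprob n \<sigma> (L.S n \<omega> + s) \<partial>M)"
      using tailprob_bounds[OF \<sigma>] by (intro integral_nonneg_AE) auto
  qed
  have key: "\<forall>\<^sub>F n in sequentially. opt_NLD M H \<sigma> n \<epsilon> \<le> ereal (c n + r n) \<and> ereal (c n - r n) \<le> opt_NLD M H \<sigma> n \<epsilon>"
    using D(2) eventually_ge_at_top[of 3]
  proof eventually_elim
    case (elim n)
    have n: "1 \<le> n" "2 \<le> n" "3 \<le> n" using elim by auto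
    have n0: "0 < real n" using n by simp
    have "sqrt (real n * V) = sqrt (real n * real n * (V / real n))" using n0 by (intro arg_cong[where f = sqrt]) simp
    also have "\<dots> = real n * sqrt (V / real n)" by (simp only: real_sqrt_mult real_sqrt_mult_self abs_of_nat)
    finally have sq: "real n * sqrt (V / real n) = sqrt (real n * V)" ..
    have nr: "real n * r n = D * (ln n)^2" using n0 by (simp add: r_def)
    \<comment> \<open>Translates an NLD into a threshold for Q: n times the dispersion term is sqrt
      (n V) x, and the constant in \<open>cap_star\<close> cancels the main part of
      \<open>lnvol_center\<close>, leaving \<open>a n\<close>.\<close>
    have arg: "n * \<mu> - n * (c n + t) - lnvol_center n \<sigma> = sqrt (n * V) * x - n * t - a n" for t :: real
    proof -
      have "n * c n = n * \<mu> - n / 2 * ln (2 * pi * exp 1 * \<sigma>^2) - sqrt (n * V) * x"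
        unfolding c_def cap sq[symmetric] by (simp add: algebra_simps)
      then show ?thesis unfolding a_def by (simp add: algebra_simps)
    qed
    \<comment> \<open>A constellation of larger NLD would, by the converse and the first half of
      \<open>Qfun_inversion\<close>, have error strictly above \<epsilon>.\<close>
    have "opt_NLD M H \<sigma> n \<epsilon> \<le> ereal (c n + r n)"
      unfolding opt_NLD_def
    proof (rule Sup_least)
      fix y assume "y \<in> {NLD n S | S. is_IC n S \<and> (\<forall>a. finite (S \<inter> Cb n a)) \<and> avg_err M H n \<sigma> S \<le> ennreal \<epsilon>}"
      then obtain S where S: "y = NLD n S" "is_IC n S" "\<And>a. finite (S \<inter> Cb n a)" "avg_err M H n \<sigma> S \<le> ennreal \<epsilon>" by auto
      show "y \<le> ereal (c n + r n)"
      proof (rule ccontr)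
        assume "\<not> y \<le> ereal (c n + r n)"
        then have "ereal (c n + r n) < NLD n S" using S(1) by simp
        from converse_bound[OF n(1) \<sigma> S(2,3) this posn] S(4)
        have "(\<integral>\<^sup>+\<omega>. ennreal (tailprob n \<sigma> (L.S n \<omega> + (n * \<mu> - n * (c n + r n)))) \<partial>M) \<le> ennreal \<epsilon>"
          unfolding Ssum by (simp add: add_diff_eq)
        then have "(\<integral>\<omega>. tailprob n \<sigma> (L.S n \<omega> + (n * \<mu> - n * (c n + r n))) \<partial>M) \<le> \<epsilon>"
          using nt assms(12) by (simp add: ennreal_le_iff)
        moreover have "n * \<mu> - n * (c n + r n) - lnvol_center n \<sigma> = sqrt (n * V) * x - D * (ln n)^2 - a n"
          using arg[of "r n"] unfolding nr .
        then have "\<bar>(\<integral>\<omega>. tailprob n \<sigma> (L.S n \<omega> + (n * \<mu> - n * (c n + r n))) \<partial>M) - Qfun ((sqrt (n * V) * x - D * (ln n)^2 - a n) / sqrt (n * V))\<bar>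
          \<le> C * (ln n)^2 / sqrt n"
          using C(2)[OF n(3), of "n * \<mu> - n * (c n + r n)"] by simp
        ultimately show False using elim(1) unfolding Qx by linarith
      qed
    qed
    \<comment> \<open>The second half of \<open>Qfun_inversion\<close> makes room for the 2 / n and
      \<open>ln (3 * real n)\<close> of the lattice bound.\<close>
    moreover have "ereal (c n - r n) \<le> opt_NLD M H \<sigma> n \<epsilon>"
    proof -
      obtain S where S: "is_IC n S" "\<forall>a. finite (S \<inter> Cb n a)" "ereal (c n - r n) \<le> NLD n S"
        "avg_err M H n \<sigma> S \<le> ennreal (2 / n) + (\<integral>\<^sup>+\<omega>. ennreal (tailprob n \<sigma> ((\<Sum>i<n. lnH H i \<omega>) - n * (c n - r n) - ln (3 * real n))) \<partial>M)"
        using achievability[OF M H posn n(2) \<sigma>, of "c n - r n"] by blast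
      define s where "s = n * \<mu> - n * (c n + - r n) - ln (3 * real n)"
      have "s - lnvol_center n \<sigma> = (n * \<mu> - n * (c n + - r n) - lnvol_center n \<sigma>) - ln (3 * real n)" by (simp add: s_def)
      also have "\<dots> = sqrt (n * V) * x + D * (ln n)^2 - a n - ln (3 * real n)" unfolding arg using nr by simp
      finally have s: "s - lnvol_center n \<sigma> = sqrt (n * V) * x + D * (ln n)^2 - a n - ln (3 * real n)" .
      have "avg_err M H n \<sigma> S \<le> ennreal (2 / n) + (\<integral>\<^sup>+\<omega>. ennreal (tailprob n \<sigma> (L.S n \<omega> + s)) \<partial>M)"
        using S(4) unfolding Ssum s_def by (simp add: algebra_simps)
      also have "\<dots> = ennreal (2 / n + (\<integral>\<omega>. tailprob n \<sigma> (L.S n \<omega> + s) \<partial>M))"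
        unfolding nt(1) using nt(2) by (intro ennreal_plus[symmetric]) auto
      also have "\<dots> \<le> ennreal \<epsilon>"
      proof (rule ennreal_leI)
        have "\<bar>(\<integral>\<omega>. tailprob n \<sigma> (L.S n \<omega> + s) \<partial>M) - Qfun ((sqrt (n * V) * x + D * (ln n)^2 - a n - ln (3 * real n)) / sqrt (n * V))\<bar>
          \<le> C * (ln n)^2 / sqrt n"
          using C(2)[OF n(3), of s] unfolding s .
        then show "2 / n + (\<integral>\<omega>. tailprob n \<sigma> (L.S n \<omega> + s) \<partial>M) \<le> \<epsilon>" using elim(1) unfolding Qx by linarith
      qed
      finally have "NLD n S \<le> opt_NLD M H \<sigma> n \<epsilon>" unfolding opt_NLD_def using S by (intro Sup_upper) blast
      then show ?thesis using S(3) by (rule order_trans[rotated])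
    qed
    ultimately show ?case by blast
  qed
  have fin: "\<forall>\<^sub>F n in sequentially. \<bar>opt_NLD M H \<sigma> n \<epsilon>\<bar> \<noteq> \<infinity>"
    using key by eventually_elim (auto simp: ereal_infty_less_eq)
  have "(\<lambda>n. real_of_ereal (opt_NLD M H \<sigma> n \<epsilon>) - c n) \<in> O(\<lambda>n. (ln (real n))^2 / real n)"
  proof (rule bigoI)
    show "\<forall>\<^sub>F n in sequentially. norm (real_of_ereal (opt_NLD M H \<sigma> n \<epsilon>) - c n) \<le> D * norm ((ln (real n))^2 / real n)"
      using key
    proof eventually_elim
      case (elim n)
      then obtain z where z: "opt_NLD M H \<sigma> n \<epsilon> = ereal z" by (cases "opt_NLD M H \<sigma> n \<epsilon>") auto
      then have "\<bar>z - c n\<bar> \<le> r n" using elim by (auto simp: abs_le_iff)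
      then show ?case using z by (simp add: r_def)
    qed
  qed
  then show ?thesis
    using L.R_summable L.variance_limit fin unfolding var v c_def V_def x_def by blast
qed

end
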